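(* Let $d\ge1$, $T>0$, $\mathcal{T}=(0,T)$, $\overline{\mathcal{T}}=[0,T]$. Let $2\sigma\in(0,1)$, let $\nu$ be a Lévy measure (of order less than one) on $\mathbb{R}^d$ and $K\ge0$ a constant such that $$\int_{B_1}\Big(1\wedge\frac{|z|^{p}}{r^{p}}\Big)\,\nu(dz)\le\frac{K}{p-2\sigma}\,r^{-2\sigma}\qquad\text{for every } p\in(2\sigma,1],\ r\in(0,1),$$ and let $\mathcal{L}\phi(x)=\int_{\mathbb{R}^d}\big(\phi(x+z)-\phi(x)\big)\,\nu(dz)$. Let $m_0\in\mathcal{P}(\mathbb{R}^d)$. Let $b:\mathcal{T}\times\mathbb{R}^d\to[0,B]$ be continuous, where $B\in[0,\infty)$, and assume $b\in B(\mathcal{T},\mathcal{C}^{\beta}_b(\mathbb{R}^d))$ for some $\beta>0$. Assume that either (i) $2\sigma\in\big(0,\frac{3-\sqrt5}{2}\big)$ and $\beta\in\big(2\sigma+\frac{2\sigma}{1-2\sigma},1\big]$; or (ii) $\nu$ is symmetric at the origin, $2\sigma\in\big(0,\frac{5-\sqrt{17}}{2}\big)$, and $\beta\in\big(2\sigma+\frac{2\sigma}{1-\sigma},1\big]$. Then the Fokker--Planck problem $$\partial_tm-\mathcal{L}^*(bm)=0\ \text{ on }\mathcal{T}\times\mathbb{R}^d,\qquad m(0)=m_0\ \text{ on }\mathbb{R}^d,$$ has precisely one very weak solution.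
   Context: $B_r(x)$ is the ball of radius $r$ centred at $x$, $B_r=B_r(0)$. A Lévy measure (of order less than one) is a non-negative Radon measure $\nu$ on $\mathbb{R}^d$ with $\nu(\{0\})=0$ and $\int_{\mathbb{R}^d}(1\wedge|z|)\,\nu(dz)<\infty$. It is symmetric at the origin if $\nu(A)=\nu(-A)$ for every (Borel) $A\subset B_1$. $\mathcal{L}^*$ is the formal adjoint of $\mathcal{L}$. For $\beta\in(0,1]$: $[\phi]_\beta=\sup_{x\in\mathbb{R}^d}\sup_{y\in B_1(x)\setminus\{x\}}\frac{|\phi(x)-\phi(y)|}{|x-y|^\beta}$, $\|\phi\|_\beta=\|\phi\|_{L^\infty}+[\phi]_\beta$, $\mathcal{C}^\beta_b(\mathbb{R}^d)=\{\phi:\|\phi\|_\beta<\infty\}$. For a normed space $X$, $B(\mathcal{T},X)$ is the space of functions $u:\mathcal{T}\to X$ with $\sup_{t\in\mathcal{T}}\|u(t)\|_X<\infty$. $\mathcal{P}(\mathbb{R}^d)$ is the set of Borel probability measures on $\mathbb{R}^d$ with the topology of weak (narrow) convergence, and $C(\overline{\mathcal{T}},\mathcal{P}(\mathbb{R}^d))$ is the space of continuous curves in it. A very weak solution is an $m\in C(\overline{\mathcal{T}},\mathcal{P}(\mathbb{R}^d))$ solving the problem in the sense of distributions: for every $\varphi\in C_c^\infty(\overline{\mathcal{T}}\times\mathbb{R}^d)$ and $t\in\overline{\mathcal{T}}$, $\int\varphi(t)\,dm(t)=\int\varphi(0)\,dm_0+\int_0^t\int\big(\partial_t\varphi+b\,\mathcal{L}\varphi\big)(\tau,x)\,m(\tau,dx)\,d\tau$.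 *)

theory Defs
  imports "HOL-Probability.Probability"
begin

section \<open>Levy measures and the nonlocal operator\<close>

text \<open>
  As usual for Levy measures, the Radon property is understood on the complement of the
  origin: infinite mass near 0 is allowed, as for the density \<open>1 / norm z powr (d + 2 * \<sigma>)\<close>.
  Local finiteness there follows from the integrability condition, see
  \<open>levy_measure_finite_on_compact\<close> below; inner regularity is then automatic for Borel measures.
\<close>

definition levy_measure :: "'a::euclidean_space measure \<Rightarrow> bool" where
  "levy_measure \<nu> \<longleftrightarrow>
     sets \<nu> = sets borel \<and> emeasure \<nu> {0} = 0 \<and> (\<integral>\<^sup>+z. ennreal (min 1 (norm z)) \<partial>\<nu>) < \<infinity>"

lemma levy_measure_finite_on_compact:
  fixes \<nu> :: "'a::euclidean_space measure"
  assumes \<nu>: "levy_measure \<nu>" and K: "compact K" "0 \<notin> K"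
  shows "emeasure \<nu> K < \<infinity>"
proof -
  have sets[measurable_cong]: "sets \<nu> = sets borel"
    and fin: "(\<integral>\<^sup>+z. ennreal (min 1 (norm z)) \<partial>\<nu>) < \<infinity>"
    using \<nu> by (auto simp: levy_measure_def)
  have Kc: "closed K" using K compact_imp_closed by blast
  have KS: "K \<in> sets \<nu>" using Kc sets by auto
  have "0 \<in> - K" "open (- K)" using K Kc by auto
  then obtain e where e: "e > 0" "ball 0 e \<subseteq> - K" by (meson openE)
  define c where "c = min 1 e"
  have c: "c > 0" using e by (auto simp: c_def)
  have *: "ennreal c * indicator K z \<le> ennreal (min 1 (norm z))" for z
  proof (cases "z \<in> K")
    case True
    then have "e \<le> norm z" using e(2) by (auto simp: subset_eq not_less[symmetric])
    then show ?thesis using True by (auto simp: c_def intro!: ennreal_leI)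
  qed auto
  have "ennreal c * emeasure \<nu> K = (\<integral>\<^sup>+z. ennreal c * indicator K z \<partial>\<nu>)"
    using KS by (simp add: nn_integral_cmult_indicator)
  also have "\<dots> \<le> (\<integral>\<^sup>+z. ennreal (min 1 (norm z)) \<partial>\<nu>)"
    by (intro nn_integral_mono *)
  finally have "ennreal c * emeasure \<nu> K < \<infinity>" using fin by order
  then show ?thesis using c
    by (auto simp: ennreal_mult_less_top less_top[symmetric] top_unique ennreal_mult_eq_top_iff)
qed

definition symmetric_at_origin :: "'a::euclidean_space measure \<Rightarrow> bool" where
  "symmetric_at_origin \<nu> \<longleftrightarrow>
     (\<forall>A \<in> sets borel. A \<subseteq> ball 0 1 \<longrightarrow> emeasure \<nu> A = emeasure \<nu> (uminus ` A))"

definition levy_op :: "'a::euclidean_space measure \<Rightarrow> ('a \<Rightarrow> real) \<Rightarrow> 'a \<Rightarrow> real" where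
  "levy_op \<nu> \<phi> x = (\<integral>z. (\<phi> (x + z) - \<phi> x) \<partial>\<nu>)"

section \<open>Hoelder norms\<close>

definition holder_seminorm :: "real \<Rightarrow> ('a::euclidean_space \<Rightarrow> real) \<Rightarrow> ennreal" where
  "holder_seminorm \<beta> \<phi> =
     (SUP x. SUP y \<in> ball x 1 - {x}. ennreal (\<bar>\<phi> x - \<phi> y\<bar> / norm (x - y) powr \<beta>))"

definition holder_norm :: "real \<Rightarrow> ('a::euclidean_space \<Rightarrow> real) \<Rightarrow> ennreal" where
  "holder_norm \<beta> \<phi> = esssup lborel (\<lambda>x. ennreal \<bar>\<phi> x\<bar>) + holder_seminorm \<beta> \<phi>"

text \<open>
  \<open>bounded_curves I N\<close> is the space \<open>B(I, X)\<close> for the normed space \<open>X\<close> of all functions whose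
  extended norm \<open>N\<close> is finite; that \<open>u\<close> maps \<open>I\<close> into \<open>X\<close> follows from the finite supremum.
\<close>

definition bounded_curves :: "real set \<Rightarrow> ('x \<Rightarrow> ennreal) \<Rightarrow> (real \<Rightarrow> 'x) set" where
  "bounded_curves I N = {u. (SUP t\<in>I. N (u t)) < \<infinity>}"

section \<open>Test functions\<close>

primrec Ck :: "nat \<Rightarrow> ('a::euclidean_space \<Rightarrow> real) \<Rightarrow> bool" where
  "Ck 0 f \<longleftrightarrow> continuous_on UNIV f"
| "Ck (Suc k) f \<longleftrightarrow>
     (\<forall>x. f differentiable at x) \<and> (\<forall>v. Ck k (\<lambda>x. frechet_derivative f (at x) v))"

definition Cc_infty :: "('a::euclidean_space \<Rightarrow> real) set" where
  "Cc_infty = {f. (\<forall>k. Ck k f) \<and> compact (closure {x. f x \<noteq> 0})}"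

section \<open>Probability measures with the narrow topology\<close>

definition borel_probs :: "'a::euclidean_space measure set" where
  "borel_probs = {\<mu>. sets \<mu> = sets borel \<and> prob_space \<mu>}"

definition narrow_topology :: "'a::euclidean_space measure topology" where
  "narrow_topology = topology_generated_by
     {{\<mu> \<in> borel_probs. (\<integral>x. f x \<partial>\<mu>) \<in> U} | (f :: 'a \<Rightarrow> real) U.
        continuous_on UNIV f \<and> bounded (range f) \<and> open U}"

text \<open>
  Curves on \<open>{0..T}\<close> are represented by functions that are \<open>undefined\<close> elsewhere, so that
  equality of curves is equality of HOL functions.
\<close>

definition narrow_curves :: "real \<Rightarrow> (real \<Rightarrow> 'a::euclidean_space measure) set" where
  "narrow_curves T =
     {m \<in> extensional {0..T}. continuous_map (top_of_set {0..T}) narrow_topology m}"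

section \<open>Very weak solutions of the Fokker--Planck problem\<close>

text \<open>
  A smooth compactly supported function on \<open>{0..T} \<times> UNIV\<close> is the restriction of a smooth compactly
  supported function on the whole of \<open>UNIV \<times> UNIV\<close> (it need not vanish at times 0 and T); only its
  values at times in \<open>{0..T}\<close> matter below. The coefficient \<open>b\<close> is given only on the open time
  interval, hence the integration over \<open>{0<..<t}\<close>.
\<close>

definition very_weak_solution ::
  "real \<Rightarrow> 'a::euclidean_space measure \<Rightarrow> (real \<Rightarrow> 'a \<Rightarrow> real) \<Rightarrow> 'a measure
     \<Rightarrow> (real \<Rightarrow> 'a measure) \<Rightarrow> bool" where
  "very_weak_solution T \<nu> b m0 m \<longleftrightarrow>
     m \<in> narrow_curves T \<and>
     (\<forall>\<phi> \<in> Cc_infty. \<forall>t \<in> {0..T}.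
        (\<integral>x. \<phi> (t, x) \<partial>m t) =
        (\<integral>x. \<phi> (0, x) \<partial>m0) +
        (LINT \<tau>:{0<..<t}|lborel.
           (\<integral>x. deriv (\<lambda>s. \<phi> (s, x)) \<tau> + b \<tau> x * levy_op \<nu> (\<lambda>y. \<phi> (\<tau>, y)) x \<partial>m \<tau>)))"

end

theory Submission
  imports Defs
begin

text \<open>
  In both alternatives \<open>2 * \<sigma> < \<beta> \<le> 1\<close>, so \<open>p = \<beta>\<close> is admissible in the bound on \<open>\<nu>\<close>, and
  \<open>M = \<integral> min 1 (|z| powr \<beta>) d\<nu>\<close> is finite. Thus \<open>\<L>\<close> is defined on bounded \<open>\<beta>\<close>-Hoelder functions, and
  the coefficient \<open>b\<close> has exactly the regularity of the functions on which \<open>b \<L>\<close> is to be evaluated.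
  Measure such functions by \<open>2 a + c\<close>, where \<open>a\<close> bounds the values and \<open>c\<close> is a Hoelder constant.

  The heart of the proof is an estimate that sees no derivative and no maximum principle. Let \<open>L\<^sub>r\<close> keep only
  the jumps of length at least \<open>r\<close>, and let \<open>\<alpha> \<ge> B \<nu>(|z| \<ge> r)\<close>. Then \<open>S u = u + b L\<^sub>r u / \<alpha>\<close> averages values
  of \<open>u\<close>, so that \<open>|S u| \<le> a\<close>. Comparing \<open>S u\<close> at two points \<open>x\<close> and \<open>y\<close> with the same jumps, the averages
  differ by at most \<open>c |x - y| powr \<beta>\<close>, and what is left is \<open>(b x - b y) L\<^sub>r u x / \<alpha>\<close>, which the Hoelder
  continuity of \<open>b\<close> controls. So \<open>2 a + c\<close> grows at most by the factor \<open>1 + \<kappa> / \<alpha>\<close>, where \<open>\<kappa> = H M\<close> does not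
  depend on \<open>r\<close> (lemma \<open>shift_operator_holder\<close>).

  Let now \<open>D\<^sub>t u\<close> be the difference of the integrals of \<open>u\<close> against two curves that solve the equation up to an
  error \<open>\<delta>\<close>. Damping with rate \<open>\<alpha>\<close> in the variation of constants formula writes \<open>D\<^sub>t u\<close> as a weighted time integral
  of \<open>D\<^sub>s (S u)\<close>, up to the effect of the small jumps, which is of the order of
  \<open>small r = \<integral> 1_{|z| < r} min 1 (|z| powr \<beta>) d\<nu>\<close>. Iteration of this contraction yields
  \<open>|D\<^sub>t u| \<le> exp ((\<kappa> + 1) T) (2 B small r + \<delta> C\<^sub>r) (2 a + c)\<close>, lemma \<open>stability\<close>.

  Uniqueness is the case \<open>\<delta> = 0\<close> and \<open>r \<rightarrow> 0\<close>: very weak solutions may be tested with Hoelder functions, since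
  mollification and truncation keep the Hoelder constants bounded (lemma \<open>weak_solution_holder_test\<close>).

  For existence, an Euler scheme with jumps of length at least \<open>r\<close> produces curves of probability measures that
  solve the equation up to any prescribed \<open>\<delta>\<close> (lemma \<open>approximate_solution\<close>). By stability, taking first \<open>\<delta> \<rightarrow> 0\<close>
  and then \<open>r \<rightarrow> 0\<close>, their integrals form Cauchy sequences for every Hoelder function. The limit functionals are
  tight, because \<open>\<L>\<close> is small on cutoff functions that vary slowly, hence they are represented by probability
  measures (\<open>integral_representing\<close>). The limit curve solves the equation for test functions that do not depend on
  time; for a time-dependent one the defect of the equation between \<open>s\<close> and \<open>t\<close> is \<open>O((t - s)\<^sup>2)\<close>, hence zero
  (lemma \<open>holder_solution_weak\<close>).
\<close>

section \<open>Smooth functions of compact support and mollifiers\<close>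

text \<open>The induction step for \<open>Ck\<close> with a derivative that is known in closed form.\<close>

lemma Ck_SucI:
  assumes "\<And>x. (f has_derivative D x) (at x)" "\<And>v. Ck k (\<lambda>x. D x v)"
  shows "Ck (Suc k) f"
proof -
  have "frechet_derivative f (at x) = D x" for x
    using frechet_derivative_at[OF assms(1)] by simp
  then show ?thesis using assms by (auto simp: differentiable_def)
qed

lemma Ck_SucD: "Ck (Suc k) f \<Longrightarrow> (f has_derivative frechet_derivative f (at x)) (at x)"
  by (simp add: frechet_derivative_works)

lemma Ck_Suc_imp: "Ck (Suc k) f \<Longrightarrow> Ck k f"
proof (induction k arbitrary: f)
  case 0
  then show ?case
    by (auto intro!: differentiable_imp_continuous_on simp: differentiable_on_def differentiable_at_withinI)
qed auto

lemma Ck_const: "Ck k (\<lambda>x. c)"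
proof (induction k arbitrary: c)
  case (Suc k)
  show ?case by (rule Ck_SucI[where D = "\<lambda>_ _. 0"]) (use Suc in auto)
qed auto

lemma Ck_add: "Ck k f \<Longrightarrow> Ck k g \<Longrightarrow> Ck k (\<lambda>x. f x + g x)"
proof (induction k arbitrary: f g)
  case 0 then show ?case by (auto intro: continuous_intros)
next
  case (Suc k)
  show ?case
    by (rule Ck_SucI[where D = "\<lambda>x v. frechet_derivative f (at x) v + frechet_derivative g (at x) v"])
       (use Suc in \<open>auto intro!: has_derivative_add Ck_SucD[OF Suc.prems(1)] Ck_SucD[OF Suc.prems(2)]\<close>)
qed

lemma Ck_mult: "Ck k f \<Longrightarrow> Ck k g \<Longrightarrow> Ck k (\<lambda>x. f x * g x)"
proof (induction k arbitrary: f g)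
  case 0 then show ?case by (auto intro: continuous_intros)
next
  case (Suc k)
  note D = Ck_SucD[OF Suc.prems(1)] Ck_SucD[OF Suc.prems(2)]
  show ?case
  proof (rule Ck_SucI)
    show "((\<lambda>x. f x * g x) has_derivative
        (\<lambda>v. f x * frechet_derivative g (at x) v + frechet_derivative f (at x) v * g x)) (at x)" for x
      by (rule has_derivative_mult[OF D])
    show "Ck k (\<lambda>x. f x * frechet_derivative g (at x) v + frechet_derivative f (at x) v * g x)" for v
      using Suc.prems Ck_Suc_imp[OF Suc.prems(1)] Ck_Suc_imp[OF Suc.prems(2)]
      by (intro Ck_add Suc.IH) auto
  qed
qed

lemma Ck_linear: "bounded_linear f \<Longrightarrow> Ck k f"
proof (cases k)
  case 0
  assume "bounded_linear f"
  then show ?thesis using 0 by (simp add: linear_continuous_on)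
next
  case (Suc j)
  assume f: "bounded_linear f"
  show ?thesis unfolding Suc
    by (rule Ck_SucI[where D = "\<lambda>_. f"])
       (use f in \<open>auto intro: bounded_linear_imp_has_derivative Ck_const\<close>)
qed

text \<open>
  These functions are closed under differentiation up to linear combinations, so the smoothness of
  \<open>exp (- 1 / x)\<close> (the case \<open>n = 0\<close>) is an induction over all \<open>n\<close> at once.
\<close>

definition exp_inv :: "nat \<Rightarrow> real \<Rightarrow> real" where
  "exp_inv n x = (if x > 0 then exp (- (1 / x)) / x ^ n else 0)"

lemma exp_inv_tendsto_0: "(exp_inv n \<longlongrightarrow> 0) (at 0)"
proof (rule filterlim_split_at)
  have "((\<lambda>y::real. y ^ n / exp y) \<longlongrightarrow> 0) at_top" by (rule tendsto_power_div_exp_0)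
  then have "((\<lambda>x::real. (inverse x) ^ n / exp (inverse x)) \<longlongrightarrow> 0) (at_right 0)"
    by (rule filterlim_compose[OF _ filterlim_inverse_at_top_right])
  moreover have "\<forall>\<^sub>F x in at_right 0. (inverse x) ^ n / exp (inverse x) = exp_inv n x"
    unfolding eventually_at_right_field
    by (intro exI[of _ 1]) (auto simp: exp_inv_def exp_minus field_simps power_inverse)
  ultimately show "(exp_inv n \<longlongrightarrow> 0) (at_right 0)"
    by (rule Lim_transform_eventually)
  have "\<forall>\<^sub>F x in at_left 0. 0 = exp_inv n x"
    unfolding eventually_at_left_field by (intro exI[of _ "-1"]) (auto simp: exp_inv_def)
  then show "(exp_inv n \<longlongrightarrow> 0) (at_left 0)"
    by (rule Lim_transform_eventually[OF tendsto_const])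
qed

lemma exp_inv_deriv:
  "(exp_inv n has_real_derivative exp_inv (n + 2) x - real n * exp_inv (n + 1) x) (at x)"
proof -
  consider "x > 0" | "x < 0" | "x = 0" by linarith
  then show ?thesis
  proof cases
    case 1
    have "((\<lambda>x. exp (- (1 / x)) / x ^ n) has_real_derivative
        exp (- (1 / x)) / x ^ (n + 2) - real n * (exp (- (1 / x)) / x ^ (n + 1))) (at x)"
    proof -
      have n: "real n * x ^ (n - Suc 0) = real n * x ^ n / x" using 1 by (cases n) auto
      show ?thesis
        using 1 by (auto intro!: derivative_eq_intros simp: n) (simp add: field_simps power2_eq_square)
    qed
    then have "(exp_inv n has_real_derivative
        exp (- (1 / x)) / x ^ (n + 2) - real n * (exp (- (1 / x)) / x ^ (n + 1))) (at x)"
      by (rule has_field_derivative_transform_within_open[where S = "{0<..}"])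
         (use 1 in \<open>auto simp: exp_inv_def\<close>)
    then show ?thesis using 1 by (simp add: exp_inv_def)
  next
    case 2
    have "((\<lambda>x. 0) has_real_derivative 0) (at x)" by simp
    then have "(exp_inv n has_real_derivative 0) (at x)"
      by (rule has_field_derivative_transform_within_open[where S = "{..<0}"])
         (use 2 in \<open>auto simp: exp_inv_def\<close>)
    then show ?thesis using 2 by (simp add: exp_inv_def)
  next
    case 3
    have eq: "(exp_inv n h - exp_inv n 0) / (h - 0) = exp_inv (n + 1) h" for h
      by (auto simp: exp_inv_def)
    have "((\<lambda>h. (exp_inv n h - exp_inv n 0) / (h - 0)) \<longlongrightarrow> 0) (at 0)"
      unfolding eq by (rule exp_inv_tendsto_0)
    then show ?thesis using 3 by (simp add: has_field_derivative_iff exp_inv_def)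
  qed
qed

text \<open>
  For \<open>n = 0\<close> this is the standard bump, supported in the ball of radius \<open>sqrt r\<close>. The statement is
  for all \<open>n\<close> because directional derivatives are linear functions times functions of the same family.
\<close>

lemma Ck_bump: "Ck k (\<lambda>x::'a::euclidean_space. exp_inv n (r - x \<bullet> x))"
proof (induction k arbitrary: n)
  case 0
  have "continuous_on UNIV (exp_inv n)"
    using exp_inv_deriv DERIV_isCont by (blast intro: continuous_at_imp_continuous_on)
  then have "continuous_on UNIV (exp_inv n \<circ> (\<lambda>x::'a. r - x \<bullet> x))"
    by (intro continuous_on_compose) (auto intro!: continuous_intros elim: continuous_on_subset)
  then show ?case by (simp add: o_def)
next
  case (Suc k)
  show ?case
  proof (rule Ck_SucI)
    fix x :: 'a
    have "((\<lambda>x. r - x \<bullet> x) has_derivative (\<lambda>v. - 2 * (x \<bullet> v))) (at x)"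
      by (auto intro!: derivative_eq_intros simp: inner_commute)
    from has_derivative_compose[OF this exp_inv_deriv[THEN has_field_derivative_imp_has_derivative]]
    show "((\<lambda>x::'a. exp_inv n (r - x \<bullet> x)) has_derivative
       (\<lambda>v. (exp_inv (n + 2) (r - x \<bullet> x) + (- real n) * exp_inv (n + 1) (r - x \<bullet> x)) * (- 2 * (x \<bullet> v)))) (at x)"
      by simp
  next
    show "Ck k (\<lambda>x. (exp_inv (n + 2) (r - x \<bullet> x) + (- real n) * exp_inv (n + 1) (r - x \<bullet> x)) * (- 2 * (x \<bullet> v)))"
        for v :: 'a
      by (intro Ck_mult Ck_add Ck_const Suc.IH Ck_linear[OF bounded_linear_inner_left])
  qed
qed

text \<open>
  All derivatives fall on the smooth factor, and a directional derivative of it is again smooth, so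
  the claim reproduces itself under differentiation below the integral sign.
\<close>

lemma Ck_convolution:
  fixes w :: "'a::euclidean_space \<Rightarrow> real"
  assumes w: "continuous_on UNIV w" and \<rho>: "\<And>k. Ck k \<rho>"
  shows "Ck k (\<lambda>x. integral (cbox a b) (\<lambda>y. w y * \<rho> (x - y)))"
proof -
  have D: "((\<lambda>x. integral (cbox a b) (\<lambda>y. w y * \<rho> (x - y))) has_derivative
      (\<lambda>v. integral (cbox a b) (\<lambda>y. w y * frechet_derivative \<rho> (at (x - y)) v))) (at x)"
    if \<rho>: "\<And>k. Ck k \<rho>" for \<rho> x
  proof -
    let ?D = "\<lambda>x. frechet_derivative \<rho> (at x)"
    have d: "(\<rho> has_derivative ?D x) (at x)" for x
      using Ck_SucD[OF \<rho>[of "Suc 0"]] .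
    have bl: "bounded_linear (?D x)" for x using d has_derivative_bounded_linear by blast
    define fx where "fx x y = w y *\<^sub>R Blinfun (?D (x - y))" for x y
    have fx: "blinfun_apply (fx x y) = (\<lambda>v. w y * ?D (x - y) v)" for x y
      by (auto simp: fx_def fun_eq_iff blinfun.scaleR_left bounded_linear_Blinfun_apply[OF bl])
    have cD: "continuous_on UNIV (\<lambda>x. ?D x v)" for v
      using \<rho>[of "Suc 0"] by simp
    have cB: "continuous_on UNIV (\<lambda>x. Blinfun (?D x))"
      by (rule continuous_on_blinfun_componentwise)
         (simp add: bounded_linear_Blinfun_apply[OF bl] cD)
    have c\<rho>: "continuous_on UNIV \<rho>" using \<rho>[of 0] by simp
    have cfx: "continuous_on (UNIV \<times> cbox a b) (\<lambda>(x, y). fx x y)"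
      unfolding fx_def split_beta
      by (intro continuous_intros continuous_on_compose2[OF w] continuous_on_compose2[OF cB]) auto
    have "((\<lambda>x. integral (cbox a b) (\<lambda>y. w y * \<rho> (x - y))) has_derivative
         blinfun_apply (integral (cbox a b) (fx x))) (at x within UNIV)"
    proof (rule leibniz_rule)
      show "((\<lambda>x. w y * \<rho> (x - y)) has_derivative blinfun_apply (fx x y)) (at x within UNIV)" for x y
      proof -
        have "((\<lambda>x. \<rho> (x - y)) has_derivative ?D (x - y)) (at x)"
        proof -
          have "((\<lambda>x. x - y) has_derivative (\<lambda>v. v)) (at x)"
            by (auto intro!: derivative_eq_intros)
          from has_derivative_compose[OF this d] show ?thesis by simp
        qed
        then show ?thesis unfolding fx by (auto intro!: derivative_eq_intros)
      qed
      show "(\<lambda>y. w y * \<rho> (x - y)) integrable_on cbox a b" for x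
        by (intro integrable_continuous continuous_intros continuous_on_compose2[OF w] continuous_on_compose2[OF c\<rho>])
            auto
    qed (use cfx in auto)
    moreover have "blinfun_apply (integral (cbox a b) (fx x)) v
       = integral (cbox a b) (\<lambda>y. w y * ?D (x - y) v)" for v
    proof -
      have "fx x integrable_on cbox a b"
      proof (rule integrable_continuous)
        have "continuous_on (cbox a b) ((\<lambda>(x, y). fx x y) \<circ> (\<lambda>y. (x, y)))"
          by (intro continuous_on_compose continuous_on_subset[OF cfx]) (auto intro!: continuous_intros)
        then show "continuous_on (cbox a b) (fx x)" by (simp add: o_def)
      qed
      from integral_linear[OF this blinfun.bounded_linear_left[of v]]
      show ?thesis by (simp add: fx o_def)
    qed
    ultimately show ?thesis by (metis (no_types, lifting) ext)
  qed
  show ?thesis using \<rho>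
  proof (induction k arbitrary: \<rho>)
    case 0
    have "(\<lambda>x. integral (cbox a b) (\<lambda>y. w y * \<rho> (x - y))) differentiable (at x)" for x
      using D[OF 0] by (auto simp: differentiable_def)
    then show ?case
      by (auto intro!: differentiable_imp_continuous_on simp: differentiable_on_def differentiable_at_withinI)
  next
    case (Suc k)
    show ?case
    proof (rule Ck_SucI[OF D[OF Suc.prems]])
      fix v
      have "Ck j (\<lambda>x. frechet_derivative \<rho> (at x) v)" for j
        using Suc.prems[of "Suc j"] by simp
      from Suc.IH[OF this]
      show "Ck k (\<lambda>x. integral (cbox a b) (\<lambda>y. w y * frechet_derivative \<rho> (at (x - y)) v))" .
    qed
  qed
qed

text \<open>
  The normalised bump as the law of a small random displacement. In this form bounds, Hoelder
  estimates and local constancy pass to the mollified function by monotonicity of the integral.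
\<close>

lemma exists_mollifier:
  fixes \<epsilon> :: real
  assumes "\<epsilon> > 0"
  obtains \<pi> :: "'a::euclidean_space measure" where
    "prob_space \<pi>" "sets \<pi> = sets borel" "AE y in \<pi>. norm y < \<epsilon>"
    "\<And>w. continuous_on UNIV w \<Longrightarrow> bounded {x. w x \<noteq> 0} \<Longrightarrow> (\<lambda>x. \<integral>y. w (x - y) \<partial>\<pi>) \<in> Cc_infty"
proof -
  define \<rho>0 where "\<rho>0 x = exp_inv 0 (\<epsilon>\<^sup>2 - x \<bullet> x)" for x :: 'a
  have Ck0: "Ck k \<rho>0" for k unfolding \<rho>0_def by (rule Ck_bump)
  have c0: "continuous_on UNIV \<rho>0" using Ck0[of 0] by simp
  have [measurable]: "\<rho>0 \<in> borel_measurable borel" using c0 by (rule borel_measurable_continuous_onI)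
  have nz: "\<rho>0 x \<noteq> 0 \<longleftrightarrow> norm x < \<epsilon>" for x
    using assms by (auto simp: \<rho>0_def exp_inv_def power2_norm_eq_inner[symmetric] power_mono_iff
        intro: power_strict_mono dest: power_less_imp_less_base)
  have nn: "\<rho>0 x \<ge> 0" for x by (auto simp: \<rho>0_def exp_inv_def)
  have le1: "\<rho>0 x \<le> 1" for x by (auto simp: \<rho>0_def exp_inv_def)
  have int0: "integrable lborel \<rho>0"
  proof (rule Bochner_Integration.integrable_bound)
    show "integrable lborel (indicator (ball (0::'a) \<epsilon>) :: 'a \<Rightarrow> real)"
      using emeasure_lborel_ball_finite[of 0 \<epsilon>] by (intro integrable_real_indicator) auto
    show "AE x in lborel. norm (\<rho>0 x) \<le> norm (indicator (ball 0 \<epsilon>) x :: real)"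
    proof (rule AE_I2)
      fix x :: 'a
      show "norm (\<rho>0 x) \<le> norm (indicator (ball 0 \<epsilon>) x :: real)"
        using nn[of x] le1[of x] nz[of x] by (auto simp: indicator_def)
    qed
  qed simp
  define c where "c = (\<integral>x. \<rho>0 x \<partial>lborel)"
  have cpos: "c > 0"
  proof -
    have "c \<ge> 0" unfolding c_def using nn by simp
    moreover have "c \<noteq> 0"
    proof
      assume "c = 0"
      then have "AE x in lborel. \<rho>0 x = 0"
        unfolding c_def using integral_nonneg_eq_0_iff_AE[OF int0] nn by auto
      then have "AE x in lborel. x \<notin> ball (0::'a) \<epsilon>" using nz by (auto elim!: eventually_mono)
      then have "ball (0::'a) \<epsilon> \<in> null_sets lborel" by (subst (asm) AE_iff_null_sets[symmetric]) auto
      then show False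
        using content_ball_pos[OF assms, of "0::'a"] by (auto simp: null_sets_def measure_def)
    qed
    ultimately show ?thesis by simp
  qed
  define \<rho> where "\<rho> x = \<rho>0 x * (1 / c)" for x
  have Ck: "Ck k \<rho>" for k unfolding \<rho>_def by (intro Ck_mult Ck0 Ck_const)
  have [measurable]: "\<rho> \<in> borel_measurable borel" unfolding \<rho>_def by measurable
  have \<rho>nn: "\<rho> x \<ge> 0" for x using nn cpos by (simp add: \<rho>_def)
  have \<rho>int: "integrable lborel \<rho>" unfolding \<rho>_def using int0 by simp
  have \<rho>1: "(\<integral>x. \<rho> x \<partial>lborel) = 1" unfolding \<rho>_def using cpos by (simp add: c_def[symmetric])
  define \<pi> where "\<pi> = density lborel (\<lambda>x. ennreal (\<rho> x))"
  show thesis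
  proof
    show "prob_space \<pi>"
    proof
      show "emeasure \<pi> (space \<pi>) = 1"
        using nn_integral_eq_integral[OF \<rho>int] \<rho>nn \<rho>1 by (simp add: \<pi>_def emeasure_density)
    qed
    show "sets \<pi> = sets borel" by (simp add: \<pi>_def)
    show "AE y in \<pi>. norm y < \<epsilon>"
    proof -
      have "0 < \<rho> x \<Longrightarrow> norm x < \<epsilon>" for x
        using nz[of x] nn[of x] cpos by (auto simp: \<rho>_def)
      then show ?thesis unfolding \<pi>_def by (subst AE_density) auto
    qed
  next
    fix w :: "'a \<Rightarrow> real" assume w: "continuous_on UNIV w" "bounded {x. w x \<noteq> 0}"
    have [measurable]: "w \<in> borel_measurable borel" using w by (intro borel_measurable_continuous_onI)
    obtain a b where ab: "{x. w x \<noteq> 0} \<subseteq> cbox a b" using w bounded_subset_cbox_symmetric by blast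
    obtain K where K: "\<And>x. w x \<noteq> 0 \<Longrightarrow> norm x \<le> K" using w(2) by (auto simp: bounded_iff)
    have eq: "(\<integral>y. w (x - y) \<partial>\<pi>) = integral (cbox a b) (\<lambda>y. w y * \<rho> (x - y))" for x
    proof -
      have "(\<integral>y. w (x - y) \<partial>\<pi>) = (\<integral>y. \<rho> y * w (x - y) \<partial>lborel)"
        unfolding \<pi>_def by (subst integral_real_density) (auto simp: \<rho>nn)
      also have "\<dots> = (\<integral>y. \<rho> (x + (-1) *\<^sub>R y) * w (x - (x + (-1) *\<^sub>R y)) \<partial>lborel)"
        by (subst lborel_affine[of "-1" x], simp, subst integral_density)
           (auto simp: integral_distr)
      also have "\<dots> = (\<integral>y. w y * \<rho> (x - y) \<partial>lborel)" by (simp add: mult.commute)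
      also have "\<dots> = (\<integral>y\<in>cbox a b. w y * \<rho> (x - y) \<partial>lborel)"
        unfolding set_lebesgue_integral_def
        by (intro Bochner_Integration.integral_cong) (use ab in \<open>auto simp: indicator_def\<close>)
      also have "\<dots> = integral (cbox a b) (\<lambda>y. w y * \<rho> (x - y))"
      proof (rule set_borel_integral_eq_integral)
        have "continuous_on UNIV \<rho>" using Ck[of 0] by simp
        then have "continuous_on (cbox a b) (\<lambda>y. \<rho> (x - y))"
          by (rule continuous_on_compose2) (auto intro!: continuous_intros)
        then have "continuous_on (cbox a b) (\<lambda>y. w y * \<rho> (x - y))"
          by (intro continuous_on_mult continuous_on_subset[OF w(1)]) (auto intro!: continuous_intros)
        then show "set_integrable lborel (cbox a b) (\<lambda>y. w y * \<rho> (x - y))"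
          unfolding set_integrable_def by (intro borel_integrable_compact compact_cbox)
      qed
      finally show ?thesis .
    qed
    have "{x. (\<integral>y. w (x - y) \<partial>\<pi>) \<noteq> 0} \<subseteq> cball 0 (K + \<epsilon>)"
    proof safe
      fix x assume "(\<integral>y. w (x - y) \<partial>\<pi>) \<noteq> 0"
      then have "integral (cbox a b) (\<lambda>y. w y * \<rho> (x - y)) \<noteq> 0" by (simp add: eq)
      then obtain y where "w y * \<rho> (x - y) \<noteq> 0" by (metis (no_types, lifting)
          Henstock_Kurzweil_Integration.integral_cong integral_0)
      then have "norm y \<le> K" "norm (x - y) < \<epsilon>" using K nz by (auto simp: \<rho>_def)
      then show "x \<in> cball 0 (K + \<epsilon>)" using norm_triangle_ineq2[of x y] by simp
    qed
    then have "bounded {x. (\<integral>y. w (x - y) \<partial>\<pi>) \<noteq> 0}" using bounded_cball bounded_subset by blast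
    then show "(\<lambda>x. \<integral>y. w (x - y) \<partial>\<pi>) \<in> Cc_infty"
      unfolding Cc_infty_def using Ck_convolution[OF w(1) Ck, of _ a b]
      by (simp add: eq compact_closure)
  qed
qed

section \<open>Bounded Lipschitz functions and narrow convergence\<close>

definition bounded_lipschitz :: "('a::metric_space \<Rightarrow> real) \<Rightarrow> bool" where
  "bounded_lipschitz f \<longleftrightarrow>
     (\<exists>M L. \<forall>x y. \<bar>f x\<bar> \<le> M \<and> \<bar>f x - f y\<bar> \<le> L * dist x y)"

lemma bounded_lipschitzI:
  "(\<And>x. \<bar>f x\<bar> \<le> M) \<Longrightarrow> (\<And>x y. \<bar>f x - f y\<bar> \<le> L * dist x y) \<Longrightarrow> bounded_lipschitz f"
  unfolding bounded_lipschitz_def by (intro exI[of _ M] exI[of _ L] allI conjI)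

lemma bounded_lipschitzE:
  assumes "bounded_lipschitz f"
  obtains M L where "M \<ge> 0" "L \<ge> 0" "\<And>x. \<bar>f x\<bar> \<le> M" "\<And>x y. \<bar>f x - f y\<bar> \<le> L * dist x y"
proof -
  from assms obtain M L where "\<forall>x y. \<bar>f x\<bar> \<le> M \<and> \<bar>f x - f y\<bar> \<le> L * dist x y"
    unfolding bounded_lipschitz_def by (elim exE)
  then have *: "\<And>x. \<bar>f x\<bar> \<le> M" "\<And>x y. \<bar>f x - f y\<bar> \<le> L * dist x y" by simp_all
  have "\<bar>f x - f y\<bar> \<le> \<bar>L\<bar> * dist x y" for x y
    using *(2)[of x y] mult_right_mono[OF abs_ge_self[of L], of "dist x y"] by simp
  then show ?thesis using *(1) order_trans[OF abs_ge_zero *(1)] by (intro that[of "M" "\<bar>L\<bar>"]) simp_all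
qed

lemma bounded_lipschitz_const: "bounded_lipschitz (\<lambda>x. c)"
  by (rule bounded_lipschitzI[of _ "\<bar>c\<bar>" 0]) auto

text \<open>One estimate for all the pointwise operations below; \<open>h\<close> need only be Lipschitz in both arguments.\<close>

lemma bounded_lipschitz_compose2:
  assumes f: "bounded_lipschitz f" and g: "bounded_lipschitz g"
    and h: "\<And>a b a' b'. \<bar>h a b - h a' b'\<bar> \<le> C * (\<bar>a - a'\<bar> + \<bar>b - b'\<bar>)" and C: "C \<ge> 0"
  shows "bounded_lipschitz (\<lambda>x. h (f x) (g x) :: real)"
proof -
  obtain M L where f': "M \<ge> 0" "L \<ge> 0" "\<And>x. \<bar>f x\<bar> \<le> M" "\<And>x y. \<bar>f x - f y\<bar> \<le> L * dist x y"
    by (rule bounded_lipschitzE[OF f]) (rule that)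
  obtain N K where g': "N \<ge> 0" "K \<ge> 0" "\<And>x. \<bar>g x\<bar> \<le> N" "\<And>x y. \<bar>g x - g y\<bar> \<le> K * dist x y"
    by (rule bounded_lipschitzE[OF g]) (rule that)
  show ?thesis
  proof (rule bounded_lipschitzI)
    fix x
    have "\<bar>h (f x) (g x) - h 0 0\<bar> \<le> C * (\<bar>f x\<bar> + \<bar>g x\<bar>)" using h[of "f x" "g x" 0 0] by simp
    also have "\<dots> \<le> C * (M + N)" using f' g' C by (intro mult_left_mono add_mono) auto
    finally show "\<bar>h (f x) (g x)\<bar> \<le> \<bar>h 0 0\<bar> + C * (M + N)" by linarith
  next
    fix x y
    have "\<bar>h (f x) (g x) - h (f y) (g y)\<bar> \<le> C * (\<bar>f x - f y\<bar> + \<bar>g x - g y\<bar>)" by (rule h)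
    also have "\<dots> \<le> C * (L * dist x y + K * dist x y)" using f' g' C by (intro mult_left_mono add_mono) auto
    finally show "\<bar>h (f x) (g x) - h (f y) (g y)\<bar> \<le> (C * (L + K)) * dist x y" by (simp add: algebra_simps)
  qed
qed

lemma bounded_lipschitz_add:
  "bounded_lipschitz f \<Longrightarrow> bounded_lipschitz g \<Longrightarrow> bounded_lipschitz (\<lambda>x. f x + g x)"
  by (rule bounded_lipschitz_compose2[where C = 1 and h = "\<lambda>a b. a + b"]) (auto)

lemma bounded_lipschitz_diff:
  "bounded_lipschitz f \<Longrightarrow> bounded_lipschitz g \<Longrightarrow> bounded_lipschitz (\<lambda>x. f x - g x)"
  by (rule bounded_lipschitz_compose2[where C = 1 and h = "\<lambda>a b. a - b"]) (auto)

lemma bounded_lipschitz_max: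
  "bounded_lipschitz f \<Longrightarrow> bounded_lipschitz g \<Longrightarrow> bounded_lipschitz (\<lambda>x. max (f x) (g x))"
  by (rule bounded_lipschitz_compose2[where C = 1 and h = "\<lambda>a b. max a b"]) (auto simp: max_def)

lemma bounded_lipschitz_min:
  "bounded_lipschitz f \<Longrightarrow> bounded_lipschitz g \<Longrightarrow> bounded_lipschitz (\<lambda>x. min (f x) (g x))"
  by (rule bounded_lipschitz_compose2[where C = 1 and h = "\<lambda>a b. min a b"]) (auto simp: min_def)

lemma bounded_lipschitz_cmult:
  assumes "bounded_lipschitz f" shows "bounded_lipschitz (\<lambda>x. c * f x)"
  by (rule bounded_lipschitz_compose2[OF assms assms, where C = "\<bar>c\<bar>" and h = "\<lambda>a b. c * a"])
     (auto simp: right_diff_distrib[symmetric] abs_mult intro!: mult_left_mono)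

lemma bounded_lipschitz_sum:
  "(\<And>i. i \<in> I \<Longrightarrow> bounded_lipschitz (f i)) \<Longrightarrow> bounded_lipschitz (\<lambda>x. \<Sum>i\<in>I. f i x)"
  by (induction I rule: infinite_finite_induct)
     (auto intro: bounded_lipschitz_add bounded_lipschitz_const)

lemmas bounded_lipschitz_intros = bounded_lipschitz_const bounded_lipschitz_add
  bounded_lipschitz_diff bounded_lipschitz_max bounded_lipschitz_min bounded_lipschitz_cmult
  bounded_lipschitz_sum

lemma bounded_lipschitz_continuous_on:
  assumes "bounded_lipschitz f" shows "continuous_on S f"
proof -
  obtain M L where "M \<ge> 0" "L \<ge> 0" "\<And>x. \<bar>f x\<bar> \<le> M" "\<And>x y. \<bar>f x - f y\<bar> \<le> L * dist x y"
    by (rule bounded_lipschitzE[OF assms]) (rule that)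
  then have "L-lipschitz_on S f" by (auto simp: lipschitz_on_def dist_real_def)
  then show ?thesis by (rule lipschitz_on_continuous_on)
qed

lemma bounded_lipschitz_measurable:
  fixes f :: "'a::metric_space \<Rightarrow> real"
  shows "bounded_lipschitz f \<Longrightarrow> f \<in> borel_measurable borel"
  by (intro borel_measurable_continuous_onI bounded_lipschitz_continuous_on)

text \<open>The case distinction is needed because \<open>infdist x {} = 0\<close>.\<close>

definition bump_inside :: "'a::metric_space set \<Rightarrow> nat \<Rightarrow> 'a \<Rightarrow> real" where
  "bump_inside U k x = (if U = UNIV then 1 else min 1 (real k * infdist x (- U)))"

lemma bounded_lipschitz_bump_inside: "bounded_lipschitz (bump_inside U k)"
proof (cases "U = UNIV")
  case True
  then have "bump_inside U k = (\<lambda>x. 1)" by (simp add: bump_inside_def fun_eq_iff)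
  then show ?thesis by (simp add: bounded_lipschitz_const)
next
  case False
  have "\<bar>min 1 (real k * infdist x (- U)) - min 1 (real k * infdist y (- U))\<bar> \<le> real k * dist x y" for x y
  proof -
    have "\<bar>infdist x (- U) - infdist y (- U)\<bar> \<le> dist x y"
      using infdist_triangle[of x "- U" y] infdist_triangle[of y "- U" x] by (simp add: dist_commute abs_le_iff)
    then have "real k * \<bar>infdist x (- U) - infdist y (- U)\<bar> \<le> real k * dist x y"
      by (rule mult_left_mono) simp
    then have "\<bar>real k * infdist x (- U) - real k * infdist y (- U)\<bar> \<le> real k * dist x y"
      by (simp add: abs_mult right_diff_distrib[symmetric])
    then show ?thesis by (auto simp: min_def)
  qed
  then show ?thesis using False
    by (intro bounded_lipschitzI[of _ 1 "real k"]) (auto simp: bump_inside_def infdist_nonneg)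
qed

lemma bump_inside_range: "0 \<le> bump_inside U k x" "bump_inside U k x \<le> 1"
  by (auto simp: bump_inside_def infdist_nonneg)

lemma bump_inside_outside: "x \<notin> U \<Longrightarrow> bump_inside U k x = 0"
  by (auto simp: bump_inside_def)

lemma bump_inside_mono: "k \<le> l \<Longrightarrow> bump_inside U k x \<le> bump_inside U l x"
proof -
  assume "k \<le> l"
  then have "real k * infdist x (- U) \<le> real l * infdist x (- U)"
    by (intro mult_right_mono infdist_nonneg) simp
  then show ?thesis by (auto simp: bump_inside_def)
qed

lemma bump_inside_eventually:
  assumes "open U" "x \<in> U" shows "\<forall>\<^sub>F k in sequentially. bump_inside U k x = 1"
proof (cases "U = UNIV")
  case False
  have "closed (- U)" "- U \<noteq> {}" "x \<notin> - U" using assms False by auto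
  then have pos: "infdist x (- U) > 0" by (rule infdist_pos_not_in_closed)
  obtain n :: nat where n: "real n * infdist x (- U) > 1" using reals_Archimedean3[OF pos] by blast
  have "\<forall>\<^sub>F k in sequentially. real k * infdist x (- U) \<ge> 1"
    using eventually_ge_at_top[of n]
  proof eventually_elim
    case (elim k)
    then have "real n * infdist x (- U) \<le> real k * infdist x (- U)" using pos by (intro mult_right_mono) auto
    then show ?case using n by simp
  qed
  then show ?thesis by eventually_elim (auto simp: bump_inside_def)
qed (simp add: bump_inside_def)

lemma bump_inside_LIMSEQ:
  assumes "open U" shows "(\<lambda>k. bump_inside U k x) \<longlonglongrightarrow> indicator U x"
proof (cases "x \<in> U")
  case True
  then show ?thesis using bump_inside_eventually[OF assms True] by (simp add: tendsto_eventually)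
next
  case False
  then show ?thesis by (simp add: bump_inside_outside)
qed

text \<open>
  Indicators of open sets are increasing limits of bounded Lipschitz functions, and open sets form a
  generator of the Borel sets that is stable under intersection.
\<close>

lemma prob_eqI_bounded_lipschitz:
  fixes \<mu> \<mu>' :: "'a::metric_space measure"
  assumes "prob_space \<mu>" "prob_space \<mu>'" and sets: "sets \<mu> = sets borel" "sets \<mu>' = sets borel"
    and eq: "\<And>u. bounded_lipschitz u \<Longrightarrow> (\<integral>x. u x \<partial>\<mu>) = (\<integral>x. u x \<partial>\<mu>')"
  shows "\<mu> = \<mu>'"
proof -
  interpret \<mu>: prob_space \<mu> by fact
  interpret \<mu>': prob_space \<mu>' by fact
  have lim: "(\<lambda>k. \<integral>x. bump_inside U k x \<partial>M) \<longlonglongrightarrow> measure M U"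
    if "open U" "prob_space M" "sets M = sets borel" for U and M :: "'a measure"
  proof -
    interpret M: prob_space M by fact
    note [measurable_cong] = that(3)
    have "(\<lambda>k. \<integral>x. bump_inside U k x \<partial>M) \<longlonglongrightarrow> (\<integral>x. indicator U x \<partial>M)"
    proof (rule integral_dominated_convergence[where w = "\<lambda>_. 1"])
      show "bump_inside U k \<in> borel_measurable M" for k
        using bounded_lipschitz_measurable[OF bounded_lipschitz_bump_inside] by measurable
      show "indicator U \<in> borel_measurable M" using that by (simp add: borel_measurable_indicator)
      show "AE x in M. (\<lambda>k. bump_inside U k x) \<longlonglongrightarrow> indicator U x" using bump_inside_LIMSEQ[OF that(1)] by simp
      show "AE x in M. norm (bump_inside U k x) \<le> 1" for k using bump_inside_range[of U k] by simp
    qed simp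
    moreover have "U \<in> sets M" "U \<subseteq> space M" using that by (auto simp: sets_eq_imp_space_eq[OF that(3)])
    ultimately show ?thesis by (simp add: Int_absorb2)
  qed
  show ?thesis
  proof (rule measure_eqI_generator_eq[where E = "{S. open S}" and \<Omega> = UNIV and A = "\<lambda>_. UNIV"])
    fix U :: "'a set" assume "U \<in> {S. open S}"
    then have U: "open U" by simp
    have "(\<lambda>k. \<integral>x. bump_inside U k x \<partial>\<mu>) \<longlonglongrightarrow> measure \<mu>' U"
      unfolding eq[OF bounded_lipschitz_bump_inside] by (rule lim) (use U assms in auto)
    with lim[OF U assms(1) sets(1)] have "measure \<mu> U = measure \<mu>' U" by (rule LIMSEQ_unique)
    then show "emeasure \<mu> U = emeasure \<mu>' U"
      by (simp add: \<mu>.emeasure_eq_measure \<mu>'.emeasure_eq_measure)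
  qed (auto simp: Int_stable_def sets borel_def)
qed

text \<open>
  The inf-convolutions \<open>g k x = (INF y. f y + k * dist x y)\<close>: each is \<open>k\<close>-Lipschitz, and for large \<open>k\<close> only points
  \<open>y\<close> close to \<open>x\<close> matter in the infimum, where \<open>f y\<close> is close to \<open>f x\<close>.
\<close>

lemma lipschitz_minorants:
  fixes f :: "'a::metric_space \<Rightarrow> real"
  assumes f: "continuous_on UNIV f" and M: "\<And>x. \<bar>f x\<bar> \<le> M"
  obtains g :: "nat \<Rightarrow> 'a \<Rightarrow> real" where
    "\<And>k. bounded_lipschitz (g k)" "\<And>k x. - M \<le> g k x" "\<And>k x. g k x \<le> f x"
    "\<And>x. (\<lambda>k. g k x) \<longlonglongrightarrow> f x"
proof -
  define g where "g k x = (INF y. f y + real k * dist x y)" for k x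
  have bdd: "bdd_below (range (\<lambda>y. f y + real k * dist x y))" for k x
  proof (rule bdd_belowI2)
    show "- M \<le> f y + real k * dist x y" for y
      using M[of y] mult_nonneg_nonneg[of "real k" "dist x y"] by (auto simp: abs_le_iff simp del: mult_nonneg_nonneg)
  qed
  have ge: "- M \<le> g k x" for k x
    unfolding g_def
  proof (rule cINF_greatest)
    show "- M \<le> f y + real k * dist x y" for y
      using M[of y] mult_nonneg_nonneg[of "real k" "dist x y"] by (auto simp: abs_le_iff simp del: mult_nonneg_nonneg)
  qed simp
  have le': "g k x \<le> f y + real k * dist x y" for k x y
    unfolding g_def by (rule cINF_lower[OF bdd]) simp
  have le: "g k x \<le> f x" for k x using le'[of k x x] by simp
  have lip1: "g k x \<le> g k y + real k * dist x y" for k x y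
  proof -
    have "g k x - real k * dist x y \<le> g k y"
      unfolding g_def[of k y]
    proof (rule cINF_greatest)
      fix z
      have "g k x \<le> f z + real k * dist x z" by (rule le')
      also have "\<dots> \<le> f z + real k * (dist x y + dist y z)"
        by (intro add_left_mono mult_left_mono dist_triangle) auto
      finally show "g k x - real k * dist x y \<le> f z + real k * dist y z" by (simp add: algebra_simps)
    qed simp
    then show ?thesis by simp
  qed
  have bl: "bounded_lipschitz (g k)" for k
  proof (rule bounded_lipschitzI)
    show "\<bar>g k x\<bar> \<le> M" for x using ge[of k x] le[of k x] M[of x] by simp
    show "\<bar>g k x - g k y\<bar> \<le> real k * dist x y" for x y
      using lip1[of k x y] lip1[of k y x] by (simp add: dist_commute abs_le_iff)
  qed
  have lim: "(\<lambda>k. g k x) \<longlonglongrightarrow> f x" for x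
  proof (rule LIMSEQ_I)
    fix e :: real assume "e > 0"
    have "isCont f x" using f by (simp add: continuous_on_eq_continuous_at)
    then obtain d where d: "d > 0" "\<And>y. dist y x < d \<Longrightarrow> dist (f y) (f x) < e / 2"
      using \<open>e > 0\<close> unfolding continuous_at_eps_delta by (meson half_gt_zero)
    obtain n :: nat where n: "real n * d > 2 * M" using reals_Archimedean3[OF d(1)] by blast
    have "norm (g k x - f x) < e" if "k \<ge> n" for k
    proof -
      have "f x - e / 2 \<le> g k x"
        unfolding g_def
      proof (rule cINF_greatest)
        fix y
        show "f x - e / 2 \<le> f y + real k * dist x y"
        proof (cases "dist y x < d")
          case True
          then have "f x - e / 2 \<le> f y" using d(2)[OF True] by (simp add: dist_real_def abs_if split: if_splits)
          moreover have "0 \<le> real k * dist x y" by simp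
          ultimately show ?thesis by linarith
        next
          case False
          then have "real n * d \<le> real k * dist x y" using that d(1) by (intro mult_mono) (auto simp: dist_commute)
          then show ?thesis using n M[of x] M[of y] \<open>e > 0\<close> by linarith
        qed
      qed simp
      then show ?thesis using le[of k x] \<open>e > 0\<close> by simp
    qed
    then show "\<exists>no. \<forall>k\<ge>no. norm (g k x - f x) < e" by blast
  qed
  show ?thesis by (rule that[of g]) (use bl ge le lim in auto)
qed

lemma (in prob_space) integrable_bounded_real:
  fixes f :: "'a \<Rightarrow> real"
  assumes "f \<in> borel_measurable M" "\<And>x. \<bar>f x\<bar> \<le> C"
  shows "integrable M f"
  by (rule integrable_const_bound[where B = C]) (use assms in auto)

text \<open>
  Lipschitz minorants of \<open>f\<close> bound the lower limit of the integrals from below; the same for \<open>- f\<close>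
  bounds the upper limit.
\<close>

lemma narrow_convergence_bounded_lipschitz:
  fixes \<mu> :: "'i \<Rightarrow> 'a::metric_space measure"
  assumes P: "\<forall>\<^sub>F i in F. prob_space (\<mu> i) \<and> sets (\<mu> i) = sets borel"
    and \<mu>': "prob_space \<mu>'" "sets \<mu>' = sets borel"
    and lim: "\<And>u. bounded_lipschitz u \<Longrightarrow> ((\<lambda>i. \<integral>x. u x \<partial>\<mu> i) \<longlongrightarrow> (\<integral>x. u x \<partial>\<mu>')) F"
    and f: "continuous_on UNIV f" "\<And>x. \<bar>f x\<bar> \<le> (M::real)"
  shows "((\<lambda>i. \<integral>x. f x \<partial>\<mu> i) \<longlongrightarrow> (\<integral>x. f x \<partial>\<mu>')) F"
proof -
  interpret \<mu>': prob_space \<mu>' by fact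
  have lower: "\<forall>\<^sub>F i in F. a < (\<integral>x. f x \<partial>\<mu> i)"
    if f: "continuous_on UNIV f" "\<And>x. \<bar>f x\<bar> \<le> M" and a: "a < (\<integral>x. f x \<partial>\<mu>')" for f a
  proof -
    obtain g :: "nat \<Rightarrow> 'a \<Rightarrow> real" where g: "\<And>k. bounded_lipschitz (g k)" "\<And>k x. - M \<le> g k x" "\<And>k x. g k x \<le> f x"
        "\<And>x. (\<lambda>k. g k x) \<longlonglongrightarrow> f x"
      using lipschitz_minorants[OF f] by blast
    have [measurable]: "f \<in> borel_measurable borel" "\<And>k. g k \<in> borel_measurable borel"
      using f(1) g(1) by (auto intro: borel_measurable_continuous_onI bounded_lipschitz_measurable)
    have gM: "\<bar>g k x\<bar> \<le> M" for k x using g(2)[of k x] g(3)[of k x] f(2)[of x] by simp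
    note [measurable_cong] = \<mu>'(2)
    have "(\<lambda>k. \<integral>x. g k x \<partial>\<mu>') \<longlonglongrightarrow> (\<integral>x. f x \<partial>\<mu>')"
      by (rule integral_dominated_convergence[where w = "\<lambda>_. M"]) (use g(4) gM in auto)
    from order_tendstoD(1)[OF this a] obtain k where k: "a < (\<integral>x. g k x \<partial>\<mu>')"
      by (auto simp: eventually_sequentially)
    from order_tendstoD(1)[OF lim[OF g(1)] k] P
    show ?thesis
    proof eventually_elim
      case (elim i)
      interpret M: prob_space "\<mu> i" using elim by simp
      have [measurable_cong]: "sets (\<mu> i) = sets borel" using elim by simp
      have "(\<integral>x. g k x \<partial>\<mu> i) \<le> (\<integral>x. f x \<partial>\<mu> i)"
        by (intro integral_mono M.integrable_bounded_real[of _ M]) (use gM f g in auto)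
      then show ?case using elim by simp
    qed
  qed
  show ?thesis
  proof (rule order_tendstoI)
    show "a < (\<integral>x. f x \<partial>\<mu>') \<Longrightarrow> \<forall>\<^sub>F i in F. a < (\<integral>x. f x \<partial>\<mu> i)" for a
      by (rule lower) (use f in auto)
    show "(\<integral>x. f x \<partial>\<mu>') < a \<Longrightarrow> \<forall>\<^sub>F i in F. (\<integral>x. f x \<partial>\<mu> i) < a" for a
      using lower[of "\<lambda>x. - f x" "- a"] f by (auto intro!: continuous_intros)
  qed
qed

lemma narrow_curves_iff:
  fixes m :: "real \<Rightarrow> 'a::euclidean_space measure"
  shows "m \<in> narrow_curves T \<longleftrightarrow> m \<in> extensional {0..T} \<and> (\<forall>t\<in>{0..T}. m t \<in> borel_probs) \<and>
     (\<forall>f :: 'a \<Rightarrow> real. continuous_on UNIV f \<longrightarrow> bounded (range f) \<longrightarrow> continuous_on {0..T} (\<lambda>t. \<integral>x. f x \<partial>m t))"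
  (is "_ \<longleftrightarrow> _ \<and> ?P \<and> ?C")
proof -
  let ?S = "{{\<mu> \<in> borel_probs. (\<integral>x. f x \<partial>\<mu>) \<in> U} | (f :: 'a \<Rightarrow> real) U.
        continuous_on UNIV f \<and> bounded (range f) \<and> open U}"
  have un: "\<Union>?S = borel_probs"
  proof safe
    fix \<mu> :: "'a measure" assume "\<mu> \<in> borel_probs"
    moreover have "{\<mu> \<in> borel_probs. (LINT x|\<mu>. (0::real)) \<in> UNIV} \<in> ?S"
      by (intro CollectI exI[of _ "\<lambda>_. 0"] exI[of _ UNIV]) auto
    ultimately show "\<mu> \<in> \<Union>?S" by blast
  qed
  have "continuous_map (top_of_set {0..T}) narrow_topology m \<longleftrightarrow> ?P \<and> ?C"
  proof (rule iffI)
    assume c: "continuous_map (top_of_set {0..T}) narrow_topology m"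
    have P: ?P
      using c un by (auto simp: continuous_map_def narrow_topology_def)
    have "continuous_on {0..T} (\<lambda>t. \<integral>x. f x \<partial>m t)"
      if f: "continuous_on UNIV f" "bounded (range f)" for f :: "'a \<Rightarrow> real"
      unfolding continuous_openin_preimage_eq
    proof (intro allI impI)
      fix U :: "real set" assume U: "open U"
      have "openin narrow_topology {\<mu> \<in> borel_probs. (\<integral>x. f x \<partial>\<mu>) \<in> U}"
        unfolding narrow_topology_def by (rule topology_generated_by_Basis) (use f U in blast)
      then have "openin (top_of_set {0..T}) {t \<in> {0..T}. m t \<in> {\<mu> \<in> borel_probs. (\<integral>x. f x \<partial>\<mu>) \<in> U}}"
        by (drule_tac openin_continuous_map_preimage[OF c]) simp
      moreover have "{t \<in> {0..T}. m t \<in> {\<mu> \<in> borel_probs. (\<integral>x. f x \<partial>\<mu>) \<in> U}}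
          = {0..T} \<inter> (\<lambda>t. \<integral>x. f x \<partial>m t) -` U" using P by auto
      ultimately show "openin (top_of_set {0..T}) ({0..T} \<inter> (\<lambda>t. \<integral>x. f x \<partial>m t) -` U)" by simp
    qed
    with P show "?P \<and> ?C" by blast
  next
    assume PC: "?P \<and> ?C"
    show "continuous_map (top_of_set {0..T}) narrow_topology m"
      unfolding narrow_topology_def
    proof (rule continuous_on_generated_topo)
      show "m ` topspace (top_of_set {0..T}) \<subseteq> \<Union>?S" unfolding un using PC by auto
      fix V assume "V \<in> ?S"
      then obtain f :: "'a \<Rightarrow> real" and U where V: "V = {\<mu> \<in> borel_probs. (\<integral>x. f x \<partial>\<mu>) \<in> U}"
        and f: "continuous_on UNIV f" "bounded (range f)" "open U"
        unfolding mem_Collect_eq by (elim exE conjE) (rule that)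
      have "openin (top_of_set {0..T}) ({0..T} \<inter> (\<lambda>t. \<integral>x. f x \<partial>m t) -` U)"
        by (rule continuous_openin_preimage_gen[OF _ f(3)]) (use PC f in blast)
      moreover have "m -` V \<inter> topspace (top_of_set {0..T}) = {0..T} \<inter> (\<lambda>t. \<integral>x. f x \<partial>m t) -` U"
        using PC unfolding V by auto
      ultimately show "openin (top_of_set {0..T}) (m -` V \<inter> topspace (top_of_set {0..T}))" by simp
    qed
  qed
  then show ?thesis by (auto simp: narrow_curves_def)
qed

section \<open>Measures that represent tight positive functionals\<close>

definition cutoff :: "real \<Rightarrow> 'a::real_normed_vector \<Rightarrow> real" where
  "cutoff R x = max 0 (min 1 (norm x - R))"

lemma bounded_lipschitz_cutoff: "bounded_lipschitz (cutoff R)"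
proof (rule bounded_lipschitzI[of _ 1 1])
  fix x y :: 'a
  show "\<bar>cutoff R x\<bar> \<le> 1" by (simp add: cutoff_def)
  have "\<bar>norm x - norm y\<bar> \<le> dist x y" by (simp add: dist_norm norm_triangle_ineq3)
  then show "\<bar>cutoff R x - cutoff R y\<bar> \<le> 1 * dist x y" by (auto simp: cutoff_def min_def max_def)
qed

text \<open>
  A functional that arises as a limit of integrals against a tight sequence of probability measures.
  The assumption \<open>tight\<close> keeps mass from escaping to infinity; on the whole space it replaces the compactness
  in the representation theorem of Riesz.
\<close>

locale tight_functional =
  fixes \<Lambda> :: "('a::euclidean_space \<Rightarrow> real) \<Rightarrow> real"
  assumes add: "bounded_lipschitz f \<Longrightarrow> bounded_lipschitz g \<Longrightarrow> \<Lambda> (\<lambda>x. f x + g x) = \<Lambda> f + \<Lambda> g"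
    and cmult: "bounded_lipschitz f \<Longrightarrow> \<Lambda> (\<lambda>x. c * f x) = c * \<Lambda> f"
    and nonneg: "bounded_lipschitz f \<Longrightarrow> (\<And>x. 0 \<le> f x) \<Longrightarrow> 0 \<le> \<Lambda> f"
    and one: "\<Lambda> (\<lambda>x. 1) = 1"
    and tight: "\<epsilon> > 0 \<Longrightarrow> \<exists>R. \<forall>f. bounded_lipschitz f \<longrightarrow> (\<forall>x. 0 \<le> f x \<and> f x \<le> 1) \<longrightarrow>
        (\<forall>x. norm x \<le> R \<longrightarrow> f x = 0) \<longrightarrow> \<Lambda> f \<le> \<epsilon>"
begin

lemma diff: "bounded_lipschitz f \<Longrightarrow> bounded_lipschitz g \<Longrightarrow> \<Lambda> (\<lambda>x. f x - g x) = \<Lambda> f - \<Lambda> g"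
  using add[of f "\<lambda>x. - 1 * g x"] cmult[of g "- 1"] bounded_lipschitz_cmult[of g "-1"] by simp

lemma mono:
  assumes "bounded_lipschitz f" "bounded_lipschitz g" "\<And>x. f x \<le> g x"
  shows "\<Lambda> f \<le> \<Lambda> g"
proof -
  have "0 \<le> \<Lambda> (\<lambda>x. g x - f x)" by (rule nonneg) (use assms in \<open>auto intro: bounded_lipschitz_diff\<close>)
  then show ?thesis using diff assms by simp
qed

lemma const: "\<Lambda> (\<lambda>x. c) = c"
  using cmult[OF bounded_lipschitz_const[of 1], of c] one by simp

lemma sum: "finite I \<Longrightarrow> (\<And>i. i \<in> I \<Longrightarrow> bounded_lipschitz (f i)) \<Longrightarrow> \<Lambda> (\<lambda>x. \<Sum>i\<in>I. f i x) = (\<Sum>i\<in>I. \<Lambda> (f i))"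
  by (induction I rule: finite_induct) (simp_all add: const add bounded_lipschitz_sum)

text \<open>
  Dini's argument on a large ball, and tightness outside of it. This continuity along decreasing sequences is
  what makes the measure below countably additive.
\<close>

lemma daniell:
  assumes f: "\<And>k. bounded_lipschitz (f k)" "\<And>k x. 0 \<le> f k x" "\<And>x. decseq (\<lambda>k. f k x)"
    "\<And>x. (\<lambda>k. f k x) \<longlonglongrightarrow> 0"
    and \<epsilon>: "\<epsilon> > 0"
  shows "\<exists>k. \<Lambda> (f k) \<le> \<epsilon>"
proof -
  obtain M L where M: "M \<ge> 0" "\<And>x. \<bar>f 0 x\<bar> \<le> M" and "L \<ge> 0" "\<And>x y. \<bar>f 0 x - f 0 y\<bar> \<le> L * dist x y"
    by (rule bounded_lipschitzE[OF f(1)[of 0]]) (rule that)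
  obtain R where R: "\<And>f. bounded_lipschitz f \<Longrightarrow> (\<And>x. 0 \<le> f x \<and> f x \<le> 1) \<Longrightarrow>
        (\<And>x. norm x \<le> R \<Longrightarrow> f x = 0) \<Longrightarrow> \<Lambda> f \<le> \<epsilon> / 2 / (M + 1)"
    using tight[of "\<epsilon> / 2 / (M + 1)"] \<epsilon> M by auto
  have c: "\<Lambda> (cutoff R) \<le> \<epsilon> / 2 / (M + 1)"
    by (rule R) (auto simp: bounded_lipschitz_cutoff cutoff_def)
  have "\<exists>k. \<forall>x\<in>cball 0 (R + 1). f k x < \<epsilon> / 2"
  proof -
    have op: "open {x. f k x < \<epsilon> / 2}" for k
      by (intro open_Collect_less bounded_lipschitz_continuous_on[OF f(1)] continuous_on_const)
    have "cball 0 (R + 1) \<subseteq> (\<Union>k\<in>UNIV. {x. f k x < \<epsilon> / 2})"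
    proof
      fix x
      from order_tendstoD(2)[OF f(4)[of x], of "\<epsilon> / 2"] \<epsilon>
      have "\<exists>k. f k x < \<epsilon> / 2" by (auto simp: eventually_sequentially)
      then show "x \<in> (\<Union>k\<in>UNIV. {x. f k x < \<epsilon> / 2})" by auto
    qed
    then obtain C where C: "finite C" "cball 0 (R + 1) \<subseteq> (\<Union>k\<in>C. {x. f k x < \<epsilon> / 2})"
      using compactE_image[OF compact_cball, of UNIV "\<lambda>k. {x. f k x < \<epsilon> / 2}" 0 "R + 1"] op by metis
    show ?thesis
    proof (cases "C = {}")
      case False
      have "f (Max C) x < \<epsilon> / 2" if x: "x \<in> cball 0 (R + 1)" for x
      proof -
        obtain k where k: "k \<in> C" "f k x < \<epsilon> / 2"
          using subsetD[OF C(2) x] by (elim UN_E CollectE) (rule that)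
        have "f (Max C) x \<le> f k x" using decseqD[OF f(3)] C k by simp
        then show ?thesis using k by simp
      qed
      then show ?thesis by blast
    qed (use C in auto)
  qed
  then obtain k where "\<forall>x\<in>cball 0 (R + 1). f k x < \<epsilon> / 2" by (elim exE)
  then have k: "\<And>x. norm x \<le> R + 1 \<Longrightarrow> f k x < \<epsilon> / 2" by simp
  have "f k x \<le> \<epsilon> / 2 + M * cutoff R x" for x
  proof (cases "norm x \<le> R + 1")
    case True
    then show ?thesis using k[of x] M by (simp add: cutoff_def add_increasing2 less_imp_le)
  next
    case False
    have "f k x \<le> f 0 x" using decseqD[OF f(3), of 0 k] by simp
    then show ?thesis using False M(2)[of x] \<epsilon> by (simp add: cutoff_def)
  qed
  then have "\<Lambda> (f k) \<le> \<Lambda> (\<lambda>x. \<epsilon> / 2 + M * cutoff R x)"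
    by (intro mono f bounded_lipschitz_intros bounded_lipschitz_cutoff)
  also have "\<dots> = \<epsilon> / 2 + M * \<Lambda> (cutoff R)"
    by (simp add: add cmult const bounded_lipschitz_intros bounded_lipschitz_cutoff)
  also have "M * \<Lambda> (cutoff R) \<le> M * (\<epsilon> / 2 / (M + 1))" using c M by (intro mult_left_mono)
  also have "\<dots> \<le> \<epsilon> / 2" using M \<epsilon> by (simp add: field_simps)
  finally show ?thesis by (intro exI[of _ k]) simp
qed

definition admissible :: "'a set \<Rightarrow> ('a \<Rightarrow> real) \<Rightarrow> bool" where
  "admissible U f \<longleftrightarrow> bounded_lipschitz f \<and> (\<forall>x. 0 \<le> f x \<and> f x \<le> 1) \<and> (\<forall>x. x \<notin> U \<longrightarrow> f x = 0)"

text \<open>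
  The mass of an open set, approximated from within. Outer regularity then determines the other sets,
  by \<open>outer\<close> below.
\<close>

definition content_open :: "'a set \<Rightarrow> real" where
  "content_open U = (SUP f\<in>Collect (admissible U). \<Lambda> f)"

lemma admissible_zero: "admissible U (\<lambda>x. 0)"
  by (simp add: admissible_def bounded_lipschitz_const)

lemma admissible_range: "admissible U f \<Longrightarrow> 0 \<le> \<Lambda> f" "admissible U f \<Longrightarrow> \<Lambda> f \<le> 1"
  using nonneg[of f] mono[of f "\<lambda>_. 1"] by (auto simp: admissible_def bounded_lipschitz_const one)

lemma bdd_admissible: "bdd_above (\<Lambda> ` Collect (admissible U))"
  by (rule bdd_aboveI2[of _ _ 1]) (auto simp: admissible_range)

lemma content_open_upper: "admissible U f \<Longrightarrow> \<Lambda> f \<le> content_open U"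
  unfolding content_open_def by (rule cSUP_upper) (auto intro: bdd_admissible)

lemma content_open_least: "(\<And>f. admissible U f \<Longrightarrow> \<Lambda> f \<le> c) \<Longrightarrow> content_open U \<le> c"
  unfolding content_open_def by (rule cSUP_least) (use admissible_zero in auto)

lemma content_open_approx:
  assumes "\<epsilon> > 0" obtains f where "admissible U f" "content_open U < \<Lambda> f + \<epsilon>"
proof -
  have "content_open U - \<epsilon> < (SUP f\<in>Collect (admissible U). \<Lambda> f)"
    using assms unfolding content_open_def by simp
  then obtain f where "admissible U f" "content_open U - \<epsilon> < \<Lambda> f"
    using less_cSUP_iff[OF _ bdd_admissible, of U] admissible_zero by (metis empty_iff mem_Collect_eq)
  then show ?thesis using that by (simp add: algebra_simps)
qed

lemma content_open_nonneg: "0 \<le> content_open U"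
  using content_open_upper[OF admissible_zero[of U]] by (simp add: const)

lemma content_open_mono: "U \<subseteq> V \<Longrightarrow> content_open U \<le> content_open V"
  by (rule content_open_least, rule content_open_upper) (auto simp: admissible_def)

lemma content_open_empty: "content_open {} = 0"
proof (rule antisym[OF content_open_least content_open_nonneg])
  fix f assume "admissible {} f"
  then have "f = (\<lambda>x. 0)" by (auto simp: admissible_def)
  then show "\<Lambda> f \<le> 0" by (simp add: const)
qed

lemma content_open_UNIV: "content_open UNIV = 1"
proof (rule antisym)
  show "content_open UNIV \<le> 1" by (rule content_open_least) (rule admissible_range)
  show "1 \<le> content_open UNIV"
    using content_open_upper[of UNIV "\<lambda>x. 1"] by (simp add: one admissible_def bounded_lipschitz_const)
qed

text \<open>
  A function supported in the union lies below finite sums of functions supported in the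
  \<open>U i\<close>, up to a remainder that decreases to zero and is negligible by \<open>daniell\<close>.
\<close>

lemma content_open_countably_subadditive:
  fixes U :: "nat \<Rightarrow> 'a set"
  assumes U: "\<And>i. open (U i)"
  shows "ennreal (content_open (\<Union>i. U i)) \<le> (\<Sum>i. ennreal (content_open (U i)))"
proof (rule ennreal_le_epsilon)
  fix e :: real assume e: "e > 0"
  obtain f where f: "admissible (\<Union>i. U i) f" "content_open (\<Union>i. U i) < \<Lambda> f + e / 2"
    using content_open_approx[of "e / 2"] e by auto
  have fbl: "bounded_lipschitz f" using f by (simp add: admissible_def)
  define g where "g k x = (\<Sum>i<k. bump_inside (U i) k x)" for k x
  have gbl: "bounded_lipschitz (g k)" for k
    unfolding g_def by (intro bounded_lipschitz_sum bounded_lipschitz_bump_inside)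
  have ginc: "g k x \<le> g l x" if "k \<le> l" for k l x
  proof -
    have "g k x \<le> (\<Sum>i<k. bump_inside (U i) l x)"
      unfolding g_def by (intro sum_mono bump_inside_mono that)
    also have "\<dots> \<le> g l x"
      unfolding g_def by (intro sum_mono2) (use that bump_inside_range in auto)
    finally show ?thesis .
  qed
  define r where "r k x = max 0 (f x - g k x)" for k x
  have "\<exists>k. \<Lambda> (r k) \<le> e / 2"
  proof (rule daniell)
    show "bounded_lipschitz (r k)" for k
      unfolding r_def by (intro bounded_lipschitz_intros fbl gbl)
    show "0 \<le> r k x" for k x by (simp add: r_def)
    show "decseq (\<lambda>k. r k x)" for x
      unfolding decseq_def r_def by (intro allI impI max.mono diff_left_mono ginc order_refl)
    show "(\<lambda>k. r k x) \<longlonglongrightarrow> 0" for x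
    proof (cases "x \<in> (\<Union>i. U i)")
      case True
      then obtain i where i: "x \<in> U i" by auto
      from bump_inside_eventually[OF U i] eventually_gt_at_top[of i]
      have "\<forall>\<^sub>F k in sequentially. r k x = 0"
      proof eventually_elim
        case (elim k)
        have "bump_inside (U i) k x \<le> g k x"
          unfolding g_def by (rule member_le_sum) (use elim bump_inside_range in auto)
        moreover have "f x \<le> 1" using f by (simp add: admissible_def)
        ultimately show ?case using elim by (simp add: r_def)
      qed
      then show ?thesis by (rule tendsto_eventually)
    next
      case False
      then have "f x = 0" using f by (simp add: admissible_def)
      moreover have "g k x \<ge> 0" for k unfolding g_def by (intro sum_nonneg bump_inside_range)
      ultimately have "r k x = 0" for k by (simp add: r_def)
      then show ?thesis by simp
    qed
  qed (use e in simp)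
  then obtain k where k: "\<Lambda> (r k) \<le> e / 2" by blast
  have "\<Lambda> f \<le> \<Lambda> (\<lambda>x. g k x + r k x)"
    by (intro mono fbl bounded_lipschitz_add gbl) (auto simp: r_def intro!: bounded_lipschitz_intros fbl gbl)
  also have "\<dots> = \<Lambda> (g k) + \<Lambda> (r k)"
    by (intro add gbl) (auto simp: r_def intro!: bounded_lipschitz_intros fbl gbl)
  also have "\<Lambda> (g k) = (\<Sum>i<k. \<Lambda> (bump_inside (U i) k))"
    unfolding g_def by (rule sum) (auto simp: bounded_lipschitz_bump_inside)
  also have "\<dots> \<le> (\<Sum>i<k. content_open (U i))"
    by (intro sum_mono content_open_upper)
       (auto simp: admissible_def bounded_lipschitz_bump_inside bump_inside_range bump_inside_outside)
  finally have "content_open (\<Union>i. U i) \<le> (\<Sum>i<k. content_open (U i)) + e" using f k by linarith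
  then have "ennreal (content_open (\<Union>i. U i)) \<le> ennreal ((\<Sum>i<k. content_open (U i)) + e)"
    by (rule ennreal_leI)
  also have "\<dots> = (\<Sum>i<k. ennreal (content_open (U i))) + ennreal e"
    using e by (simp add: ennreal_plus sum_nonneg content_open_nonneg sum_ennreal)
  also have "\<dots> \<le> (\<Sum>i. ennreal (content_open (U i))) + ennreal e"
    by (intro add_right_mono sum_le_suminf) auto
  finally show "ennreal (content_open (\<Union>i. U i)) \<le> (\<Sum>i. ennreal (content_open (U i))) + ennreal e" .
qed

definition outer :: "'a set \<Rightarrow> ennreal" where
  "outer A = (INF U\<in>{U. open U \<and> A \<subseteq> U}. ennreal (content_open U))"

lemma outer_le: "open U \<Longrightarrow> A \<subseteq> U \<Longrightarrow> outer A \<le> ennreal (content_open U)"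
  unfolding outer_def by (rule INF_lower) simp

lemma outer_open: "open U \<Longrightarrow> outer U = ennreal (content_open U)"
  unfolding outer_def
  by (intro antisym INF_lower INF_greatest ennreal_leI content_open_mono) auto

lemma outer_mono: "A \<subseteq> B \<Longrightarrow> outer A \<le> outer B"
  unfolding outer_def by (rule INF_superset_mono) auto

lemma outer_approx:
  assumes "e > 0" obtains U where "open U" "A \<subseteq> U" "ennreal (content_open U) \<le> outer A + ennreal e"
proof -
  have "outer A \<le> outer UNIV" by (rule outer_mono) simp
  also have "outer UNIV = 1" by (simp add: outer_open content_open_UNIV)
  finally have "outer A < \<infinity>" by (auto simp: top_unique less_top[symmetric])
  then have "outer A < outer A + ennreal e"
    using assms by (auto simp: ennreal_add_left_cancel_less)
  then obtain U where "open U" "A \<subseteq> U" "ennreal (content_open U) < outer A + ennreal e"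
    unfolding outer_def by (subst (asm) INF_less_iff) auto
  then show ?thesis using that[of U] by simp
qed

lemma outer_countably_subadditive: "outer (\<Union>i. A i) \<le> (\<Sum>i. outer (A i))"
proof (rule ennreal_le_epsilon)
  fix e :: real assume e: "e > 0"
  have "\<exists>U. open U \<and> A i \<subseteq> U \<and> ennreal (content_open U) \<le> outer (A i) + ennreal (e * (1/2) ^ Suc i)" for i
    using outer_approx[of "e * (1/2) ^ Suc i" "A i"] e by auto
  then obtain U where U: "\<And>i. open (U i)" "\<And>i. A i \<subseteq> U i"
      "\<And>i. ennreal (content_open (U i)) \<le> outer (A i) + ennreal (e * (1/2) ^ Suc i)" by metis
  have "outer (\<Union>i. A i) \<le> ennreal (content_open (\<Union>i. U i))"
    by (rule outer_le) (use U in \<open>auto intro!: open_UN\<close>)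
  also have "\<dots> \<le> (\<Sum>i. ennreal (content_open (U i)))"
    by (rule content_open_countably_subadditive) (rule U)
  also have "\<dots> \<le> (\<Sum>i. outer (A i) + ennreal (e * (1/2) ^ Suc i))"
    by (intro suminf_le U) auto
  also have "\<dots> = (\<Sum>i. outer (A i)) + (\<Sum>i. ennreal (e * (1/2) ^ Suc i))"
    by (intro suminf_add[symmetric]) auto
  also have "(\<Sum>i. ennreal (e * (1/2) ^ Suc i)) = ennreal e"
  proof (rule suminf_ennreal_eq)
    show "(\<lambda>i. e * (1/2) ^ Suc i) sums e" using sums_mult[OF power_half_series, of e] by simp
  qed (use e in auto)
  finally show "outer (\<Union>i. A i) \<le> (\<Sum>i. outer (A i)) + ennreal e" .
qed

text \<open>
  For an open \<open>V\<close> let \<open>f\<close> be almost optimal for \<open>V \<inter> G\<close>. The set \<open>W\<close> where \<open>f\<close> is small is an open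
  neighbourhood of \<open>V - G\<close>, and functions supported in \<open>W\<close> can be added to \<open>f\<close> with almost no loss.
\<close>

lemma open_caratheodory:
  assumes G: "open G" shows "outer (A \<inter> G) + outer (A - G) \<le> outer A"
proof -
  have main: "outer (V \<inter> G) + outer (V - G) \<le> ennreal (content_open V)" if V: "open V" for V
  proof (rule ennreal_le_epsilon)
    fix e :: real assume e: "e > 0"
    obtain f where f: "admissible (V \<inter> G) f" "content_open (V \<inter> G) < \<Lambda> f + e / 2"
      using content_open_approx[of "e / 2"] e by auto
    have fbl: "bounded_lipschitz f" using f by (simp add: admissible_def)
    define W where "W = V \<inter> {x. f x < e / 2}"
    have W: "open W" "V - G \<subseteq> W"
      unfolding W_def
      by (intro open_Int V open_Collect_less bounded_lipschitz_continuous_on[OF fbl] continuous_on_const)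
         (use f e in \<open>auto simp: admissible_def\<close>)
    have "content_open W \<le> (1 + e / 2) * content_open V - \<Lambda> f"
    proof (rule content_open_least)
      fix h assume h: "admissible W h"
      then have hbl: "bounded_lipschitz h" by (simp add: admissible_def)
      \<comment> \<open>on W the function f is at most e / 2, off W the function h vanishes\<close>
      have "admissible V (\<lambda>x. (1 / (1 + e / 2)) * (f x + h x))"
        unfolding admissible_def
      proof (intro conjI allI impI)
        show "bounded_lipschitz (\<lambda>x. (1 / (1 + e / 2)) * (f x + h x))" by (intro bounded_lipschitz_intros fbl hbl)
        fix x
        have r: "0 \<le> f x" "f x \<le> 1" "0 \<le> h x" "h x \<le> 1" using f h by (auto simp: admissible_def)
        then show "0 \<le> (1 / (1 + e / 2)) * (f x + h x)" using e by simp
        have "f x + h x \<le> 1 + e / 2"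
        proof (cases "x \<in> W")
          case True
          then show ?thesis using r by (simp add: W_def)
        next
          case False
          then have "h x = 0" using h by (simp add: admissible_def)
          then show ?thesis using r e by simp
        qed
        then show "(1 / (1 + e / 2)) * (f x + h x) \<le> 1" using e by (simp add: field_simps)
        assume "x \<notin> V"
        then have "f x = 0" "h x = 0" using f h by (auto simp: admissible_def W_def)
        then show "(1 / (1 + e / 2)) * (f x + h x) = 0" by simp
      qed
      from content_open_upper[OF this]
      have "(1 / (1 + e / 2)) * (\<Lambda> f + \<Lambda> h) \<le> content_open V"
        by (subst (asm) cmult) (auto simp: add fbl hbl bounded_lipschitz_add)
      then show "\<Lambda> h \<le> (1 + e / 2) * content_open V - \<Lambda> f" using e by (simp add: field_simps)
    qed
    moreover have "content_open V \<le> 1" using content_open_mono[of V UNIV] by (simp add: content_open_UNIV)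
    then have "e / 2 * content_open V \<le> e / 2" using e by simp
    ultimately have le: "content_open (V \<inter> G) + content_open W \<le> content_open V + e"
      using f by (simp add: algebra_simps)
    have "outer (V \<inter> G) + outer (V - G) \<le> ennreal (content_open (V \<inter> G)) + ennreal (content_open W)"
      by (intro add_mono outer_le) (use V G W in auto)
    also have "\<dots> = ennreal (content_open (V \<inter> G) + content_open W)"
      by (simp add: content_open_nonneg)
    also have "\<dots> \<le> ennreal (content_open V + e)" by (rule ennreal_leI[OF le])
    also have "\<dots> = ennreal (content_open V) + ennreal e" using e by (simp add: content_open_nonneg)
    finally show "outer (V \<inter> G) + outer (V - G) \<le> ennreal (content_open V) + ennreal e" .
  qed
  show ?thesis
    unfolding outer_def[of A]
  proof (rule INF_greatest, clarify)
    fix V assume V: "open V" "A \<subseteq> V"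
    have "outer (A \<inter> G) + outer (A - G) \<le> outer (V \<inter> G) + outer (V - G)"
      by (intro add_mono outer_mono) (use V in auto)
    also have "\<dots> \<le> ennreal (content_open V)" by (rule main[OF V(1)])
    finally show "outer (A \<inter> G) + outer (A - G) \<le> ennreal (content_open V)" .
  qed
qed

lemma outer_empty: "outer {} = 0"
  by (simp add: outer_open content_open_empty)

definition representing :: "'a measure" where
  "representing = measure_of UNIV (sets borel) outer"

lemma sets_representing: "sets representing = sets borel"
  using sets.sigma_sets_eq[of "borel :: 'a measure"] by (simp add: representing_def sets_measure_of)

lemma emeasure_representing: "A \<in> sets borel \<Longrightarrow> emeasure representing A = outer A"
proof -
  interpret P: sigma_algebra UNIV "Pow (UNIV :: 'a set)" by (rule sigma_algebra_Pow)
  have "outer_measure_space (Pow UNIV) outer"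
    unfolding outer_measure_space_def positive_def increasing_def countably_subadditive_def
    using outer_countably_subadditive outer_mono by (auto simp: outer_empty)
  then have ms: "measure_space UNIV (lambda_system UNIV (Pow UNIV) outer) outer"
    by (rule P.caratheodory_lemma)
  have "sets borel \<subseteq> lambda_system UNIV (Pow (UNIV :: 'a set)) outer"
  proof -
    have "{S :: 'a set. open S} \<subseteq> lambda_system UNIV (Pow UNIV) outer"
    proof
      fix G :: "'a set" assume "G \<in> {S. open S}"
      then have G: "open G" by simp
      have "outer (A \<inter> G) + outer (A - G) = outer A" for A
      proof (rule antisym[OF open_caratheodory[OF G]])
        define C where "C i = (if i = 0 then A \<inter> G else if i = 1 then A - G else {})" for i :: nat
        have "A = (\<Union>i. C i)" by (auto simp: C_def split: if_splits)
        then have "outer A \<le> (\<Sum>i. outer (C i))" using outer_countably_subadditive[of C] by simp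
        also have "\<dots> = (\<Sum>i<2. outer (C i))"
          by (rule suminf_finite) (auto simp: C_def outer_empty)
        finally show "outer A \<le> outer (A \<inter> G) + outer (A - G)"
          by (simp add: C_def numeral_2_eq_2)
      qed
      then show "G \<in> lambda_system UNIV (Pow UNIV) outer" unfolding P.lambda_system_eq by simp
    qed
    then have "sigma_sets UNIV {S :: 'a set. open S} \<subseteq> lambda_system UNIV (Pow UNIV) outer"
      using ms sigma_algebra.sigma_sets_subset unfolding measure_space_def by blast
    then show ?thesis by (simp add: borel_def)
  qed
  then have "measure_space UNIV (sets borel) outer"
    using ms sets.sigma_algebra_axioms[of "borel :: 'a measure"]
    unfolding measure_space_def positive_def countably_additive_def by (auto simp: subset_iff)
  then show "A \<in> sets borel \<Longrightarrow> emeasure representing A = outer A"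
    unfolding representing_def measure_space_def
    by (intro emeasure_measure_of_sigma) auto
qed

lemma prob_space_representing: "prob_space representing"
proof
  have "space representing = UNIV" using sets_eq_imp_space_eq[OF sets_representing] by simp
  then show "emeasure representing (space representing) = 1"
    by (simp add: emeasure_representing outer_open content_open_UNIV)
qed

lemma measure_representing_open:
  assumes "open U" shows "measure representing U = content_open U"
  using assms by (simp add: measure_def emeasure_representing outer_open content_open_nonneg)

text \<open>
  Layer cake: \<open>f\<close> is the sum of the slices \<open>p k\<close> between the levels \<open>k / n\<close> and \<open>(k + 1) / n\<close>, and
  \<open>n * p k\<close> is a competitor for the open set where \<open>f\<close> exceeds \<open>k / n\<close>.
\<close>

lemma integral_representing_ge:
  assumes f: "bounded_lipschitz f" "\<And>x. 0 \<le> f x" "\<And>x. f x \<le> 1"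
  shows "\<Lambda> f \<le> (\<integral>x. f x \<partial>representing)"
proof (rule field_le_epsilon)
  fix e :: real assume e: "e > 0"
  interpret R: prob_space representing by (rule prob_space_representing)
  note [measurable_cong] = sets_representing
  have [measurable]: "f \<in> borel_measurable borel" by (rule bounded_lipschitz_measurable[OF f(1)])
  obtain n :: nat where n: "n > 0" "1 / real n < e" using e by (metis nat_approx_posE of_nat_0_less_iff zero_less_Suc)
  define p where "p k x = min (f x) (real (Suc k) / real n) - min (f x) (real k / real n)" for k x
  define U where "U k = {x. real k / real n < f x}" for k
  have U: "open (U k)" for k
    unfolding U_def by (intro open_Collect_less bounded_lipschitz_continuous_on[OF f(1)] continuous_on_const)
  have pbl: "bounded_lipschitz (p k)" for k unfolding p_def by (intro bounded_lipschitz_intros f)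
  have frac: "real (Suc k) / real n = real k / real n + 1 / real n" for k by (simp add: add_divide_distrib)
  have clip: "0 \<le> min a (c + d) - min a c \<and> min a (c + d) - min a c \<le> d" if "0 \<le> d" for a c d :: real
    using that by (auto simp: min_def)
  have clip2: "(if c < a then d else 0) \<le> min a c - min a (c - d)" if "0 \<le> d" for a c d :: real
    using that by (auto simp: min_def)
  have adm: "admissible (U k) (\<lambda>x. real n * p k x)" for k
    unfolding admissible_def
  proof (intro conjI allI impI)
    show "bounded_lipschitz (\<lambda>x. real n * p k x)" by (intro bounded_lipschitz_intros pbl)
    fix x
    have "0 \<le> p k x" "p k x \<le> 1 / real n" unfolding p_def frac using clip[of "1 / real n" "f x" "real k / real n"]
        by auto
    then show "0 \<le> real n * p k x" "real n * p k x \<le> 1" using n by (auto simp: field_simps)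
    assume "x \<notin> U k"
    then have "f x \<le> real k / real n" by (simp add: U_def)
    then have "p k x = 0" unfolding p_def frac by (simp add: min_absorb1 add_increasing2)
    then show "real n * p k x = 0" by simp
  qed
  have sump: "(\<Sum>k<n. p k x) = f x" for x
  proof -
    have "(\<Sum>k<n. p k x) = min (f x) (real n / real n) - min (f x) (real 0 / real n)"
      unfolding p_def by (rule sum_lessThan_telescope)
    then show ?thesis using f(2,3)[of x] n by (simp add: min_def)
  qed
  have ind: "integrable representing (\<lambda>x. (1 / real n) * indicator (U k) x)" for k
    using borel_open[OF U[of k]] R.emeasure_finite[of "U k"]
    by (intro integrable_mult_right integrable_real_indicator) (auto simp: sets_representing less_top[symmetric])
  have "\<Lambda> f = (\<Sum>k<n. \<Lambda> (p k))"
    using sum[of "{..<n}" p] pbl by (simp add: sump)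
  also have "\<dots> \<le> (\<Sum>k<n. (1 / real n) * content_open (U k))"
  proof (rule sum_mono)
    fix k
    have "real n * \<Lambda> (p k) \<le> content_open (U k)" using content_open_upper[OF adm] pbl by (simp add: cmult)
    then show "\<Lambda> (p k) \<le> (1 / real n) * content_open (U k)" using n by (simp add: field_simps)
  qed
  also have "\<dots> = (\<Sum>k<n. \<integral>x. (1 / real n) * indicator (U k) x \<partial>representing)"
    using U sets_eq_imp_space_eq[OF sets_representing]
    by (intro sum.cong refl) (simp add: measure_representing_open)
  also have "\<dots> = (\<integral>x. (\<Sum>k<n. (1 / real n) * indicator (U k) x) \<partial>representing)"
    by (intro Bochner_Integration.integral_sum[symmetric] ind)
  also have "\<dots> \<le> (\<integral>x. f x + 1 / real n \<partial>representing)"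
  proof (rule integral_mono)
    show "integrable representing (\<lambda>x. \<Sum>k<n. (1 / real n) * indicator (U k) x)"
      by (intro Bochner_Integration.integrable_sum ind)
    show "integrable representing (\<lambda>x. f x + 1 / real n)"
      by (intro Bochner_Integration.integrable_add R.integrable_bounded_real[of f 1] R.integrable_const)
         (use f in auto)
    fix x
    have "(\<Sum>k<n. (1 / real n) * indicator (U k) x) \<le> (\<Sum>k<n. min (f x) (real_of_int (int (Suc k) - 1) / real n)
        - min (f x) (real_of_int (int k - 1) / real n))"
    proof (rule sum_mono)
      fix k
      have "real_of_int (int (Suc k) - 1) / real n = real k / real n"
        "real_of_int (int k - 1) / real n = real k / real n - 1 / real n"
        by (auto simp: diff_divide_distrib)
      then show "(1 / real n) * indicator (U k) x \<le> min (f x) (real_of_int (int (Suc k) - 1) / real n)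
          - min (f x) (real_of_int (int k - 1) / real n)"
        using clip2[of "1 / real n" "real k / real n" "f x"] by (auto simp: indicator_def U_def)
    qed
    also have "\<dots> = min (f x) (real_of_int (int n - 1) / real n) - min (f x) (real_of_int (int 0 - 1) / real n)"
      by (rule sum_lessThan_telescope)
    also have "min (f x) (real_of_int (int 0 - 1) / real n) = - (1 / real n)"
      using order_trans[OF _ f(2)[of x], of "- (1 / real n)"] by (simp add: min_absorb2)
    also have "min (f x) (real_of_int (int n - 1) / real n) - - (1 / real n) \<le> f x + 1 / real n" by simp
    finally show "(\<Sum>k<n. (1 / real n) * indicator (U k) x) \<le> f x + 1 / real n" .
  qed
  also have "\<dots> = (\<integral>x. f x \<partial>representing) + 1 / real n"
    using f by (subst Bochner_Integration.integral_add)
      (auto intro!: R.integrable_bounded_real[of f 1] simp: R.prob_space)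
  finally show "\<Lambda> f \<le> (\<integral>x. f x \<partial>representing) + e" using n by simp
qed

text \<open>One inequality suffices, since it can be applied to \<open>1 - f\<close> too.\<close>

theorem integral_representing:
  assumes f: "bounded_lipschitz f"
  shows "(\<integral>x. f x \<partial>representing) = \<Lambda> f"
proof -
  interpret R: prob_space representing by (rule prob_space_representing)
  note [measurable_cong] = sets_representing
  have unit: "(\<integral>x. g x \<partial>representing) = \<Lambda> g"
    if g: "bounded_lipschitz g" "\<And>x. 0 \<le> g x" "\<And>x. g x \<le> 1" for g
  proof (rule antisym)
    have [measurable]: "g \<in> borel_measurable borel" by (rule bounded_lipschitz_measurable[OF g(1)])
    have int: "integrable representing g" by (rule R.integrable_bounded_real[where C = 1]) (use g in auto)
    have "\<Lambda> (\<lambda>x. 1 - g x) \<le> (\<integral>x. 1 - g x \<partial>representing)"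
      by (rule integral_representing_ge) (use g in \<open>auto intro: bounded_lipschitz_intros\<close>)
    moreover have "\<Lambda> (\<lambda>x. 1 - g x) = 1 - \<Lambda> g" using diff[OF bounded_lipschitz_const g(1)] by (simp add: one)
    moreover have "(\<integral>x. 1 - g x \<partial>representing) = 1 - (\<integral>x. g x \<partial>representing)"
      using int by (simp add: R.prob_space)
    ultimately show "(\<integral>x. g x \<partial>representing) \<le> \<Lambda> g" by simp
    show "\<Lambda> g \<le> (\<integral>x. g x \<partial>representing)" by (rule integral_representing_ge) (use g in auto)
  qed
  obtain M L where M: "M \<ge> 0" "\<And>x. \<bar>f x\<bar> \<le> M" and "L \<ge> 0" "\<And>x y. \<bar>f x - f y\<bar> \<le> L * dist x y"
    by (rule bounded_lipschitzE[OF f]) (rule that)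
  define c where "c = 1 / (2 * M + 1)"
  have c: "c > 0" using M by (simp add: c_def)
  have [measurable]: "f \<in> borel_measurable borel" by (rule bounded_lipschitz_measurable[OF f])
  have int: "integrable representing f" by (rule R.integrable_bounded_real[where C = M]) (use M in auto)
  have "(\<integral>x. c * f x + c * M \<partial>representing) = \<Lambda> (\<lambda>x. c * f x + c * M)"
  proof (rule unit)
    fix x
    have "- M \<le> f x" "f x \<le> M" using M(2)[of x] by auto
    then have "0 \<le> c * (f x + M)" "c * (f x + M) \<le> c * (2 * M + 1)"
      using c by (auto intro!: mult_left_mono mult_nonneg_nonneg)
    moreover have "c * (2 * M + 1) = 1" using M by (simp add: c_def)
    ultimately show "0 \<le> c * f x + c * M" "c * f x + c * M \<le> 1" by (auto simp: algebra_simps)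
  qed (intro bounded_lipschitz_intros f)
  also have "\<dots> = c * \<Lambda> f + c * M"
    by (simp add: add cmult f const bounded_lipschitz_intros)
  also have "(\<integral>x. c * f x + c * M \<partial>representing) = c * (\<integral>x. f x \<partial>representing) + c * M"
    using int by (simp add: R.prob_space)
  finally show ?thesis using c by simp
qed

end

section \<open>Hoelder functions and variation of constants\<close>

definition holder_ball :: "real \<Rightarrow> real \<Rightarrow> real \<Rightarrow> ('a::real_normed_vector \<Rightarrow> real) set" where
  "holder_ball \<beta> a c = {u. 0 \<le> c \<and> (\<forall>x y. \<bar>u x\<bar> \<le> a \<and> \<bar>u x - u y\<bar> \<le> c * norm (x - y) powr \<beta>)}"

lemma holder_ballI:
  "0 \<le> c \<Longrightarrow> (\<And>x. \<bar>u x\<bar> \<le> a) \<Longrightarrow> (\<And>x y. \<bar>u x - u y\<bar> \<le> c * norm (x - y) powr \<beta>) \<Longrightarrow> u \<in> holder_ball \<beta> a c"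
  by (simp add: holder_ball_def)

lemma holder_ballD:
  assumes "u \<in> holder_ball \<beta> a c"
  shows "\<bar>u x\<bar> \<le> a" "\<bar>u x - u y\<bar> \<le> c * norm (x - y) powr \<beta>" "0 \<le> c" "0 \<le> a"
  using assms order_trans[OF abs_ge_zero, of "u x" a] by (auto simp: holder_ball_def)

text \<open>
  For points at distance at most one the Lipschitz bound is stronger, as \<open>\<beta> \<le> 1\<close>; for the others the
  bound on the values is.
\<close>

lemma bounded_lipschitz_imp_holder:
  fixes u :: "'a::real_normed_vector \<Rightarrow> real"
  assumes u: "bounded_lipschitz u" and \<beta>: "0 < \<beta>" "\<beta> \<le> 1"
  obtains a c where "u \<in> holder_ball \<beta> a c"
proof -
  obtain M L where M: "M \<ge> 0" "L \<ge> 0" "\<And>x. \<bar>u x\<bar> \<le> M" "\<And>x y. \<bar>u x - u y\<bar> \<le> L * dist x y"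
    by (rule bounded_lipschitzE[OF u]) (rule that)
  have "u \<in> holder_ball \<beta> M (L + 2 * M)"
  proof (rule holder_ballI)
    fix x y
    show "\<bar>u x - u y\<bar> \<le> (L + 2 * M) * norm (x - y) powr \<beta>"
    proof (cases "norm (x - y) \<le> 1")
      case True
      have "norm (x - y) powr 1 \<le> norm (x - y) powr \<beta>" using True \<beta> by (intro powr_mono') auto
      then have "L * norm (x - y) \<le> (L + 2 * M) * norm (x - y) powr \<beta>"
        using M by (intro mult_mono) auto
      then show ?thesis using M(4)[of x y] by (simp add: dist_norm)
    next
      case False
      then have "1 \<le> norm (x - y) powr \<beta>" using \<beta> by (intro ge_one_powr_ge_zero) auto
      then have "(L + 2 * M) * 1 \<le> (L + 2 * M) * norm (x - y) powr \<beta>" using M by (intro mult_left_mono) auto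
      moreover have "\<bar>u x - u y\<bar> \<le> 2 * M" using M(3)[of x] M(3)[of y] by linarith
      ultimately show ?thesis using M by simp
    qed
  qed (use M in auto)
  then show ?thesis by (rule that)
qed

lemma holder_continuous:
  fixes u :: "'a::real_normed_vector \<Rightarrow> real"
  assumes u: "u \<in> holder_ball \<beta> a c" and \<beta>: "0 < \<beta>"
  shows "continuous_on S u"
proof -
  have "isCont u x" for x
    unfolding isCont_def
  proof (rule LIM_zero_cancel, rule Lim_null_comparison)
    show "\<forall>\<^sub>F y in at x. norm (u y - u x) \<le> c * norm (y - x) powr \<beta>"
      using holder_ballD(2)[OF u] by (intro always_eventually) simp
    have "((\<lambda>y. c * norm (y - x) powr \<beta>) \<longlongrightarrow> c * norm (x - x) powr \<beta>) (at x)"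
      using \<beta> by (intro tendsto_intros tendsto_powr') auto
    then show "((\<lambda>y. c * norm (y - x) powr \<beta>) \<longlongrightarrow> 0) (at x)" using \<beta> by simp
  qed
  then show ?thesis by (simp add: continuous_at_imp_continuous_on)
qed

lemma emeasure_lborel_Ioo_finite: "emeasure lborel {s<..<t::real} < top"
  by (cases "s \<le> t") auto

text \<open>Fubini's theorem replaces integration by parts, so that \<open>g\<close> need only be measurable and bounded.\<close>

lemma duhamel:
  fixes g :: "real \<Rightarrow> real"
  assumes g[measurable]: "g \<in> borel_measurable borel" and C: "\<And>s. \<bar>g s\<bar> \<le> C" and \<alpha>: "\<alpha> > 0" and t: "0 \<le> t"
  defines "F \<equiv> \<lambda>t. LINT s:{0<..<t}|lborel. g s"
  shows "exp (\<alpha> * t) * F t = (LINT s:{0<..<t}|lborel. exp (\<alpha> * s) * (\<alpha> * F s + g s))"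
    and "set_integrable lborel {0<..<t} (\<lambda>s. exp (\<alpha> * s) * (\<alpha> * F s + g s))"
proof -
  have C0: "C \<ge> 0" using C[of 0] by simp
  have bdd: "set_integrable lborel {0<..<t} h" if "h \<in> borel_measurable borel" "\<And>s. s \<in> {0<..<t} \<Longrightarrow> \<bar>h s\<bar> \<le> D"
      for h :: "real \<Rightarrow> real" and D t
    unfolding set_integrable_def
  proof (rule Bochner_Integration.integrable_bound)
    show "integrable lborel (\<lambda>s. indicator {0<..<t} s * D)"
        by (intro integrable_mult_left integrable_real_indicator) (auto simp: emeasure_lborel_Ioo_finite)
    show "(\<lambda>s. indicator {0<..<t} s *\<^sub>R h s) \<in> borel_measurable lborel" using that(1) by measurable
    show "AE s in lborel. norm (indicator {0<..<t} s *\<^sub>R h s) \<le> norm (indicator {0<..<t} s * D)"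
      using that(2) by (intro AE_I2) (auto simp: indicator_def intro: order_trans[OF _ abs_ge_self])
  qed
  \<comment> \<open>integrated over s this is the term with F, integrated over \<tau> it is an exact derivative\<close>
  define k where "k \<tau> s = indicator {0<..<t} \<tau> * indicator {0<..<\<tau>} s * (\<alpha> * exp (\<alpha> * \<tau>) * g s)" for \<tau> s
  have kmeas[measurable]: "case_prod k \<in> borel_measurable (lborel \<Otimes>\<^sub>M lborel)"
  proof -
    have "(\<lambda>(\<tau>, s). if 0 < \<tau> \<and> \<tau> < t \<and> 0 < s \<and> s < \<tau> then \<alpha> * exp (\<alpha> * \<tau>) * g s else 0)
        \<in> borel_measurable (lborel \<Otimes>\<^sub>M lborel)"
      by measurable
    moreover have "(\<lambda>(\<tau>, s). if 0 < \<tau> \<and> \<tau> < t \<and> 0 < s \<and> s < \<tau> then \<alpha> * exp (\<alpha> * \<tau>) * g s else 0) = case_prod k"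
      by (auto simp: k_def fun_eq_iff)
    ultimately show ?thesis by simp
  qed
  have "integrable (lborel \<Otimes>\<^sub>M lborel) (case_prod k)"
  proof (rule Bochner_Integration.integrable_bound)
    have "emeasure (lborel \<Otimes>\<^sub>M lborel) ({0<..<t} \<times> {0<..<t}) < \<infinity>"
      by (subst lborel.emeasure_pair_measure_Times) (auto simp: emeasure_lborel_Ioo_finite ennreal_mult_less_top)
    then show "integrable (lborel \<Otimes>\<^sub>M lborel) (\<lambda>p. indicator ({0<..<t} \<times> {0<..<t}) p * (\<alpha> * exp (\<alpha> * t) * C))"
      by (intro integrable_mult_left integrable_real_indicator) auto
    have "norm (k \<tau> s) \<le> norm (indicator ({0<..<t} \<times> {0<..<t}) (\<tau>, s) * (\<alpha> * exp (\<alpha> * t) * C))" for \<tau> s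
    proof (cases "0 < \<tau> \<and> \<tau> < t \<and> 0 < s \<and> s < \<tau>")
      case True
      have "\<alpha> * exp (\<alpha> * \<tau>) * \<bar>g s\<bar> \<le> \<alpha> * exp (\<alpha> * t) * C"
        using True \<alpha> C[of s] by (intro mult_mono) auto
      then show ?thesis using True \<alpha> C0 by (simp add: k_def abs_mult)
    next
      case False
      then have "k \<tau> s = 0" by (auto simp: k_def indicator_def)
      then show ?thesis by simp
    qed
    then show "AE p in lborel \<Otimes>\<^sub>M lborel. norm (case_prod k p)
        \<le> norm (indicator ({0<..<t} \<times> {0<..<t}) p * (\<alpha> * exp (\<alpha> * t) * C))"
      by (intro AE_I2) (auto simp del: real_norm_def)
  qed measurable
  from lborel_pair.Fubini_integral[OF this]
  have fub: "(\<integral>s. (\<integral>\<tau>. k \<tau> s \<partial>lborel) \<partial>lborel) = (\<integral>\<tau>. (\<integral>s. k \<tau> s \<partial>lborel) \<partial>lborel)" .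
  have inner1: "(\<integral>s. k \<tau> s \<partial>lborel) = indicator {0<..<t} \<tau> * (\<alpha> * exp (\<alpha> * \<tau>) * F \<tau>)" for \<tau>
  proof -
    have "(\<integral>s. k \<tau> s \<partial>lborel) = (\<integral>s. (indicator {0<..<t} \<tau> * (\<alpha> * exp (\<alpha> * \<tau>))) * (indicator {0<..<\<tau>} s *\<^sub>R g s)
        \<partial>lborel)"
      by (intro Bochner_Integration.integral_cong) (auto simp: k_def)
    also have "\<dots> = (indicator {0<..<t} \<tau> * (\<alpha> * exp (\<alpha> * \<tau>))) * F \<tau>"
      unfolding F_def set_lebesgue_integral_def by (rule integral_mult_right_zero)
    finally show ?thesis by simp
  qed
  have inner2: "(\<integral>\<tau>. k \<tau> s \<partial>lborel) = indicator {0<..<t} s *\<^sub>R ((exp (\<alpha> * t) - exp (\<alpha> * s)) * g s)" for s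
  proof (cases "0 < s \<and> s < t")
    case True
    have "(\<integral>\<tau>. k \<tau> s \<partial>lborel) = (\<integral>\<tau>. (indicator {s<..<t} \<tau> *\<^sub>R (\<alpha> * exp (\<alpha> * \<tau>))) * g s \<partial>lborel)"
      using True by (intro Bochner_Integration.integral_cong) (auto simp: k_def indicator_def)
    also have "\<dots> = (\<integral>\<tau>. indicator {s<..<t} \<tau> *\<^sub>R (\<alpha> * exp (\<alpha> * \<tau>)) \<partial>lborel) * g s"
      by (rule integral_mult_left_zero)
    also have "(\<integral>\<tau>. indicator {s<..<t} \<tau> *\<^sub>R (\<alpha> * exp (\<alpha> * \<tau>)) \<partial>lborel)
        = (\<integral>\<tau>. indicator {s..t} \<tau> *\<^sub>R (\<alpha> * exp (\<alpha> * \<tau>)) \<partial>lborel)"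
    proof (rule integral_cong_AE)
      have "AE \<tau> in lborel. \<tau> \<noteq> s \<and> \<tau> \<noteq> t" using AE_lborel_singleton[of s] AE_lborel_singleton[of t]
          by eventually_elim simp
      then show "AE \<tau> in lborel. indicator {s<..<t} \<tau> *\<^sub>R (\<alpha> * exp (\<alpha> * \<tau>))
          = indicator {s..t} \<tau> *\<^sub>R (\<alpha> * exp (\<alpha> * \<tau>))"
        by eventually_elim (auto simp: indicator_def)
    qed auto
    also have "\<dots> = exp (\<alpha> * t) - exp (\<alpha> * s)"
      using True by (intro integral_FTC_Icc) (auto intro!: derivative_eq_intros continuous_intros simp:
          has_real_derivative_iff_has_vector_derivative[symmetric])
    finally show ?thesis using True by simp
  next
    case False
    then have "k \<tau> s = 0" for \<tau> by (auto simp: k_def indicator_def)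
    then show ?thesis using False by (auto simp: indicator_def)
  qed
  have FC: "\<bar>F s\<bar> \<le> C * t" if "s \<in> {0<..<t}" for s
  proof -
    have "\<bar>F s\<bar> \<le> (LINT r:{0<..<s}|lborel. C)"
    proof -
      have "norm (F s) \<le> (LINT r:{0<..<s}|lborel. norm (g r))"
        unfolding F_def by (rule set_integral_norm_bound) (rule bdd[where D = C], use C in auto)
      also have "\<dots> \<le> (LINT r:{0<..<s}|lborel. C)"
        by (rule set_integral_mono) (use C C0 in \<open>auto intro!: bdd[where D = C]\<close>)
      finally show ?thesis by simp
    qed
    also have "\<dots> = C * s" using that by (simp add: set_lebesgue_integral_def)
    also have "\<dots> \<le> C * t" using that C0 by (intro mult_left_mono) auto
    finally show ?thesis .
  qed
  have Fmeas: "(\<lambda>\<tau>. indicator {0<..<t} \<tau> * (\<alpha> * exp (\<alpha> * \<tau>) * F \<tau>)) \<in> borel_measurable borel"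
    unfolding inner1[symmetric] using kmeas by measurable
  have i1: "set_integrable lborel {0<..<t} (\<lambda>\<tau>. \<alpha> * exp (\<alpha> * \<tau>) * F \<tau>)"
  proof -
    have "set_integrable lborel {0<..<t} (\<lambda>\<tau>. indicator {0<..<t} \<tau> * (\<alpha> * exp (\<alpha> * \<tau>) * F \<tau>))"
    proof (rule bdd[OF Fmeas])
      fix s assume s: "s \<in> {0<..<t}"
      have "\<alpha> * exp (\<alpha> * s) * \<bar>F s\<bar> \<le> \<alpha> * exp (\<alpha> * t) * (C * t)"
        using s \<alpha> FC[OF s] by (intro mult_mono) auto
      then show "\<bar>indicator {0<..<t} s * (\<alpha> * exp (\<alpha> * s) * F s)\<bar> \<le> \<alpha> * exp (\<alpha> * t) * (C * t)"
        using s \<alpha> by (simp add: abs_mult)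
    qed
    then show ?thesis unfolding set_integrable_def
        by (simp add: mult.assoc[symmetric] indicator_inter_arith[symmetric])
  qed
  have i2: "set_integrable lborel {0<..<t} (\<lambda>s. exp (\<alpha> * s) * g s)"
  proof (rule bdd)
    show "\<bar>exp (\<alpha> * s) * g s\<bar> \<le> exp (\<alpha> * t) * C" if "s \<in> {0<..<t}" for s
      using that \<alpha> C[of s] by (simp add: abs_mult, intro mult_mono) auto
  qed measurable
  have eq: "exp (\<alpha> * s) * (\<alpha> * F s + g s) = \<alpha> * exp (\<alpha> * s) * F s + exp (\<alpha> * s) * g s" for s
    by (simp add: algebra_simps)
  show "set_integrable lborel {0<..<t} (\<lambda>s. exp (\<alpha> * s) * (\<alpha> * F s + g s))"
    unfolding eq by (intro set_integral_add i1 i2)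
  have "(LINT s:{0<..<t}|lborel. exp (\<alpha> * s) * (\<alpha> * F s + g s))
     = (LINT s:{0<..<t}|lborel. \<alpha> * exp (\<alpha> * s) * F s) + (LINT s:{0<..<t}|lborel. exp (\<alpha> * s) * g s)"
    unfolding eq by (intro set_integral_add i1 i2)
  also have "(LINT s:{0<..<t}|lborel. \<alpha> * exp (\<alpha> * s) * F s) = (\<integral>\<tau>. (\<integral>s. k \<tau> s \<partial>lborel) \<partial>lborel)"
    unfolding inner1 set_lebesgue_integral_def by simp
  also have "\<dots> = (LINT s:{0<..<t}|lborel. (exp (\<alpha> * t) - exp (\<alpha> * s)) * g s)"
    unfolding fub[symmetric] inner2 set_lebesgue_integral_def ..
  also have "\<dots> = (LINT s:{0<..<t}|lborel. exp (\<alpha> * t) * g s - exp (\<alpha> * s) * g s)"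
    by (simp add: left_diff_distrib)
  also have "\<dots> = (LINT s:{0<..<t}|lborel. exp (\<alpha> * t) * g s) - (LINT s:{0<..<t}|lborel. exp (\<alpha> * s) * g s)"
    by (intro set_integral_diff i2 set_integrable_mult_right) (use bdd[where h = g and D = C] C in auto)
  finally show "exp (\<alpha> * t) * F t = (LINT s:{0<..<t}|lborel. exp (\<alpha> * s) * (\<alpha> * F s + g s))"
    by (simp add: F_def)
qed

text \<open>
  The gain over a direct estimate of \<open>F\<close> is the factor \<open>1 / (\<alpha> + \<kappa>)\<close>: a bound of size \<open>\<alpha> * exp (\<kappa> * s)\<close> on
  \<open>\<alpha> * F s + g s\<close> returns a bound on \<open>F\<close> that is smaller by \<open>\<alpha> / (\<alpha> + \<kappa>) < 1\<close>.
\<close>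

lemma duhamel_bound:
  fixes g :: "real \<Rightarrow> real"
  assumes g: "g \<in> borel_measurable borel" and C: "\<And>s. \<bar>g s\<bar> \<le> C" and \<alpha>: "\<alpha> > 0" and \<kappa>: "\<kappa> > 0" and t: "0 \<le> t"
  defines "F \<equiv> \<lambda>t. LINT s:{0<..<t}|lborel. g s"
  assumes G: "\<And>s. s \<in> {0<..<t} \<Longrightarrow> \<bar>\<alpha> * F s + g s\<bar> \<le> G * exp (\<kappa> * s)" and "G \<ge> 0"
  shows "\<bar>F t\<bar> \<le> G / (\<alpha> + \<kappa>) * exp (\<kappa> * t)"
proof -
  have pos: "\<alpha> + \<kappa> > 0" using \<alpha> \<kappa> by simp
  have int: "set_integrable lborel {0<..<t} (\<lambda>s. exp (\<alpha> * s) * (\<alpha> * F s + g s))"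
    unfolding F_def by (rule duhamel(2)[OF g C \<alpha> t])
  have intR: "set_integrable lborel {0<..<t} (\<lambda>s. G * exp ((\<alpha> + \<kappa>) * s))"
  proof -
    have "set_integrable lborel {0..t} (\<lambda>s. G * exp ((\<alpha> + \<kappa>) * s))"
      unfolding set_integrable_def by (intro borel_integrable_compact continuous_intros) auto
    then show ?thesis by (rule set_integrable_subset) auto
  qed
  have eq: "exp (\<alpha> * t) * F t = (LINT s:{0<..<t}|lborel. exp (\<alpha> * s) * (\<alpha> * F s + g s))"
    unfolding F_def by (rule duhamel(1)[OF g C \<alpha> t])
  have "exp (\<alpha> * t) * \<bar>F t\<bar> = \<bar>exp (\<alpha> * t) * F t\<bar>" by (simp add: abs_mult)
  also have "\<dots> = \<bar>LINT s:{0<..<t}|lborel. exp (\<alpha> * s) * (\<alpha> * F s + g s)\<bar>"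
    by (simp only: eq)
  also have "\<dots> \<le> (LINT s:{0<..<t}|lborel. norm (exp (\<alpha> * s) * (\<alpha> * F s + g s)))"
    using set_integral_norm_bound[OF int] by simp
  also have "\<dots> \<le> (LINT s:{0<..<t}|lborel. G * exp ((\<alpha> + \<kappa>) * s))"
  proof (rule set_integral_mono)
    show "set_integrable lborel {0<..<t} (\<lambda>s. norm (exp (\<alpha> * s) * (\<alpha> * F s + g s)))"
      using int by (rule set_integrable_norm)
    fix s assume s: "s \<in> {0<..<t}"
    have "exp (\<alpha> * s) * \<bar>\<alpha> * F s + g s\<bar> \<le> exp (\<alpha> * s) * (G * exp (\<kappa> * s))"
      using G[OF s] by (intro mult_left_mono) auto
    also have "\<dots> = G * exp ((\<alpha> + \<kappa>) * s)" by (simp add: distrib_right exp_add)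
    finally show "norm (exp (\<alpha> * s) * (\<alpha> * F s + g s)) \<le> G * exp ((\<alpha> + \<kappa>) * s)" by (simp add: abs_mult)
  qed (rule intR)
  also have "\<dots> \<le> (LINT s:{0..t}|lborel. G * exp ((\<alpha> + \<kappa>) * s))"
  proof -
    have "set_integrable lborel {0..t} (\<lambda>s. G * exp ((\<alpha> + \<kappa>) * s))"
      unfolding set_integrable_def by (intro borel_integrable_compact continuous_intros) auto
    then show ?thesis using intR \<open>G \<ge> 0\<close> unfolding set_integrable_def set_lebesgue_integral_def
      by (intro integral_mono) (auto simp: indicator_def)
  qed
  also have "\<dots> = G / (\<alpha> + \<kappa>) * exp ((\<alpha> + \<kappa>) * t) - G / (\<alpha> + \<kappa>) * exp ((\<alpha> + \<kappa>) * 0)"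
    unfolding set_lebesgue_integral_def using t pos
    by (intro integral_FTC_Icc) (auto intro!: derivative_eq_intros continuous_intros simp:
        has_real_derivative_iff_has_vector_derivative[symmetric])
  also have "\<dots> \<le> G / (\<alpha> + \<kappa>) * exp ((\<alpha> + \<kappa>) * t)" using pos \<open>G \<ge> 0\<close> by simp
  also have "\<dots> = exp (\<alpha> * t) * (G / (\<alpha> + \<kappa>) * exp (\<kappa> * t))" by (simp add: distrib_right exp_add)
  finally have "exp (\<alpha> * t) * \<bar>F t\<bar> \<le> exp (\<alpha> * t) * (G / (\<alpha> + \<kappa>) * exp (\<kappa> * t))" .
  then show ?thesis by (rule mult_left_le_imp_le) simp
qed

section \<open>Stability of the equation against Hoelder test functions\<close>

text \<open>
  What is needed of a curve of measures in order to integrate the equation in time. Only integrands that are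
  continuous on the open time interval occur, as \<open>b\<close> has this continuity; the condition holds for narrowly
  continuous curves as well as for piecewise constant ones, and passes to pointwise narrow limits.
\<close>

definition measurable_curve :: "real \<Rightarrow> (real \<Rightarrow> 'a::euclidean_space measure) \<Rightarrow> bool" where
  "measurable_curve T m \<longleftrightarrow> (\<forall>t\<in>{0..T}. prob_space (m t) \<and> sets (m t) = sets borel) \<and>
     (\<forall>(g :: real \<Rightarrow> 'a \<Rightarrow> real) C. continuous_on ({0<..<T} \<times> UNIV) (\<lambda>(t, x). g t x) \<longrightarrow> (\<forall>t x. \<bar>g t x\<bar> \<le> C) \<longrightarrow>
        (\<lambda>t. indicator {0<..<T} t * (\<integral>x. g t x \<partial>m t)) \<in> borel_measurable borel)"

text \<open>
  The setting of the whole argument: \<open>H\<close> is a Hoelder constant of all \<open>b t\<close>, and the moment of order \<open>\<beta>\<close> of the small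
  jumps is finite. The bounds on \<open>b\<close> hold at all real times; a coefficient
  on \<open>{0<..<T}\<close> is extended by zero.
\<close>

locale fokker_planck =
  fixes \<nu> :: "'a::euclidean_space measure" and b :: "real \<Rightarrow> 'a \<Rightarrow> real" and \<beta> B H T :: real
  assumes sets_\<nu>[measurable_cong]: "sets \<nu> = sets borel"
    and \<nu>_zero: "emeasure \<nu> {0} = 0"
    and \<beta>: "0 < \<beta>" "\<beta> \<le> 1"
    and moment: "(\<integral>\<^sup>+z. ennreal (min 1 (norm z powr \<beta>)) \<partial>\<nu>) < \<infinity>"
    and b_range: "0 \<le> b t x" "b t x \<le> B"
    and b_holder: "\<bar>b t x - b t y\<bar> \<le> H * norm (x - y) powr \<beta>"
    and b_cont: "continuous_on ({0<..<T} \<times> UNIV) (\<lambda>(t, x). b t x)"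
    and T: "0 < T" and H: "0 \<le> H"
begin

definition weight :: "'a \<Rightarrow> real" where "weight z = min 1 (norm z powr \<beta>)"
definition M :: real where "M = (\<integral>z. weight z \<partial>\<nu>)"
definition small :: "real \<Rightarrow> real" where "small r = (\<integral>z. indicator (ball 0 r) z * weight z \<partial>\<nu>)"
definition mass :: "real \<Rightarrow> real" where "mass r = measure \<nu> (- ball 0 r)"
definition trunc_op :: "real \<Rightarrow> ('a \<Rightarrow> real) \<Rightarrow> 'a \<Rightarrow> real" where
  "trunc_op r u x = (\<integral>z. indicator (- ball 0 r) z * (u (x + z) - u x) \<partial>\<nu>)"

abbreviation flux :: "('a \<Rightarrow> real) \<Rightarrow> (real \<Rightarrow> 'a measure) \<Rightarrow> real \<Rightarrow> real" where
  "flux u m \<tau> \<equiv> (\<integral>x. b \<tau> x * levy_op \<nu> u x \<partial>m \<tau>)"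

lemma B: "0 \<le> B" using b_range[of 0 0] by linarith

lemma space_\<nu>: "space \<nu> = UNIV" using sets_eq_imp_space_eq[OF sets_\<nu>] by simp

lemma weight_nonneg: "0 \<le> weight z" by (simp add: weight_def)

lemma weight_measurable[measurable]: "weight \<in> borel_measurable borel"
  unfolding weight_def by measurable

lemma weight_integrable: "integrable \<nu> weight"
proof (rule integrableI_bounded)
  show "weight \<in> borel_measurable \<nu>" by measurable
  show "(\<integral>\<^sup>+ z. ennreal (norm (weight z)) \<partial>\<nu>) < \<infinity>" using moment by (simp add: weight_def)
qed

lemma M: "0 \<le> M" unfolding M_def by (intro Bochner_Integration.integral_nonneg weight_nonneg)

text \<open>The factor \<open>2 * a + c\<close> serves small and large jumps at the same time.\<close>

lemma holder_increment:
  assumes u: "u \<in> holder_ball \<beta> a c"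
  shows "\<bar>u (x + z) - u x\<bar> \<le> (2 * a + c) * weight z"
proof (cases "norm z powr \<beta> \<le> 1")
  case True
  have "\<bar>u (x + z) - u x\<bar> \<le> c * norm z powr \<beta>" using holder_ballD(2)[OF u, of "x + z" x] by simp
  also have "\<dots> \<le> (2 * a + c) * norm z powr \<beta>" using holder_ballD(4)[OF u] by (intro mult_right_mono) auto
  finally show ?thesis using True by (simp add: weight_def)
next
  case False
  have "\<bar>u (x + z) - u x\<bar> \<le> 2 * a" using holder_ballD(1)[OF u, of x] holder_ballD(1)[OF u, of "x + z"] by linarith
  then show ?thesis using False holder_ballD(3)[OF u] by (simp add: weight_def)
qed

lemma holder_measurable: "u \<in> holder_ball \<beta> a c \<Longrightarrow> u \<in> borel_measurable borel"
  by (intro borel_measurable_continuous_onI holder_continuous[OF _ \<beta>(1)])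

lemma holder_const_nonneg:
  fixes u :: "'a \<Rightarrow> real"
  shows "u \<in> holder_ball \<beta> a c \<Longrightarrow> 0 \<le> 2 * a + c"
  using holder_ballD(3,4)[of u \<beta> a c] by simp

lemma increment_integrable:
  assumes u: "u \<in> holder_ball \<beta> a c" and f: "f \<in> borel_measurable borel" "\<And>z. \<bar>f z\<bar> \<le> (1::real)"
  shows "integrable \<nu> (\<lambda>z. f z * (u (x + z) - u x))"
proof (rule Bochner_Integration.integrable_bound)
  show "integrable \<nu> (\<lambda>z. (2 * a + c) * weight z)" using weight_integrable by simp
  have [measurable]: "u \<in> borel_measurable borel" by (rule holder_measurable[OF u])
  show "(\<lambda>z. f z * (u (x + z) - u x)) \<in> borel_measurable \<nu>" using f(1) by measurable
  show "AE z in \<nu>. norm (f z * (u (x + z) - u x)) \<le> norm ((2 * a + c) * weight z)"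
  proof (rule AE_I2)
    fix z
    have "\<bar>f z\<bar> * \<bar>u (x + z) - u x\<bar> \<le> 1 * ((2 * a + c) * weight z)"
      by (intro mult_mono f holder_increment[OF u]) auto
    also have "\<dots> \<le> norm ((2 * a + c) * weight z)" by simp
    finally show "norm (f z * (u (x + z) - u x)) \<le> norm ((2 * a + c) * weight z)"
      by (simp add: abs_mult[of "f z"])
  qed
qed

lemma increment_integral_bound:
  assumes u: "u \<in> holder_ball \<beta> a c" and f: "f \<in> borel_measurable borel" "\<And>z. 0 \<le> f z" "\<And>z. f z \<le> (1::real)"
  shows "\<bar>\<integral>z. f z * (u (x + z) - u x) \<partial>\<nu>\<bar> \<le> (2 * a + c) * (\<integral>z. f z * weight z \<partial>\<nu>)"
proof -
  have fw: "integrable \<nu> (\<lambda>z. f z * weight z)"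
    by (rule Bochner_Integration.integrable_bound[OF weight_integrable])
       (use f weight_nonneg in \<open>auto simp: abs_mult intro!: mult_left_le_one_le\<close>)
  have "\<bar>\<integral>z. f z * (u (x + z) - u x) \<partial>\<nu>\<bar> \<le> (\<integral>z. \<bar>f z * (u (x + z) - u x)\<bar> \<partial>\<nu>)"
    by (rule integral_abs_bound)
  also have "\<dots> \<le> (\<integral>z. (2 * a + c) * (f z * weight z) \<partial>\<nu>)"
  proof (rule integral_mono)
    show "integrable \<nu> (\<lambda>z. \<bar>f z * (u (x + z) - u x)\<bar>)"
      by (intro integrable_abs increment_integrable[OF u] f) (use f in auto)
    show "integrable \<nu> (\<lambda>z. (2 * a + c) * (f z * weight z))" using fw by simp
    show "\<bar>f z * (u (x + z) - u x)\<bar> \<le> (2 * a + c) * (f z * weight z)" for z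
      unfolding abs_mult abs_of_nonneg[OF f(2)]
      using mult_left_mono[OF holder_increment[OF u, of x z] f(2)[of z]] by (simp add: ac_simps)
  qed
  finally show ?thesis by simp
qed

lemma levy_op_bound:
  assumes u: "u \<in> holder_ball \<beta> a c" shows "\<bar>levy_op \<nu> u x\<bar> \<le> (2 * a + c) * M"
  using increment_integral_bound[OF u, of "\<lambda>_. 1" x] by (simp add: levy_op_def M_def)

lemma small_nonneg: "0 \<le> small r"
  unfolding small_def by (intro Bochner_Integration.integral_nonneg) (simp add: weight_nonneg)

lemma trunc_op_bound:
  assumes u: "u \<in> holder_ball \<beta> a c" shows "\<bar>trunc_op r u x\<bar> \<le> (2 * a + c) * M"
proof -
  have "\<bar>trunc_op r u x\<bar> \<le> (2 * a + c) * (\<integral>z. indicator (- ball 0 r) z * weight z \<partial>\<nu>)"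
    unfolding trunc_op_def by (rule increment_integral_bound[OF u]) auto
  also have "\<dots> \<le> (2 * a + c) * M"
    unfolding M_def
  proof (intro mult_left_mono integral_mono weight_integrable holder_const_nonneg[OF u])
    show "integrable \<nu> (\<lambda>z. indicator (- ball 0 r) z * weight z)"
      by (rule Bochner_Integration.integrable_bound[OF weight_integrable])
         (auto simp: indicator_def)
  qed (auto simp: indicator_def weight_nonneg)
  finally show ?thesis .
qed

lemma levy_op_trunc_op:
  assumes u: "u \<in> holder_ball \<beta> a c"
  shows "\<bar>levy_op \<nu> u x - trunc_op r u x\<bar> \<le> (2 * a + c) * small r"
proof -
  have "levy_op \<nu> u x - trunc_op r u x = (\<integral>z. 1 * (u (x + z) - u x) - indicator (- ball 0 r) z * (u (x + z)
      - u x) \<partial>\<nu>)"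
    unfolding levy_op_def trunc_op_def
    by (subst Bochner_Integration.integral_diff[OF increment_integrable[OF u] increment_integrable[OF u]]) auto
  also have "\<dots> = (\<integral>z. indicator (ball 0 r) z * (u (x + z) - u x) \<partial>\<nu>)"
    by (intro Bochner_Integration.integral_cong) (auto simp: indicator_def)
  also have "\<bar>\<dots>\<bar> \<le> (2 * a + c) * small r"
    unfolding small_def
    by (rule increment_integral_bound[OF u]) (auto intro: borel_measurable_indicator)
  finally show ?thesis .
qed

lemma continuous_increment_integral:
  assumes u: "u \<in> holder_ball \<beta> a c" and f: "f \<in> borel_measurable borel" "\<And>z. \<bar>f z\<bar> \<le> (1::real)"
  shows "continuous_on UNIV (\<lambda>x. \<integral>z. f z * (u (x + z) - u x) \<partial>\<nu>)"
  unfolding continuous_on_sequentially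
proof (intro allI ballI impI, elim conjE)
  fix y and x :: "nat \<Rightarrow> 'a" assume x: "x \<longlonglongrightarrow> y"
  have cu: "continuous_on UNIV u" by (rule holder_continuous[OF u \<beta>(1)])
  have [measurable]: "u \<in> borel_measurable borel" by (rule holder_measurable[OF u])
  have lim: "(\<lambda>n. u (x n + z)) \<longlonglongrightarrow> u (y + z)" for z
    using cu x by (intro isCont_tendsto_compose[of _ u] tendsto_intros) (auto simp: continuous_on_eq_continuous_at)
  have "(\<lambda>n. \<integral>z. f z * (u (x n + z) - u (x n)) \<partial>\<nu>) \<longlonglongrightarrow> (\<integral>z. f z * (u (y + z) - u y) \<partial>\<nu>)"
  proof (rule integral_dominated_convergence[where w = "\<lambda>z. (2 * a + c) * weight z"])
    show "(\<lambda>z. f z * (u (y + z) - u y)) \<in> borel_measurable \<nu>" using f(1) by measurable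
    show "(\<lambda>z. f z * (u (x n + z) - u (x n))) \<in> borel_measurable \<nu>" for n using f(1) by measurable
    show "integrable \<nu> (\<lambda>z. (2 * a + c) * weight z)" using weight_integrable by simp
    show "AE z in \<nu>. (\<lambda>n. f z * (u (x n + z) - u (x n))) \<longlonglongrightarrow> f z * (u (y + z) - u y)"
      using lim lim[of 0, simplified] by (intro AE_I2 tendsto_intros)
    show "AE z in \<nu>. norm (f z * (u (x n + z) - u (x n))) \<le> (2 * a + c) * weight z" for n
    proof (rule AE_I2)
      fix z
      have "\<bar>f z\<bar> * \<bar>u (x n + z) - u (x n)\<bar> \<le> 1 * ((2 * a + c) * weight z)"
        by (intro mult_mono f holder_increment[OF u]) auto
      then show "norm (f z * (u (x n + z) - u (x n))) \<le> (2 * a + c) * weight z" by (simp add: abs_mult)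
    qed
  qed
  then show "((\<lambda>x. \<integral>z. f z * (u (x + z) - u x) \<partial>\<nu>) \<circ> x) \<longlonglongrightarrow> (\<integral>z. f z * (u (y + z) - u y) \<partial>\<nu>)"
    by (simp add: o_def)
qed

lemma levy_op_continuous: "u \<in> holder_ball \<beta> a c \<Longrightarrow> continuous_on UNIV (levy_op \<nu> u)"
  using continuous_increment_integral[of u a c "\<lambda>_. 1"] by (simp add: levy_op_def[abs_def])

lemma trunc_op_continuous: "u \<in> holder_ball \<beta> a c \<Longrightarrow> continuous_on UNIV (trunc_op r u)"
  unfolding trunc_op_def[abs_def] by (rule continuous_increment_integral) auto

lemma emeasure_outside_ball:
  assumes "r > 0" shows "emeasure \<nu> (- ball 0 r) < \<infinity>"
proof -
  define k where "k = min 1 (r powr \<beta>)"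
  have k: "k > 0" using assms by (simp add: k_def)
  have "k * indicator (- ball 0 r) z \<le> weight z" for z :: 'a
    using powr_mono2[of \<beta> r "norm z"] assms \<beta> by (auto simp: indicator_def weight_def k_def)
  then have "(\<integral>\<^sup>+z. ennreal (k * indicator (- ball 0 r) z) \<partial>\<nu>) \<le> (\<integral>\<^sup>+z. ennreal (weight z) \<partial>\<nu>)"
    by (intro nn_integral_mono ennreal_leI)
  also have "\<dots> < \<infinity>" using moment by (simp add: weight_def)
  also have "(\<integral>\<^sup>+z. ennreal (k * indicator (- ball 0 r) z) \<partial>\<nu>) = (\<integral>\<^sup>+z. ennreal k * indicator (- ball 0 r) z \<partial>\<nu>)"
    using k by (intro nn_integral_cong) (auto simp: indicator_def)
  also have "\<dots> = ennreal k * emeasure \<nu> (- ball 0 r)"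
    by (rule nn_integral_cmult_indicator) (simp add: sets_\<nu>)
  finally show ?thesis using k by (auto simp: ennreal_mult_less_top)
qed

lemma trunc_op_eq:
  assumes u: "u \<in> borel_measurable borel" "\<And>x. \<bar>u x\<bar> \<le> a" and r: "r > 0"
  shows "trunc_op r u x = (\<integral>z. indicator (- ball 0 r) z * u (x + z) \<partial>\<nu>) - mass r * u x"
    and "integrable \<nu> (\<lambda>z. indicator (- ball 0 r) z * u (x + z))"
proof -
  have fin: "integrable \<nu> (\<lambda>z. indicator (- ball 0 r) z :: real)"
    using emeasure_outside_ball[OF r] by (intro integrable_real_indicator) (auto simp: sets_\<nu>)
  have [measurable]: "u \<in> borel_measurable borel" by (rule u)
  show i: "integrable \<nu> (\<lambda>z. indicator (- ball 0 r) z * u (x + z))"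
  proof (rule Bochner_Integration.integrable_bound)
    show "integrable \<nu> (\<lambda>z. a * indicator (- ball 0 r) z :: real)" using fin by simp
    show "AE z in \<nu>. norm (indicator (- ball 0 r) z * u (x + z)) \<le> norm (a * indicator (- ball 0 r) z)"
      using u(2) by (intro AE_I2) (auto simp: indicator_def intro: order_trans[OF _ abs_ge_self])
  qed measurable
  have "trunc_op r u x = (\<integral>z. indicator (- ball 0 r) z * u (x + z) - u x * indicator (- ball 0 r) z \<partial>\<nu>)"
    unfolding trunc_op_def by (intro Bochner_Integration.integral_cong) (auto simp: algebra_simps)
  also have "\<dots> = (\<integral>z. indicator (- ball 0 r) z * u (x + z) \<partial>\<nu>) - (\<integral>z. u x * indicator (- ball 0 r) z \<partial>\<nu>)"
    by (intro Bochner_Integration.integral_diff i) (use fin in auto)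
  finally show "trunc_op r u x = (\<integral>z. indicator (- ball 0 r) z * u (x + z) \<partial>\<nu>) - mass r * u x"
    by (simp add: mass_def space_\<nu> mult.commute)
qed

lemma mass_nonneg: "0 \<le> mass r" by (simp add: mass_def)

lemma outside_integral_bound:
  assumes f: "\<And>z. \<bar>f z\<bar> \<le> k" and r: "r > 0"
  shows "\<bar>\<integral>z. indicator (- ball 0 r) z * f z \<partial>\<nu>\<bar> \<le> k * mass r"
proof -
  have fin: "integrable \<nu> (\<lambda>z. indicator (- ball 0 r) z :: real)"
    using emeasure_outside_ball[OF r] by (intro integrable_real_indicator) (auto simp: sets_\<nu>)
  have "norm (\<integral>z. indicator (- ball 0 r) z * f z \<partial>\<nu>) \<le> (\<integral>z. norm (indicator (- ball 0 r) z * f z) \<partial>\<nu>)"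
    by (rule integral_norm_bound)
  also have "\<dots> \<le> (\<integral>z. k * indicator (- ball 0 r) z \<partial>\<nu>)"
    by (rule integral_mono') (use fin f order_trans[OF abs_ge_zero f] in \<open>auto simp: indicator_def\<close>)
  finally have "norm (\<integral>z. indicator (- ball 0 r) z * f z \<partial>\<nu>) \<le> (\<integral>z. k * indicator (- ball 0 r) z \<partial>\<nu>)" .
  then show ?thesis by (simp add: mass_def space_\<nu>)
qed

text \<open>
  The central estimate. Write \<open>I x\<close> for the integral of \<open>u (x + z)\<close> over the jumps of length at least \<open>r\<close>. Then the
  function is \<open>(1 - b x * mass r / \<alpha>) * u x + b x / \<alpha> * I x\<close>, a combination of averages with nonnegative weights. In
  the difference between \<open>x\<close> and \<open>y\<close> the weights are frozen at \<open>y\<close>; the error \<open>(b x - b y) * trunc_op r u x / \<alpha>\<close> is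
  bounded by \<open>H * |x - y| powr \<beta> * M * (2 * a + c) / \<alpha>\<close>, with \<open>M\<close> not depending on \<open>r\<close>.
\<close>

lemma shift_operator_holder:
  assumes u: "u \<in> holder_ball \<beta> a c" and r: "r > 0" and \<alpha>: "\<alpha> > 0" "B * mass r \<le> \<alpha>"
  shows "(\<lambda>x. u x + b t x * trunc_op r u x / \<alpha>) \<in> holder_ball \<beta> a (c + H * M / \<alpha> * (2 * a + c))"
proof -
  let ?S = "\<lambda>x. u x + b t x * trunc_op r u x / \<alpha>"
  let ?I = "\<lambda>x. \<integral>z. indicator (- ball 0 r) z * u (x + z) \<partial>\<nu>"
  note ub = holder_ballD(1)[OF u]
  note um = holder_measurable[OF u]
  have k: "b t x * mass r / \<alpha> \<le> 1" for x
  proof -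
    have "b t x * mass r \<le> \<alpha>" using \<alpha> mult_right_mono[OF b_range(2) mass_nonneg] order_trans by blast
    then show ?thesis using \<alpha> by simp
  qed
  have k0: "0 \<le> b t x / \<alpha>" for x using \<alpha> b_range by simp
  have S: "?S x = (1 - b t x * mass r / \<alpha>) * u x + b t x / \<alpha> * ?I x" for x
    using \<alpha> by (simp add: trunc_op_eq(1)[OF um ub r] field_simps)
  show ?thesis
  proof (rule holder_ballI)
    show "0 \<le> c + H * M / \<alpha> * (2 * a + c)"
      using holder_const_nonneg[OF u] holder_ballD(3)[OF u] \<alpha> H M by auto
    fix x
    have "\<bar>?S x\<bar> \<le> \<bar>(1 - b t x * mass r / \<alpha>) * u x\<bar> + \<bar>b t x / \<alpha> * ?I x\<bar>"
      unfolding S by (rule abs_triangle_ineq)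
    also have "\<dots> \<le> (1 - b t x * mass r / \<alpha>) * a + b t x / \<alpha> * (a * mass r)"
      unfolding abs_mult abs_of_nonneg[OF k0] using k[of x] k0[of x]
      by (intro add_mono mult_mono outside_integral_bound ub r) (auto simp: abs_of_nonneg)
    also have "\<dots> = a" by (simp add: algebra_simps)
    finally show "\<bar>?S x\<bar> \<le> a" .
    fix y
    have I: "\<bar>?I x - ?I y\<bar> \<le> c * norm (x - y) powr \<beta> * mass r"
    proof -
      have "?I x - ?I y = (\<integral>z. indicator (- ball 0 r) z * (u (x + z) - u (y + z)) \<partial>\<nu>)"
        by (subst Bochner_Integration.integral_diff[symmetric, OF trunc_op_eq(2)[OF um ub r] trunc_op_eq(2)[OF um ub
            r]])
           (simp add: algebra_simps)
      also have "\<bar>\<dots>\<bar> \<le> c * norm (x - y) powr \<beta> * mass r"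
      proof (rule outside_integral_bound[OF _ r])
        show "\<bar>u (x + z) - u (y + z)\<bar> \<le> c * norm (x - y) powr \<beta>" for z
          using holder_ballD(2)[OF u, of "x + z" "y + z"] by simp
      qed
      finally show ?thesis .
    qed
    have "?S x - ?S y = (1 - b t y * mass r / \<alpha>) * (u x - u y) + b t y / \<alpha> * (?I x - ?I y)
        + (b t x - b t y) * (trunc_op r u x / \<alpha>)"
      using \<alpha> by (simp add: trunc_op_eq(1)[OF um ub r] field_simps)
    also have "\<bar>\<dots>\<bar> \<le> \<bar>(1 - b t y * mass r / \<alpha>) * (u x - u y)\<bar> + \<bar>b t y / \<alpha> * (?I x - ?I y)\<bar>
        + \<bar>(b t x - b t y) * (trunc_op r u x / \<alpha>)\<bar>" by linarith
    also have "\<dots> \<le> (1 - b t y * mass r / \<alpha>) * (c * norm (x - y) powr \<beta>) + b t y / \<alpha> * (c * norm (x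
        - y) powr \<beta> * mass r)
        + (H * norm (x - y) powr \<beta>) * ((2 * a + c) * M / \<alpha>)"
    proof (intro add_mono)
      show "\<bar>(1 - b t y * mass r / \<alpha>) * (u x - u y)\<bar> \<le> (1 - b t y * mass r / \<alpha>) * (c * norm (x - y) powr \<beta>)"
        unfolding abs_mult using k[of y] holder_ballD(2)[OF u, of x y] by (simp add: mult_left_mono abs_of_nonneg)
      show "\<bar>b t y / \<alpha> * (?I x - ?I y)\<bar> \<le> b t y / \<alpha> * (c * norm (x - y) powr \<beta> * mass r)"
        unfolding abs_mult abs_of_nonneg[OF k0] by (intro mult_left_mono I k0)
      have "\<bar>trunc_op r u x / \<alpha>\<bar> \<le> (2 * a + c) * M / \<alpha>"
        using trunc_op_bound[OF u, of r x] \<alpha> by (simp add: divide_right_mono)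
      then show "\<bar>(b t x - b t y) * (trunc_op r u x / \<alpha>)\<bar> \<le> (H * norm (x - y) powr \<beta>) * ((2 * a + c) * M / \<alpha>)"
        unfolding abs_mult using b_holder[of t x y] H by (intro mult_mono) auto
    qed
    also have "\<dots> = (c + H * M / \<alpha> * (2 * a + c)) * norm (x - y) powr \<beta>" by (simp add: algebra_simps)
    finally show "\<bar>?S x - ?S y\<bar> \<le> (c + H * M / \<alpha> * (2 * a + c)) * norm (x - y) powr \<beta>" .
  qed
qed

lemma small_tendsto_0: "(\<lambda>n. small (1 / real (Suc n))) \<longlonglongrightarrow> 0"
proof -
  have "(\<lambda>n. small (1 / real (Suc n))) \<longlonglongrightarrow> (\<integral>z. 0 \<partial>\<nu>)"
    unfolding small_def
  proof (rule integral_dominated_convergence[where w = weight])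
    show "AE z in \<nu>. (\<lambda>n. indicator (ball 0 (1 / real (Suc n))) z * weight z) \<longlonglongrightarrow> 0"
    proof (rule AE_mp[OF AE_not_in])
      show "{0} \<in> null_sets \<nu>" using \<nu>_zero by (auto simp: null_sets_def sets_\<nu>)
      show "AE z in \<nu>. z \<notin> {0} \<longrightarrow> (\<lambda>n. indicator (ball 0 (1 / real (Suc n))) z * weight z) \<longlonglongrightarrow> 0"
      proof (intro AE_I2 impI)
        fix z :: 'a assume "z \<notin> {0}"
        then have "0 < norm z" by simp
        from order_tendstoD(2)[OF LIMSEQ_inverse_real_of_nat this]
        have "\<forall>\<^sub>F n in sequentially. indicator (ball 0 (1 / real (Suc n))) z * weight z = 0"
          by eventually_elim (auto simp: indicator_def inverse_eq_divide)
        then show "(\<lambda>n. indicator (ball 0 (1 / real (Suc n))) z * weight z) \<longlonglongrightarrow> 0"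
          by (rule tendsto_eventually)
      qed
    qed
    show "AE z in \<nu>. norm (indicator (ball 0 (1 / real (Suc n))) z * weight z) \<le> weight z" for n
      by (intro AE_I2) (auto simp: indicator_def weight_nonneg)
    show "(\<lambda>z. indicator (ball 0 (1 / real (Suc n))) z * weight z) \<in> borel_measurable \<nu>" for n
    proof -
      have [measurable]: "ball (0::'a) (1 / real (Suc n)) \<in> sets borel" by simp
      show ?thesis by measurable
    qed
  qed (auto intro: weight_integrable)
  then show ?thesis by simp
qed

lemma continuous_section:
  fixes g :: "real \<Rightarrow> 'a \<Rightarrow> real"
  assumes "continuous_on ({0<..<T} \<times> UNIV) (\<lambda>(t, x). g t x)" "t \<in> {0<..<T}"
  shows "continuous_on UNIV (g t)"
proof -
  have "continuous_on UNIV ((\<lambda>(t, x). g t x) \<circ> (\<lambda>x. (t, x)))"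
    by (intro continuous_on_compose continuous_on_subset[OF assms(1)])
        (use assms(2) in \<open>auto intro!: continuous_intros\<close>)
  then show ?thesis by (simp add: o_def)
qed

lemma continuous_b_times:
  assumes "continuous_on UNIV f"
  shows "continuous_on ({0<..<T} \<times> UNIV) (\<lambda>(t, x). b t x * f x)"
proof -
  have "continuous_on ({0<..<T} \<times> UNIV) (\<lambda>p. (case p of (t, x) \<Rightarrow> b t x) * f (snd p))"
    by (intro continuous_on_mult b_cont continuous_on_compose2[OF assms]) (auto intro!: continuous_intros)
  then show ?thesis by (simp add: split_beta)
qed

lemma abs_integral_le:
  assumes "prob_space \<mu>" "sets \<mu> = sets borel" "continuous_on UNIV f" "\<And>x. \<bar>f x\<bar> \<le> (C::real)"
  shows "\<bar>\<integral>x. f x \<partial>\<mu>\<bar> \<le> C" "integrable \<mu> f"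
proof -
  interpret prob_space \<mu> by fact
  note [measurable_cong] = assms(2)
  have [measurable]: "f \<in> borel_measurable borel" using assms(3) by (rule borel_measurable_continuous_onI)
  show i: "integrable \<mu> f" by (rule integrable_bounded_real[OF _ assms(4)]) measurable
  have "\<bar>\<integral>x. f x \<partial>\<mu>\<bar> \<le> (\<integral>x. \<bar>f x\<bar> \<partial>\<mu>)" by (rule integral_abs_bound)
  also have "\<dots> \<le> (\<integral>x. C \<partial>\<mu>)" by (intro integral_mono integrable_abs i) (use assms(4) in auto)
  finally show "\<bar>\<integral>x. f x \<partial>\<mu>\<bar> \<le> C" by (simp add: prob_space)
qed

text \<open>
  The number \<open>2 * B * small r\<close> is the price for the truncation
      and can be made small first; the defect \<open>\<delta>\<close> is multiplied
  by the total jump rate, which is large but fixed once \<open>r\<close> is chosen.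

  The proof improves the bound \<open>exp (\<kappa>' * t) * (2 * \<theta> ^ j * a + \<gamma> * (2 * a + c))\<close>
      by induction on \<open>j\<close>: the trivial bound
  \<open>2 * a\<close> starts it, each use of the variation of constants formula multiplies the first term by \<open>\<theta> < 1\<close>, and \<open>\<gamma>\<close> is
  the fixed point of the resulting recursion for the second one.
\<close>

lemma stability:
  assumes m: "measurable_curve T m" and m': "measurable_curve T m'" and \<delta>: "0 \<le> \<delta>" and r: "r > 0"
  defines "D \<equiv> \<lambda>t u. (\<integral>x. u x \<partial>m t) - (\<integral>x. u x \<partial>m' t)"
  assumes eq: "\<And>a c u t. u \<in> holder_ball \<beta> a c \<Longrightarrow> t \<in> {0..T} \<Longrightarrow>
     \<bar>D t u - (LINT \<tau>:{0<..<t}|lborel. D \<tau> (\<lambda>x. b \<tau> x * levy_op \<nu> u x))\<bar> \<le> \<delta> * (2 * a + c)"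
  assumes u: "u \<in> holder_ball \<beta> a c" and t: "t \<in> {0..T}"
  shows "\<bar>D t u\<bar> \<le> exp ((H * M + 1) * T) * ((2 * B * small r + \<delta> * (2 * (B * mass r + 1) + H * M + 1)) * (2 * a + c))"
proof -
  define \<alpha> where "\<alpha> = B * mass r + 1"
  define \<kappa> where "\<kappa> = H * M"
  define \<kappa>' where "\<kappa>' = \<kappa> + 1"
  define \<theta> where "\<theta> = \<alpha> / (\<alpha> + \<kappa>')"
  \<comment> \<open>the value for which the recursion reproduces itself: \<gamma> (\<alpha> + \<kappa>) + 2 B small r + \<alpha> \<delta> + \<delta> (\<alpha> + \<kappa>') = \<gamma> (\<alpha> + \<kappa>')\<close>
  define \<gamma> where "\<gamma> = 2 * B * small r + \<delta> * (2 * \<alpha> + \<kappa> + 1)"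
  have \<alpha>: "\<alpha> > 0" "B * mass r \<le> \<alpha>" using B mass_nonneg[of r] by (auto simp: \<alpha>_def add_nonneg_pos)
  have \<kappa>: "\<kappa> \<ge> 0" "\<kappa>' > 0" using H M by (auto simp: \<kappa>_def \<kappa>'_def add_nonneg_pos)
  have \<gamma>0: "\<gamma> \<ge> 0" using B small_nonneg[of r] \<delta> \<alpha> \<kappa> by (simp add: \<gamma>_def)
  have pm: "prob_space (m t)" "sets (m t) = sets borel" "prob_space (m' t)" "sets (m' t) = sets borel" if "t \<in> {0..T}"
      for t
    using m m' that by (auto simp: measurable_curve_def)
  have Dbound: "\<bar>D t f\<bar> \<le> 2 * C" if "t \<in> {0..T}" "continuous_on UNIV f" "\<And>x. \<bar>f x\<bar> \<le> C" for t f C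
    using abs_integral_le(1)[OF pm(1,2)[OF that(1)] that(2,3)] abs_integral_le(1)[OF pm(3,4)[OF that(1)] that(2,3)]
    by (simp add: D_def)
  have Dlin: "D t (\<lambda>x. f x + k * g x) = D t f + k * D t g"
    if "t \<in> {0..T}" "continuous_on UNIV f" "\<And>x. \<bar>f x\<bar> \<le> C" "continuous_on UNIV g" "\<And>x. \<bar>g x\<bar> \<le> C'" for t f g C C' k
    using abs_integral_le(2)[OF pm(1,2)[OF that(1)] that(2,3)] abs_integral_le(2)[OF pm(3,4)[OF that(1)] that(2,3)]
      abs_integral_le(2)[OF pm(1,2)[OF that(1)] that(4,5)] abs_integral_le(2)[OF pm(3,4)[OF that(1)] that(4,5)]
    by (simp add: D_def algebra_simps)
  have main: "\<bar>D t u\<bar> \<le> exp (\<kappa>' * t) * (2 * \<theta> ^ j * a + \<gamma> * (2 * a + c))"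
    if "u \<in> holder_ball \<beta> a c" "t \<in> {0..T}" for j a c u t
    using that
  proof (induction j arbitrary: a c u t)
    case 0
    note u = 0(1) and t = 0(2)
    have a: "a \<ge> 0" "2 * a + c \<ge> 0" using holder_ballD[OF u] holder_const_nonneg[OF u] by auto
    have "\<bar>D t u\<bar> \<le> 2 * a"
      by (intro Dbound t holder_continuous[OF u \<beta>(1)] holder_ballD(1)[OF u])
    also have "\<dots> \<le> 1 * (2 * \<theta> ^ 0 * a + \<gamma> * (2 * a + c))" using a \<gamma>0 by simp
    also have "\<dots> \<le> exp (\<kappa>' * t) * (2 * \<theta> ^ 0 * a + \<gamma> * (2 * a + c))"
      using a \<gamma>0 t \<kappa> by (intro mult_right_mono) auto
    finally show ?case .
  next
    case (Suc j)
    note u = Suc.prems(1) and t = Suc.prems(2)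
    define q where "q = 2 * a + c"
    have a: "a \<ge> 0" "q \<ge> 0" using holder_ballD[OF u] holder_const_nonneg[OF u] by (auto simp: q_def)
    have cu: "continuous_on UNIV u" by (rule holder_continuous[OF u \<beta>(1)])
    have cbL: "continuous_on UNIV (\<lambda>x. b \<tau> x * levy_op \<nu> u x)" "continuous_on UNIV (\<lambda>x. b \<tau> x * trunc_op r u x)"
      if "\<tau> \<in> {0<..<T}" for \<tau>
      using continuous_section[OF continuous_b_times[OF levy_op_continuous[OF u]] that]
        continuous_section[OF continuous_b_times[OF trunc_op_continuous[OF u]] that] by auto
    have bbL: "\<bar>b \<tau> x * levy_op \<nu> u x\<bar> \<le> B * (q * M)" "\<bar>b \<tau> x * trunc_op r u x\<bar> \<le> B * (q * M)" for \<tau> x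
      using levy_op_bound[OF u, of x] trunc_op_bound[OF u, of r x] b_range[of \<tau> x] B
      unfolding abs_mult q_def by (auto intro!: mult_mono)
    define g where "g \<tau> = indicator {0<..<T} \<tau> * D \<tau> (\<lambda>x. b \<tau> x * levy_op \<nu> u x)" for \<tau>
    have g_meas: "g \<in> borel_measurable borel"
    proof -
      have "(\<lambda>\<tau>. indicator {0<..<T} \<tau> * flux u m \<tau>) \<in> borel_measurable borel"
        "(\<lambda>\<tau>. indicator {0<..<T} \<tau> * flux u m' \<tau>) \<in> borel_measurable borel"
        using m m' continuous_b_times[OF levy_op_continuous[OF u]] bbL(1) unfolding measurable_curve_def by blast+
      then have "(\<lambda>\<tau>. indicator {0<..<T} \<tau> * flux u m \<tau>
          - indicator {0<..<T} \<tau> * flux u m' \<tau>) \<in> borel_measurable borel"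
        by (rule borel_measurable_diff)
      then show ?thesis by (simp add: g_def[abs_def] D_def right_diff_distrib)
    qed
    have g_bound: "\<bar>g \<tau>\<bar> \<le> 2 * (B * (q * M))" for \<tau>
    proof (cases "\<tau> \<in> {0<..<T}")
      case True
      then show ?thesis using Dbound[OF _ cbL(1)[OF True] bbL(1)] by (simp add: g_def)
    next
      case False
      then show ?thesis using B a M by (simp add: g_def)
    qed
    define F where "F t = (LINT \<tau>:{0<..<t}|lborel. g \<tau>)" for t
    have FD: "\<bar>D \<tau> u - F \<tau>\<bar> \<le> \<delta> * q" if "\<tau> \<in> {0..T}" for \<tau>
    proof -
      have "F \<tau> = (LINT s:{0<..<\<tau>}|lborel. D s (\<lambda>x. b s x * levy_op \<nu> u x))"
        unfolding F_def set_lebesgue_integral_def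
        by (intro Bochner_Integration.integral_cong) (use that in \<open>auto simp: g_def indicator_def\<close>)
      then show ?thesis using eq[OF u that] by (simp add: q_def)
    qed
    \<comment> \<open>the induction hypothesis for the shifted function, the small jumps, and the defect\<close>
    define G where "G = 2 * \<alpha> * \<theta> ^ j * a + \<gamma> * (\<alpha> + \<kappa>) * q + 2 * B * small r * q + \<alpha> * \<delta> * q"
    have \<theta>0: "\<theta> \<ge> 0" using \<alpha> \<kappa> by (simp add: \<theta>_def)
    have G0: "G \<ge> 0" unfolding G_def using \<alpha> \<theta>0 a \<gamma>0 \<kappa> B small_nonneg[of r] \<delta>
      by (intro add_nonneg_nonneg mult_nonneg_nonneg) auto
    have key: "\<bar>\<alpha> * F \<tau> + g \<tau>\<bar> \<le> G * exp (\<kappa>' * \<tau>)" if \<tau>: "\<tau> \<in> {0<..<t}" for \<tau>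
    proof -
      have \<tau>T: "\<tau> \<in> {0<..<T}" "\<tau> \<in> {0..T}" using \<tau> t by auto
      let ?S = "\<lambda>x. u x + b \<tau> x * trunc_op r u x / \<alpha>"
      have S: "?S \<in> holder_ball \<beta> a (c + H * M / \<alpha> * (2 * a + c))"
        by (rule shift_operator_holder[OF u r \<alpha>])
      have "\<bar>D \<tau> ?S\<bar> \<le> exp (\<kappa>' * \<tau>) * (2 * \<theta> ^ j * a + \<gamma> * (2 * a + (c + H * M / \<alpha> * (2 * a + c))))"
        by (rule Suc.IH[OF S \<tau>T(2)])
      also have "2 * a + (c + H * M / \<alpha> * (2 * a + c)) = (\<alpha> + \<kappa>) / \<alpha> * q"
        using \<alpha> by (simp add: q_def \<kappa>_def field_simps)
      finally have "\<alpha> * \<bar>D \<tau> ?S\<bar> \<le> \<alpha> * (exp (\<kappa>' * \<tau>) * (2 * \<theta> ^ j * a + \<gamma> * ((\<alpha> + \<kappa>) / \<alpha> * q)))"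
        using \<alpha> by (intro mult_left_mono) auto
      also have "\<dots> = exp (\<kappa>' * \<tau>) * (2 * \<alpha> * \<theta> ^ j * a + \<gamma> * (\<alpha> + \<kappa>) * q)"
        using \<alpha> by (simp add: field_simps)
      finally have 1: "\<bar>\<alpha> * D \<tau> ?S\<bar> \<le> exp (\<kappa>' * \<tau>) * (2 * \<alpha> * \<theta> ^ j * a + \<gamma> * (\<alpha> + \<kappa>) * q)"
        using \<alpha> by (simp add: abs_mult)
      have 2: "\<alpha> * D \<tau> ?S = \<alpha> * D \<tau> u + D \<tau> (\<lambda>x. b \<tau> x * trunc_op r u x)"
        using Dlin[OF \<tau>T(2) cu holder_ballD(1)[OF u] cbL(2)[OF \<tau>T(1)] bbL(2), of "1 / \<alpha>"] \<alpha>
        by (simp add: field_simps)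
      have 3: "\<bar>D \<tau> (\<lambda>x. b \<tau> x * levy_op \<nu> u x) - D \<tau> (\<lambda>x. b \<tau> x * trunc_op r u x)\<bar> \<le> 2 * (B * (q * small r))"
      proof -
        have "D \<tau> (\<lambda>x. b \<tau> x * levy_op \<nu> u x) - D \<tau> (\<lambda>x. b \<tau> x * trunc_op r u x)
           = D \<tau> (\<lambda>x. b \<tau> x * levy_op \<nu> u x + (- 1) * (b \<tau> x * trunc_op r u x))"
          by (subst Dlin[OF \<tau>T(2) cbL(1)[OF \<tau>T(1)] bbL(1) cbL(2)[OF \<tau>T(1)] bbL(2)]) simp
        also have "\<bar>\<dots>\<bar> \<le> 2 * (B * (q * small r))"
        proof (rule Dbound[OF \<tau>T(2)])
          show "continuous_on UNIV (\<lambda>x. b \<tau> x * levy_op \<nu> u x + - 1 * (b \<tau> x * trunc_op r u x))"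
            by (intro continuous_on_add continuous_on_mult_left cbL \<tau>T)
          fix x
          have "\<bar>b \<tau> x * (levy_op \<nu> u x - trunc_op r u x)\<bar> \<le> B * (q * small r)"
            unfolding abs_mult q_def using b_range[of \<tau> x] levy_op_trunc_op[OF u, of x r] B by (intro mult_mono) auto
          then show "\<bar>b \<tau> x * levy_op \<nu> u x + - 1 * (b \<tau> x * trunc_op r u x)\<bar> \<le> B * (q * small r)"
            by (simp add: algebra_simps)
        qed
        finally show ?thesis .
      qed
      have 4: "\<bar>\<alpha> * F \<tau> - \<alpha> * D \<tau> u\<bar> \<le> \<alpha> * (\<delta> * q)"
      proof -
        have "\<alpha> * \<bar>D \<tau> u - F \<tau>\<bar> \<le> \<alpha> * (\<delta> * q)" using FD[OF \<tau>T(2)] \<alpha> by (intro mult_left_mono) auto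
        moreover have "\<alpha> * \<bar>D \<tau> u - F \<tau>\<bar> = \<bar>\<alpha> * F \<tau> - \<alpha> * D \<tau> u\<bar>"
          using \<alpha> by (simp add: abs_mult[symmetric] abs_minus_commute right_diff_distrib[symmetric]) (simp add:
              abs_mult abs_minus_commute)
        ultimately show ?thesis by simp
      qed
      have e1: "1 \<le> exp (\<kappa>' * \<tau>)" using \<kappa> \<tau> by simp
      have "\<bar>\<alpha> * F \<tau> + g \<tau>\<bar> \<le> exp (\<kappa>' * \<tau>) * (2 * \<alpha> * \<theta> ^ j * a + \<gamma> * (\<alpha> + \<kappa>) * q) + (2 * (B * (q * small r))
          + \<alpha> * (\<delta> * q))"
        using 1 2 3 4 \<tau>T by (simp add: g_def)
      also have "2 * (B * (q * small r)) + \<alpha> * (\<delta> * q) \<le> exp (\<kappa>' * \<tau>) * (2 * (B * (q * small r)) + \<alpha> * (\<delta> * q))"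
      proof -
        have "0 \<le> 2 * (B * (q * small r)) + \<alpha> * (\<delta> * q)" using B a small_nonneg[of r] \<alpha> \<delta> by simp
        from mult_right_mono[OF e1 this] show ?thesis by simp
      qed
      finally show ?thesis by (simp add: G_def algebra_simps)
    qed
    have "\<bar>F t\<bar> \<le> G / (\<alpha> + \<kappa>') * exp (\<kappa>' * t)"
      unfolding F_def
      by (rule duhamel_bound[OF g_meas g_bound \<alpha>(1) \<kappa>(2)]) (use t key G0 in \<open>auto simp: F_def\<close>)
    moreover have "\<bar>D t u\<bar> \<le> \<bar>F t\<bar> + \<delta> * q" using FD[OF t] by linarith
    moreover have "\<delta> * q \<le> \<delta> * q * exp (\<kappa>' * t)"
      using mult_left_mono[of 1 "exp (\<kappa>' * t)" "\<delta> * q"] \<kappa> t \<delta> a by simp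
    moreover have "G / (\<alpha> + \<kappa>') + \<delta> * q = 2 * \<theta> ^ Suc j * a + \<gamma> * q"
    proof -
      have "\<alpha> + \<kappa>' > 0" using \<alpha> \<kappa> by simp
      then have "G / (\<alpha> + \<kappa>') + \<delta> * q = (G + \<delta> * q * (\<alpha> + \<kappa>')) / (\<alpha> + \<kappa>')"
        by (simp add: add_divide_distrib)
      also have "G + \<delta> * q * (\<alpha> + \<kappa>') = 2 * \<alpha> * \<theta> ^ j * a + \<gamma> * q * (\<alpha> + \<kappa>')"
        by (simp add: G_def \<gamma>_def \<kappa>'_def algebra_simps)
      also have "\<dots> / (\<alpha> + \<kappa>') = 2 * (\<alpha> / (\<alpha> + \<kappa>')) * \<theta> ^ j * a + \<gamma> * q"
        using \<open>\<alpha> + \<kappa>' > 0\<close> by (simp add: add_divide_distrib)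
      finally show ?thesis by (simp add: \<theta>_def)
    qed
    ultimately have "\<bar>D t u\<bar> \<le> G / (\<alpha> + \<kappa>') * exp (\<kappa>' * t) + \<delta> * q * exp (\<kappa>' * t)"
      and eqG: "G / (\<alpha> + \<kappa>') + \<delta> * q = 2 * \<theta> ^ Suc j * a + \<gamma> * q" by linarith+
    moreover have "G / (\<alpha> + \<kappa>') * exp (\<kappa>' * t) + \<delta> * q * exp (\<kappa>' * t) = exp (\<kappa>' * t) * (G / (\<alpha> + \<kappa>') + \<delta> * q)"
      by (simp only: distrib_left mult.commute)
    ultimately show ?case unfolding eqG q_def by simp
  qed
  have a: "a \<ge> 0" "2 * a + c \<ge> 0" using holder_ballD[OF u] holder_const_nonneg[OF u] by auto
  have "\<bar>D t u\<bar> \<le> exp (\<kappa>' * t) * (2 * 0 * a + \<gamma> * (2 * a + c))"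
  proof (rule LIMSEQ_le_const)
    have "0 \<le> \<theta>" "\<theta> < 1" using \<alpha> \<kappa> by (auto simp: \<theta>_def)
    then show "(\<lambda>j. exp (\<kappa>' * t) * (2 * \<theta> ^ j * a + \<gamma> * (2 * a + c))) \<longlonglongrightarrow> exp (\<kappa>' * t) * (2 * 0 * a + \<gamma> * (2 * a + c))"
      by (intro tendsto_intros LIMSEQ_power_zero) auto
    show "\<exists>N. \<forall>j\<ge>N. \<bar>D t u\<bar> \<le> exp (\<kappa>' * t) * (2 * \<theta> ^ j * a + \<gamma> * (2 * a + c))" using main[OF u t] by blast
  qed
  also have "\<dots> \<le> exp (\<kappa>' * T) * (\<gamma> * (2 * a + c))"
    using t \<kappa> \<gamma>0 a by (auto intro!: mult_right_mono)
  finally show ?thesis by (simp add: \<kappa>'_def \<kappa>_def \<gamma>_def \<alpha>_def algebra_simps)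
qed

end

section \<open>Hoelder test functions for very weak solutions, and uniqueness\<close>

lemma cutoff_range: "0 \<le> cutoff R x" "cutoff R x \<le> 1"
  by (auto simp: cutoff_def)

lemma abs_cutoff_le: "\<bar>cutoff R x\<bar> \<le> 1"
  by (simp add: cutoff_def)

lemma cutoff_tendsto_0: "(\<lambda>n. cutoff (real n) x) \<longlonglongrightarrow> 0"
proof (rule tendsto_eventually)
  obtain n :: nat where "norm x \<le> real n" using real_arch_simple by blast
  then have "cutoff (real k) x = 0" if "k \<ge> n" for k using that by (simp add: cutoff_def)
  then show "\<forall>\<^sub>F n in sequentially. cutoff (real n) x = 0" unfolding eventually_sequentially by blast
qed

lemma prob_cutoff_small:
  assumes "prob_space \<mu>" "sets \<mu> = sets borel" "\<eta> > 0"
  obtains n :: nat where "(\<integral>x. cutoff (real n) (x :: 'a::euclidean_space) \<partial>\<mu>) < \<eta>"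
proof -
  interpret prob_space \<mu> by fact
  note [measurable_cong] = assms(2)
  have [measurable]: "cutoff R \<in> borel_measurable (borel :: 'a measure)" for R
    by (rule bounded_lipschitz_measurable[OF bounded_lipschitz_cutoff])
  have "(\<lambda>n. \<integral>x. cutoff (real n) x \<partial>\<mu>) \<longlonglongrightarrow> (\<integral>x. 0 \<partial>\<mu>)"
    by (rule integral_dominated_convergence[where w = "\<lambda>_. 1"])
       (auto simp: cutoff_tendsto_0 cutoff_range abs_of_nonneg)
  then have "\<forall>\<^sub>F n in sequentially. (\<integral>x. cutoff (real n) x \<partial>\<mu>) < \<eta>"
    using order_tendstoD(2) assms(3) by simp
  then show ?thesis using that by (auto simp: eventually_sequentially)
qed

text \<open>
  Near \<open>t0\<close> a single large ball carries almost all the mass, because the integral of a cutoff function is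
  continuous in time; on that ball \<open>g t\<close> is uniformly close to \<open>g t0\<close>.
\<close>

lemma continuous_on_integral_narrow_curve:
  fixes S :: "real set" and m :: "real \<Rightarrow> 'a::euclidean_space measure" and g :: "real \<Rightarrow> 'a \<Rightarrow> real"
  assumes P: "\<And>t. t \<in> S \<Longrightarrow> prob_space (m t) \<and> sets (m t) = sets borel"
    and narrow: "\<And>f :: 'a \<Rightarrow> real. continuous_on UNIV f \<Longrightarrow> bounded (range f) \<Longrightarrow> continuous_on S (\<lambda>t. \<integral>x. f x \<partial>m t)"
    and g: "continuous_on (S \<times> UNIV) (\<lambda>(t, x). g t x)" "\<And>t x. t \<in> S \<Longrightarrow> \<bar>g t x\<bar> \<le> C"
  shows "continuous_on S (\<lambda>t. \<integral>x. g t x \<partial>m t)"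
  unfolding continuous_on_def
proof
  fix t0 assume t0: "t0 \<in> S"
  have C: "C \<ge> 0" using g(2)[OF t0, of undefined] by (rule order_trans[OF abs_ge_zero])
  have gc: "continuous_on UNIV (g t)" if "t \<in> S" for t
  proof -
    have "continuous_on UNIV ((\<lambda>(t, x). g t x) \<circ> (\<lambda>x. (t, x)))"
      by (intro continuous_on_compose continuous_on_subset[OF g(1)]) (use that in \<open>auto intro!: continuous_intros\<close>)
    then show ?thesis by (simp add: o_def)
  qed
  have "((\<lambda>t. (\<integral>x. g t x \<partial>m t) - (\<integral>x. g t0 x \<partial>m t)) \<longlongrightarrow> 0) (at t0 within S)"
  proof (rule tendstoI)
    fix e :: real assume e: "e > 0"
    \<comment> \<open>the estimate below amounts to (1 + 2 C) \<eta>, which has to be less than e\<close>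
    define \<eta> where "\<eta> = e / (2 * C + 2)"
    have \<eta>: "\<eta> > 0" using e C by (simp add: \<eta>_def)
    obtain n :: nat where n: "(\<integral>x. cutoff (real n) x \<partial>m t0) < \<eta>"
      using prob_cutoff_small P[OF t0] \<eta> by metis
    have "continuous_on S (\<lambda>t. \<integral>x. cutoff (real n) x \<partial>m t)"
      by (rule narrow[OF bounded_lipschitz_continuous_on[OF bounded_lipschitz_cutoff]])
         (auto simp: bounded_iff cutoff_range abs_of_nonneg intro!: exI[of _ 1])
    then have "((\<lambda>t. \<integral>x. cutoff (real n) x \<partial>m t) \<longlongrightarrow> (\<integral>x. cutoff (real n) x \<partial>m t0)) (at t0 within S)"
      using t0 by (simp add: continuous_on_def)
    from order_tendstoD(2)[OF this n]
    have ev1: "\<forall>\<^sub>F t in at t0 within S. (\<integral>x. cutoff (real n) x \<partial>m t) < \<eta>" .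
    have "continuous_on (S \<times> cball 0 (real n + 1)) (\<lambda>(t, x). g t x)"
      by (rule continuous_on_subset[OF g(1)]) auto
    from continuous_on_prod_compactE[OF this compact_cball t0 \<eta>]
    obtain X0 where X0: "t0 \<in> X0" "open X0"
      and X0': "\<forall>t\<in>X0 \<inter> S. \<forall>x\<in>cball 0 (real n + 1). dist (case (t, x) of (t, x) \<Rightarrow> g t x) (case (t0, x) of (t, x) \<Rightarrow> g t
          x) \<le> \<eta>"
      by metis
    have ev2: "\<forall>\<^sub>F t in at t0 within S. t \<in> X0 \<inter> S"
      using X0 unfolding eventually_at_topological by blast
    from ev1 ev2 show "\<forall>\<^sub>F t in at t0 within S. dist ((\<integral>x. g t x \<partial>m t) - (\<integral>x. g t0 x \<partial>m t)) 0 < e"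
    proof eventually_elim
      case (elim t)
      then have t: "t \<in> S" "t \<in> X0" by auto
      interpret prob_space "m t" using P[OF t(1)] by simp
      have sm[measurable_cong]: "sets (m t) = sets borel" using P[OF t(1)] by simp
      have [measurable]: "g t \<in> borel_measurable borel" "g t0 \<in> borel_measurable borel"
        using gc t t0 by (auto intro: borel_measurable_continuous_onI)
      have [measurable]: "cutoff R \<in> borel_measurable (borel :: 'a measure)" for R
        by (rule bounded_lipschitz_measurable[OF bounded_lipschitz_cutoff])
      have i: "integrable (m t) (g t)" "integrable (m t) (g t0)" "integrable (m t) (cutoff (real n))"
        using integrable_bounded_real[of "g t" C] integrable_bounded_real[of "g t0" C]
          integrable_bounded_real[of "cutoff (real n)" 1] g(2)[OF t(1)] g(2)[OF t0]
        by (simp_all add: abs_cutoff_le)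
      have "\<bar>(\<integral>x. g t x \<partial>m t) - (\<integral>x. g t0 x \<partial>m t)\<bar> = \<bar>\<integral>x. g t x - g t0 x \<partial>m t\<bar>"
        using i by simp
      also have "\<dots> \<le> (\<integral>x. \<bar>g t x - g t0 x\<bar> \<partial>m t)" by (rule integral_abs_bound)
      also have "\<dots> \<le> (\<integral>x. \<eta> + 2 * C * cutoff (real n) x \<partial>m t)"
      proof (rule integral_mono)
        show "integrable (m t) (\<lambda>x. \<bar>g t x - g t0 x\<bar>)" using i by simp
        show "integrable (m t) (\<lambda>x. \<eta> + 2 * C * cutoff (real n) x)" using i by simp
        fix x
        show "\<bar>g t x - g t0 x\<bar> \<le> \<eta> + 2 * C * cutoff (real n) x"
        proof (cases "norm x \<le> real n + 1")
          case True
          then have "\<bar>g t x - g t0 x\<bar> \<le> \<eta>" using X0' t by (auto simp: dist_real_def)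
          moreover have "0 \<le> 2 * C * cutoff (real n) x" using C cutoff_range(1)[of "real n" x] by simp
          ultimately show ?thesis by linarith
        next
          case False
          then have "cutoff (real n) x = 1" by (simp add: cutoff_def)
          then show ?thesis using g(2)[OF t(1), of x] g(2)[OF t0, of x] \<eta> by simp
        qed
      qed
      also have "\<dots> = \<eta> + 2 * C * (\<integral>x. cutoff (real n) x \<partial>m t)" using i by (simp add: prob_space)
      also have "\<dots> \<le> \<eta> + 2 * C * \<eta>" using elim C by (intro add_left_mono mult_left_mono) auto
      also have "\<dots> < e"
      proof -
        have "(2 * C + 2) * \<eta> = e" using C by (simp add: \<eta>_def)
        then show ?thesis using \<eta> by (simp add: algebra_simps)
      qed
      finally show ?case by (simp add: dist_real_def)
    qed
  qed
  moreover have "((\<lambda>t. \<integral>x. g t0 x \<partial>m t) \<longlongrightarrow> (\<integral>x. g t0 x \<partial>m t0)) (at t0 within S)"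
  proof -
    have "bounded (range (g t0))" using g(2)[OF t0] by (auto simp: bounded_iff)
    then show ?thesis using narrow[OF gc[OF t0]] t0 by (simp add: continuous_on_def)
  qed
  ultimately have "((\<lambda>t. ((\<integral>x. g t x \<partial>m t) - (\<integral>x. g t0 x \<partial>m t)) + (\<integral>x. g t0 x \<partial>m t)) \<longlongrightarrow> 0
      + (\<integral>x. g t0 x \<partial>m t0)) (at t0 within S)"
    by (rule tendsto_add)
  then show "((\<lambda>t. \<integral>x. g t x \<partial>m t) \<longlongrightarrow> (\<integral>x. g t0 x \<partial>m t0)) (at t0 within S)" by simp
qed

lemma narrow_curve_measurable:
  assumes "m \<in> narrow_curves T" shows "measurable_curve T m"
  unfolding measurable_curve_def
proof (intro conjI ballI allI impI)
  fix t assume "t \<in> {0..T}"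
  then show "prob_space (m t)" "sets (m t) = sets borel"
    using assms by (auto simp: narrow_curves_iff borel_probs_def)
next
  fix g :: "real \<Rightarrow> 'a \<Rightarrow> real" and C
  assume g: "continuous_on ({0<..<T} \<times> UNIV) (\<lambda>(t, x). g t x)" "\<forall>t x. \<bar>g t x\<bar> \<le> C"
  have "continuous_on {0<..<T} (\<lambda>t. \<integral>x. g t x \<partial>m t)"
  proof (rule continuous_on_integral_narrow_curve[OF _ _ g(1)])
    show "prob_space (m t) \<and> sets (m t) = sets borel" if "t \<in> {0<..<T}" for t
      using assms that by (auto simp: narrow_curves_iff borel_probs_def)
    show "continuous_on {0<..<T} (\<lambda>t. \<integral>x. f x \<partial>m t)" if "continuous_on UNIV f" "bounded (range f)"
        for f :: "'a \<Rightarrow> real"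
      by (rule continuous_on_subset[of "{0..T}"]) (use assms that in \<open>auto simp: narrow_curves_iff\<close>)
  qed (use g in auto)
  then have "(\<lambda>t. indicator {0<..<T} t *\<^sub>R (\<integral>x. g t x \<partial>m t)) \<in> borel_measurable borel"
    by (intro borel_measurable_continuous_on_indicator) auto
  then show "(\<lambda>t. indicator {0<..<T} t * (\<integral>x. g t x \<partial>m t)) \<in> borel_measurable borel" by simp
qed

context fokker_planck
begin

lemma holder_truncate:
  fixes u :: "'a \<Rightarrow> real"
  assumes u: "u \<in> holder_ball \<beta> a c"
  shows "(\<lambda>x. (1 - cutoff R x) * u x) \<in> holder_ball \<beta> a (c + a)"
proof (rule holder_ballI)
  note ub = holder_ballD(1)[OF u] and a0 = holder_ballD(4)[OF u] and c0 = holder_ballD(3)[OF u]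
  show "0 \<le> c + a" using a0 c0 by simp
  fix x :: 'a
  show "\<bar>(1 - cutoff R x) * u x\<bar> \<le> a"
    unfolding abs_mult using mult_mono[of "\<bar>1 - cutoff R x\<bar>" 1 "\<bar>u x\<bar>" a] ub[of x] cutoff_range[of R x] by simp
  fix y :: 'a
  have \<chi>: "\<bar>cutoff R y - cutoff R x\<bar> \<le> norm (x - y) powr \<beta>"
  proof (cases "norm (x - y) \<le> 1")
    case True
    have "\<bar>norm x - norm y\<bar> \<le> norm (x - y)" by (rule norm_triangle_ineq3)
    then have "\<bar>cutoff R y - cutoff R x\<bar> \<le> norm (x - y)" by (auto simp: cutoff_def)
    also have "norm (x - y) = norm (x - y) powr 1" by simp
    also have "\<dots> \<le> norm (x - y) powr \<beta>" using True \<beta> by (intro powr_mono') auto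
    finally show ?thesis .
  next
    case False
    then have "1 \<le> norm (x - y) powr \<beta>" using \<beta> by (intro ge_one_powr_ge_zero) auto
    then show ?thesis using cutoff_range[of R x] cutoff_range[of R y] by linarith
  qed
  have "\<bar>(1 - cutoff R x) * u x - (1 - cutoff R y) * u y\<bar>
      = \<bar>(1 - cutoff R x) * (u x - u y) + (cutoff R y - cutoff R x) * u y\<bar>" by (simp add: algebra_simps)
  also have "\<dots> \<le> \<bar>1 - cutoff R x\<bar> * \<bar>u x - u y\<bar> + \<bar>cutoff R y - cutoff R x\<bar> * \<bar>u y\<bar>"
    unfolding abs_mult[symmetric] by (rule abs_triangle_ineq)
  also have "\<dots> \<le> 1 * (c * norm (x - y) powr \<beta>) + norm (x - y) powr \<beta> * a"
    using cutoff_range[of R x] c0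
    by (intro add_mono mult_mono \<chi> ub holder_ballD(2)[OF u]) auto
  finally show "\<bar>(1 - cutoff R x) * u x - (1 - cutoff R y) * u y\<bar> \<le> (c + a) * norm (x - y) powr \<beta>"
    by (simp add: algebra_simps)
qed

text \<open>
  Truncation in space and time followed by mollification in space and time. The time cutoff is one
  well beyond the interval, so near the interval the smooth functions do not depend on time. All Hoelder constants
      stay bounded,
  which is what makes \<open>levy_op\<close> converge along the approximation.
\<close>

lemma smooth_approximation:
  fixes u :: "'a \<Rightarrow> real"
  assumes u: "u \<in> holder_ball \<beta> a c"
  obtains \<phi> :: "nat \<Rightarrow> real \<times> 'a \<Rightarrow> real" and v :: "nat \<Rightarrow> 'a \<Rightarrow> real" where
    "\<And>k. \<phi> k \<in> Cc_infty" "\<And>k s x. \<bar>s\<bar> \<le> T + 1 \<Longrightarrow> \<phi> k (s, x) = v k x"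
    "\<And>k. v k \<in> holder_ball \<beta> a (c + a)" "\<And>x. (\<lambda>k. v k x) \<longlonglongrightarrow> u x"
proof -
  define w where "w k = (\<lambda>(s :: real, x). (1 - cutoff (T + 2) s) * ((1 - cutoff (real k) x) * u x))" for k
  have cu: "continuous_on S u" for S by (rule holder_continuous[OF u \<beta>(1)])
  have wc: "continuous_on UNIV (w k)" for k
    unfolding w_def split_beta
    by (intro continuous_intros continuous_on_compose2[OF bounded_lipschitz_continuous_on[OF bounded_lipschitz_cutoff,
        of UNIV]]
        continuous_on_compose2[OF cu[of UNIV]]) auto
  have wb: "bounded {p. w k p \<noteq> 0}" for k
  proof (rule bounded_subset)
    show "bounded (cball (0::real) (T + 3) \<times> cball (0::'a) (real k + 1))" by (intro bounded_Times bounded_cball)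
    show "{p. w k p \<noteq> 0} \<subseteq> cball 0 (T + 3) \<times> cball 0 (real k + 1)"
      by (auto simp: w_def cutoff_def split: if_splits)
  qed
  have "\<exists>\<pi> :: (real \<times> 'a) measure. prob_space \<pi> \<and> sets \<pi> = sets borel \<and> (AE y in \<pi>. norm y < 1 / real (Suc k)) \<and>
      (\<lambda>x. \<integral>y. w k (x - y) \<partial>\<pi>) \<in> Cc_infty" for k
  proof -
    have "1 / real (Suc k) > 0" by simp
    from exists_mollifier[OF this] obtain \<pi> :: "(real \<times> 'a) measure" where
      "prob_space \<pi>" "sets \<pi> = sets borel" "AE y in \<pi>. norm y < 1 / real (Suc k)"
      "\<And>w. continuous_on UNIV w \<Longrightarrow> bounded {x. w x \<noteq> 0} \<Longrightarrow> (\<lambda>x. \<integral>y. w (x - y) \<partial>\<pi>) \<in> Cc_infty" by metis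
    then show ?thesis using wc wb by blast
  qed
  then obtain \<pi> :: "nat \<Rightarrow> (real \<times> 'a) measure" where \<pi>: "\<And>k. prob_space (\<pi> k)" "\<And>k. sets (\<pi> k) = sets borel"
      "\<And>k. AE y in \<pi> k. norm y < 1 / real (Suc k)" "\<And>k. (\<lambda>x. \<integral>y. w k (x - y) \<partial>\<pi> k) \<in> Cc_infty" by metis
  define g where "g k x = (1 - cutoff (real k) x) * u x" for k and x :: 'a
  have gH: "g k \<in> holder_ball \<beta> a (c + a)" for k unfolding g_def by (rule holder_truncate[OF u])
  have [measurable]: "g k \<in> borel_measurable borel" for k by (rule holder_measurable[OF gH])
  define v where "v k x = (\<integral>y. g k (x - snd y) \<partial>\<pi> k)" for k x
  have gm: "(\<lambda>y. g k (x - snd y)) \<in> borel_measurable (\<pi> k)" for k x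
    unfolding measurable_cong_sets[OF \<pi>(2) refl]
    by (intro measurable_compose[OF _ \<open>g k \<in> borel_measurable borel\<close>] borel_measurable_diff borel_measurable_const)
       (auto intro!: borel_measurable_continuous_onI continuous_intros)
  have gi: "integrable (\<pi> k) (\<lambda>y. g k (x - snd y))" for k x
    using prob_space.integrable_bounded_real[OF \<pi>(1) gm holder_ballD(1)[OF gH]] .
  show thesis
  proof (rule that)
    show "(\<lambda>x. \<integral>y. w k (x - y) \<partial>\<pi> k) \<in> Cc_infty" for k by (rule \<pi>)
    show "(\<integral>y. w k ((s, x) - y) \<partial>\<pi> k) = v k x" if s: "\<bar>s\<bar> \<le> T + 1" for k s x
      unfolding v_def
    proof (rule integral_cong_AE)
      show "(\<lambda>y. w k ((s, x) - y)) \<in> borel_measurable (\<pi> k)"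
        unfolding measurable_cong_sets[OF \<pi>(2) refl]
        by (intro borel_measurable_continuous_onI continuous_on_compose2[OF wc] continuous_intros) auto
      show "AE y in \<pi> k. w k ((s, x) - y) = g k (x - snd y)"
        using \<pi>(3)[of k]
      proof eventually_elim
        case (elim y)
        have "\<bar>fst y\<bar> \<le> norm y" using norm_fst_le[of "fst y" "snd y"] by simp
        also have "\<dots> \<le> 1" using elim by (auto intro: order_trans[OF less_imp_le])
        finally have "cutoff (T + 2) (s - fst y) = 0" using s by (simp add: cutoff_def)
        then show ?case by (cases y) (simp add: w_def g_def)
      qed
    qed (rule gm)
    show "v k \<in> holder_ball \<beta> a (c + a)" for k
    proof (rule holder_ballI)
      interpret prob_space "\<pi> k" by (rule \<pi>)
      show "0 \<le> c + a" by (rule holder_ballD(3)[OF gH])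
      fix x
      have "\<bar>v k x\<bar> \<le> (\<integral>y. \<bar>g k (x - snd y)\<bar> \<partial>\<pi> k)" unfolding v_def by (rule integral_abs_bound)
      also have "\<dots> \<le> (\<integral>y. a \<partial>\<pi> k)" by (intro integral_mono integrable_abs gi) (auto simp: holder_ballD(1)[OF gH])
      finally show "\<bar>v k x\<bar> \<le> a" by (simp add: prob_space)
      fix y
      have "\<bar>v k x - v k y\<bar> = \<bar>\<integral>z. g k (x - snd z) - g k (y - snd z) \<partial>\<pi> k\<bar>"
        unfolding v_def by (subst Bochner_Integration.integral_diff[OF gi gi]) simp
      also have "\<dots> \<le> (\<integral>z. \<bar>g k (x - snd z) - g k (y - snd z)\<bar> \<partial>\<pi> k)" by (rule integral_abs_bound)
      also have "\<dots> \<le> (\<integral>z. (c + a) * norm (x - y) powr \<beta> \<partial>\<pi> k)"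
      proof (intro integral_mono integrable_abs Bochner_Integration.integrable_diff gi)
        show "\<bar>g k (x - snd z) - g k (y - snd z)\<bar> \<le> (c + a) * norm (x - y) powr \<beta>" for z
          using holder_ballD(2)[OF gH, of k "x - snd z" "y - snd z"] by simp
      qed simp
      finally show "\<bar>v k x - v k y\<bar> \<le> (c + a) * norm (x - y) powr \<beta>" by (simp add: prob_space)
    qed
    show "(\<lambda>k. v k x) \<longlonglongrightarrow> u x" for x
    proof (rule LIM_zero_cancel, rule Lim_null_comparison)
      obtain n :: nat where n: "norm x \<le> real n" using real_arch_simple by blast
      show "\<forall>\<^sub>F k in sequentially. norm (v k x - u x) \<le> (c + a) * (1 / real (Suc k)) powr \<beta>"
        using eventually_ge_at_top[of n]
      proof eventually_elim
        case (elim k)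
        interpret prob_space "\<pi> k" by (rule \<pi>)
        have gu: "g k x = u x" using n elim by (simp add: g_def cutoff_def)
        have "norm (v k x - u x) = \<bar>\<integral>z. g k (x - snd z) - g k x \<partial>\<pi> k\<bar>"
          unfolding v_def by (subst Bochner_Integration.integral_diff[OF gi]) (auto simp: gu prob_space)
        also have "\<dots> \<le> (\<integral>z. \<bar>g k (x - snd z) - g k x\<bar> \<partial>\<pi> k)" by (rule integral_abs_bound)
        also have "\<dots> \<le> (\<integral>z. (c + a) * (1 / real (Suc k)) powr \<beta> \<partial>\<pi> k)"
        proof (intro integral_mono_AE integrable_abs Bochner_Integration.integrable_diff gi integrable_const)
          show "AE z in \<pi> k. \<bar>g k (x - snd z) - g k x\<bar> \<le> (c + a) * (1 / real (Suc k)) powr \<beta>"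
            using \<pi>(3)[of k]
          proof eventually_elim
            case (elim z)
            have "\<bar>g k (x - snd z) - g k x\<bar> \<le> (c + a) * norm (snd z) powr \<beta>"
              using holder_ballD(2)[OF gH, of k "x - snd z" x] by simp
            also have "\<dots> \<le> (c + a) * (1 / real (Suc k)) powr \<beta>"
              using norm_snd_le[of "snd z" "fst z"] elim \<beta> holder_ballD(3)[OF gH]
                  by (intro mult_left_mono powr_mono2) auto
            finally show ?case .
          qed
        qed
        finally show ?case by (simp add: prob_space)
      qed
      have "(\<lambda>k. (1 / real (Suc k)) powr \<beta>) \<longlonglongrightarrow> 0 powr \<beta>"
        using LIMSEQ_inverse_real_of_nat \<beta> by (intro tendsto_powr') (auto simp: inverse_eq_divide)
      then show "(\<lambda>k. (c + a) * (1 / real (Suc k)) powr \<beta>) \<longlonglongrightarrow> 0"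
        using tendsto_mult_left[of _ 0 sequentially "c + a"] \<beta> by simp
    qed
  qed
qed

lemma levy_op_LIMSEQ:
  assumes v: "\<And>k. v k \<in> holder_ball \<beta> a c" and lim: "\<And>x. (\<lambda>k. v k x) \<longlonglongrightarrow> u x"
  shows "(\<lambda>k. levy_op \<nu> (v k) x) \<longlonglongrightarrow> levy_op \<nu> u x"
  unfolding levy_op_def
proof (rule integral_dominated_convergence[where w = "\<lambda>z. (2 * a + c) * weight z"])
  have [measurable]: "v k \<in> borel_measurable borel" for k by (rule holder_measurable[OF v])
  have [measurable]: "u \<in> borel_measurable borel" by (rule borel_measurable_LIMSEQ_real[OF lim]) simp
  show "(\<lambda>z. u (x + z) - u x) \<in> borel_measurable \<nu>" by measurable
  show "(\<lambda>z. v k (x + z) - v k x) \<in> borel_measurable \<nu>" for k by measurable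
  show "integrable \<nu> (\<lambda>z. (2 * a + c) * weight z)" using weight_integrable by simp
  show "AE z in \<nu>. (\<lambda>k. v k (x + z) - v k x) \<longlonglongrightarrow> u (x + z) - u x" by (intro AE_I2 tendsto_diff lim)
  show "AE z in \<nu>. norm (v k (x + z) - v k x) \<le> (2 * a + c) * weight z" for k
    using holder_increment[OF v] by (intro AE_I2) simp
qed

lemma flux_bound:
  assumes u: "u \<in> holder_ball \<beta> a c"
  shows "\<bar>b t x * levy_op \<nu> u x\<bar> \<le> B * ((2 * a + c) * M)"
  unfolding abs_mult using levy_op_bound[OF u, of x] b_range[of t x] B by (intro mult_mono) auto

lemma flux_continuous:
  assumes u: "u \<in> holder_ball \<beta> a c"
  shows "continuous_on ({0<..<T} \<times> UNIV) (\<lambda>(t, x). b t x * levy_op \<nu> u x)"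
  by (rule continuous_b_times[OF levy_op_continuous[OF u]])

lemma flux_curve_measurable:
  assumes m: "measurable_curve T m" and u: "u \<in> holder_ball \<beta> a c" and t: "t \<in> {0..T}"
  shows "(\<lambda>\<tau>. indicator {0<..<t} \<tau> *\<^sub>R flux u m \<tau>) \<in> borel_measurable borel"
proof -
  have "(\<lambda>\<tau>. indicator {0<..<T} \<tau> * flux u m \<tau>) \<in> borel_measurable borel"
    using m flux_continuous[OF u] flux_bound[OF u] unfolding measurable_curve_def by blast
  then have "(\<lambda>\<tau>. indicator {0<..<t} \<tau> * (indicator {0<..<T} \<tau> * flux u m \<tau>)) \<in> borel_measurable borel"
    by measurable
  moreover have "indicator {0<..<t} \<tau> * (indicator {0<..<T} \<tau> * y) = indicator {0<..<t} \<tau> *\<^sub>R y" for \<tau> y :: real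
    using t by (auto simp: indicator_def)
  ultimately show ?thesis by simp
qed

lemma flux_integral_bound:
  assumes m: "measurable_curve T m" and u: "u \<in> holder_ball \<beta> a c" and \<tau>: "\<tau> \<in> {0<..<T}"
  shows "\<bar>\<integral>x. b \<tau> x * levy_op \<nu> u x \<partial>m \<tau>\<bar> \<le> B * ((2 * a + c) * M)"
  by (rule abs_integral_le(1)[OF _ _ continuous_section[OF flux_continuous[OF u] \<tau>] flux_bound[OF u]])
     (use m \<tau> in \<open>auto simp: measurable_curve_def\<close>)

lemma flux_integrable:
  assumes m: "measurable_curve T m" and u: "u \<in> holder_ball \<beta> a c" and t: "t \<in> {0..T}"
  shows "set_integrable lborel {0<..<t} (\<lambda>\<tau>. \<integral>x. b \<tau> x * levy_op \<nu> u x \<partial>m \<tau>)"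
  unfolding set_integrable_def
proof (rule Bochner_Integration.integrable_bound)
  show "integrable lborel (\<lambda>\<tau>. indicator {0<..<t} \<tau> * (B * ((2 * a + c) * M)))"
    by (intro integrable_mult_left integrable_real_indicator) (auto simp: emeasure_lborel_Ioo_finite)
  show "(\<lambda>\<tau>. indicator {0<..<t} \<tau> *\<^sub>R flux u m \<tau>) \<in> borel_measurable lborel"
    using flux_curve_measurable[OF m u t] by simp
  show "AE \<tau> in lborel. norm (indicator {0<..<t} \<tau> *\<^sub>R flux u m \<tau>) \<le> norm (indicator {0<..<t} \<tau> * (B * ((2 * a
      + c) * M)))"
    using t flux_integral_bound[OF m u] by (intro AE_I2) (auto simp: indicator_def intro: order_trans[OF _
        abs_ge_self])
qed

lemma flux_LIMSEQ:
  assumes m: "measurable_curve T m" and v: "\<And>k. v k \<in> holder_ball \<beta> a c" and u: "u \<in> holder_ball \<beta> a' c'"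
    and lim: "\<And>x. (\<lambda>k. v k x) \<longlonglongrightarrow> u x" and t: "t \<in> {0..T}"
  shows "(\<lambda>k. LINT \<tau>:{0<..<t}|lborel. flux (v k) m \<tau>) \<longlonglongrightarrow>
    (LINT \<tau>:{0<..<t}|lborel. flux u m \<tau>)"
  unfolding set_lebesgue_integral_def
proof (rule integral_dominated_convergence[where w = "\<lambda>\<tau>. indicator {0<..<t} \<tau> * (B * ((2 * a + c) * M))"])
  show "integrable lborel (\<lambda>\<tau>. indicator {0<..<t} \<tau> * (B * ((2 * a + c) * M)))"
    by (intro integrable_mult_left integrable_real_indicator) (auto simp: emeasure_lborel_Ioo_finite)
  show "(\<lambda>\<tau>. indicator {0<..<t} \<tau> *\<^sub>R flux u m \<tau>) \<in> borel_measurable lborel"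
    using flux_curve_measurable[OF m u t] by simp
  show "(\<lambda>\<tau>. indicator {0<..<t} \<tau> *\<^sub>R flux (v k) m \<tau>) \<in> borel_measurable lborel" for k
    using flux_curve_measurable[OF m v t] by simp
  show "AE \<tau> in lborel. norm (indicator {0<..<t} \<tau> *\<^sub>R flux (v k) m \<tau>) \<le> indicator {0<..<t} \<tau> * (B * ((2 * a
      + c) * M))" for k
    using t flux_integral_bound[OF m v] by (intro AE_I2) (auto simp: indicator_def)
  have "(\<lambda>k. \<integral>x. b \<tau> x * levy_op \<nu> (v k) x \<partial>m \<tau>) \<longlonglongrightarrow> flux u m \<tau>" if \<tau>: "\<tau> \<in> {0<..<T}" for \<tau>
  proof (rule integral_dominated_convergence[where w = "\<lambda>_. B * ((2 * a + c) * M)"])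
    have p: "prob_space (m \<tau>)" and s: "sets (m \<tau>) = sets borel" using m \<tau> by (auto simp: measurable_curve_def)
    show "(\<lambda>x. b \<tau> x * levy_op \<nu> u x) \<in> borel_measurable (m \<tau>)"
      using borel_measurable_continuous_onI[OF continuous_section[OF flux_continuous[OF u] \<tau>]]
      unfolding measurable_cong_sets[OF s refl] .
    show "(\<lambda>x. b \<tau> x * levy_op \<nu> (v k) x) \<in> borel_measurable (m \<tau>)" for k
      using borel_measurable_continuous_onI[OF continuous_section[OF flux_continuous[OF v] \<tau>]]
      unfolding measurable_cong_sets[OF s refl] .
    interpret prob_space "m \<tau>" by (rule p)
    show "integrable (m \<tau>) (\<lambda>_. B * ((2 * a + c) * M))" by simp
    show "AE x in m \<tau>. (\<lambda>k. b \<tau> x * levy_op \<nu> (v k) x) \<longlonglongrightarrow> b \<tau> x * levy_op \<nu> u x"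
      by (intro AE_I2 tendsto_mult_left levy_op_LIMSEQ[OF v lim])
    show "AE x in m \<tau>. norm (b \<tau> x * levy_op \<nu> (v k) x) \<le> B * ((2 * a + c) * M)" for k
      using flux_bound[OF v] by (intro AE_I2) simp
  qed
  then show "AE \<tau> in lborel. (\<lambda>k. indicator {0<..<t} \<tau> *\<^sub>R flux (v k) m \<tau>) \<longlonglongrightarrow> indicator {0<..<t} \<tau> *\<^sub>R flux u m \<tau>"
    using t by (intro AE_I2) (auto simp: indicator_def)
qed

lemma prob_integral_LIMSEQ:
  assumes p: "prob_space \<mu>" "sets \<mu> = sets borel" and v: "\<And>k. v k \<in> holder_ball \<beta> a c"
    and lim: "\<And>x. (\<lambda>k. v k x) \<longlonglongrightarrow> u x"
  shows "(\<lambda>k. \<integral>x. v k x \<partial>\<mu>) \<longlonglongrightarrow> (\<integral>x. u x \<partial>\<mu>)"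
proof (rule integral_dominated_convergence[where w = "\<lambda>_. a"])
  interpret prob_space \<mu> by fact
  show "integrable \<mu> (\<lambda>_. a)" by simp
  have vm: "v k \<in> borel_measurable borel" for k by (rule holder_measurable[OF v])
  then show "v k \<in> borel_measurable \<mu>" for k unfolding measurable_cong_sets[OF p(2) refl] .
  have "u \<in> borel_measurable borel" by (rule borel_measurable_LIMSEQ_real[OF lim vm])
  then show "u \<in> borel_measurable \<mu>" unfolding measurable_cong_sets[OF p(2) refl] .
  show "AE x in \<mu>. (\<lambda>k. v k x) \<longlonglongrightarrow> u x" by (simp add: lim)
  show "AE x in \<mu>. norm (v k x) \<le> a" for k using holder_ballD(1)[OF v] by simp
qed

text \<open>
  The time derivative of the approximating test functions vanishes on the interval, and all terms of the weak
  formulation pass to the limit by dominated convergence.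
\<close>

lemma weak_solution_holder_test:
  assumes m: "very_weak_solution T \<nu> b m0 m" and m0: "m0 \<in> borel_probs"
    and u: "u \<in> holder_ball \<beta> a c" and t: "t \<in> {0..T}"
  shows "(\<integral>x. u x \<partial>m t) = (\<integral>x. u x \<partial>m0) + (LINT \<tau>:{0<..<t}|lborel. flux u m \<tau>)"
proof -
  have mc: "measurable_curve T m" using m by (intro narrow_curve_measurable) (simp add: very_weak_solution_def)
  obtain \<phi> :: "nat \<Rightarrow> real \<times> 'a \<Rightarrow> real" and v where \<phi>: "\<And>k. \<phi> k \<in> Cc_infty"
      "\<And>k s x. \<bar>s\<bar> \<le> T + 1 \<Longrightarrow> \<phi> k (s, x) = v k x"
    and v: "\<And>k. v k \<in> holder_ball \<beta> a (c + a)" "\<And>x. (\<lambda>k. v k x) \<longlonglongrightarrow> u x"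
    using smooth_approximation[OF u] by metis
  have eq: "(\<integral>x. v k x \<partial>m t) = (\<integral>x. v k x \<partial>m0) + (LINT \<tau>:{0<..<t}|lborel. flux (v k) m \<tau>)" for k
  proof -
    have "(\<integral>x. \<phi> k (t, x) \<partial>m t) = (\<integral>x. \<phi> k (0, x) \<partial>m0) + (LINT \<tau>:{0<..<t}|lborel.
           (\<integral>x. deriv (\<lambda>s. \<phi> k (s, x)) \<tau> + b \<tau> x * levy_op \<nu> (\<lambda>y. \<phi> k (\<tau>, y)) x \<partial>m \<tau>))"
      using m \<phi>(1) t by (simp add: very_weak_solution_def)
    also have "(LINT \<tau>:{0<..<t}|lborel.
           (\<integral>x. deriv (\<lambda>s. \<phi> k (s, x)) \<tau> + b \<tau> x * levy_op \<nu> (\<lambda>y. \<phi> k (\<tau>, y)) x \<partial>m \<tau>))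
       = (LINT \<tau>:{0<..<t}|lborel. flux (v k) m \<tau>)"
    proof (rule set_lebesgue_integral_cong)
      show "{0<..<t} \<in> sets lborel" by simp
      show "\<forall>\<tau>. \<tau> \<in> {0<..<t} \<longrightarrow> (\<integral>x. deriv (\<lambda>s. \<phi> k (s, x)) \<tau> + b \<tau> x * levy_op \<nu> (\<lambda>y. \<phi> k (\<tau>, y)) x \<partial>m \<tau>)
          = flux (v k) m \<tau>"
      proof (intro allI impI)
        fix \<tau> assume \<tau>: "\<tau> \<in> {0<..<t}"
        have "deriv (\<lambda>s. \<phi> k (s, x)) \<tau> = 0" for x
        proof -
          have "((\<lambda>s. v k x) has_field_derivative 0) (at \<tau>)" by simp
          then have "((\<lambda>s. \<phi> k (s, x)) has_field_derivative 0) (at \<tau>)"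
            by (rule has_field_derivative_transform_within_open[where S = "{0<..<t}"])
               (use \<tau> t \<phi>(2) in auto)
          then show ?thesis by (rule DERIV_imp_deriv)
        qed
        moreover have "(\<lambda>y. \<phi> k (\<tau>, y)) = v k" using \<tau> t \<phi>(2) by auto
        ultimately show "(\<integral>x. deriv (\<lambda>s. \<phi> k (s, x)) \<tau> + b \<tau> x * levy_op \<nu> (\<lambda>y. \<phi> k (\<tau>, y)) x \<partial>m \<tau>)
          = flux (v k) m \<tau>" by simp
      qed
    qed
    finally show ?thesis using \<phi>(2) t T by simp
  qed
  have pt: "prob_space (m t)" "sets (m t) = sets borel" using mc t by (auto simp: measurable_curve_def)
  have p0: "prob_space m0" "sets m0 = sets borel" using m0 by (auto simp: borel_probs_def)
  have "(\<lambda>k. \<integral>x. v k x \<partial>m t) \<longlonglongrightarrow> (\<integral>x. u x \<partial>m0) + (LINT \<tau>:{0<..<t}|lborel. flux u m \<tau>)"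
    unfolding eq by (intro tendsto_add prob_integral_LIMSEQ[OF p0 v] flux_LIMSEQ[OF mc v(1) u v(2) t])
  with prob_integral_LIMSEQ[OF pt v] show ?thesis by (rule LIMSEQ_unique)
qed

text \<open>Stability without defect, with the truncation radius tending to zero.\<close>

theorem weak_solution_unique:
  assumes m: "very_weak_solution T \<nu> b m0 m" and m': "very_weak_solution T \<nu> b m0 m'" and m0: "m0 \<in> borel_probs"
  shows "m = m'"
proof -
  have n: "m \<in> narrow_curves T" "m' \<in> narrow_curves T" using m m' by (auto simp: very_weak_solution_def)
  note mc = narrow_curve_measurable[OF n(1)] narrow_curve_measurable[OF n(2)]
  have "m t = m' t" if t: "t \<in> {0..T}" for t
  proof (rule prob_eqI_bounded_lipschitz)
    show "prob_space (m t)" "prob_space (m' t)" "sets (m t) = sets borel" "sets (m' t) = sets borel"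
      using mc t by (auto simp: measurable_curve_def)
    fix u :: "'a \<Rightarrow> real" assume "bounded_lipschitz u"
    then obtain a c where u: "u \<in> holder_ball \<beta> a c" by (rule bounded_lipschitz_imp_holder[OF _ \<beta>])
    have D: "((\<integral>x. w x \<partial>m t) - (\<integral>x. w x \<partial>m' t)) =
        (LINT \<tau>:{0<..<t}|lborel. flux w m \<tau> - flux w m' \<tau>)"
      if w: "w \<in> holder_ball \<beta> a c" and t: "t \<in> {0..T}" for w a c t
      by (subst set_integral_diff(2)[OF flux_integrable[OF mc(1) w t] flux_integrable[OF mc(2) w t]])
         (simp add: weak_solution_holder_test[OF m m0 w t] weak_solution_holder_test[OF m' m0 w t])
    have le: "\<bar>(\<integral>x. u x \<partial>m t) - (\<integral>x. u x \<partial>m' t)\<bar> \<le> exp ((H * M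
        + 1) * T) * ((2 * B * small (1 / real (Suc n))) * (2 * a + c))" for n
      using stability[OF mc(1) mc(2) order_refl _ _ u t, of "1 / real (Suc n)"] D by simp
    have "(\<lambda>n. exp ((H * M + 1) * T) * ((2 * B * small (1 / real (Suc n))) * (2 * a + c))) \<longlonglongrightarrow> exp ((H * M
        + 1) * T) * ((2 * B * 0) * (2 * a + c))"
      by (intro tendsto_intros small_tendsto_0)
    then have "\<bar>(\<integral>x. u x \<partial>m t) - (\<integral>x. u x \<partial>m' t)\<bar> \<le> exp ((H * M + 1) * T) * ((2 * B * 0) * (2 * a + c))"
      by (rule LIMSEQ_le_const) (use le in auto)
    then show "(\<integral>x. u x \<partial>m t) = (\<integral>x. u x \<partial>m' t)" by simp
  qed
  moreover have "m \<in> extensional {0..T}" "m' \<in> extensional {0..T}" using n by (auto simp: narrow_curves_iff)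
  ultimately show ?thesis by (intro extensionalityI[of _ "{0..T}"]) auto
qed

end

section \<open>Euler approximations with truncated jumps\<close>

text \<open>A jump distributed as \<open>\<rho>\<close> is proposed and accepted if a uniform random number does not exceed \<open>p x\<close>.\<close>

lemma exists_thinned_jump:
  fixes \<mu> \<rho> :: "'a::euclidean_space measure" and p :: "'a \<Rightarrow> real"
  assumes \<mu>: "prob_space \<mu>" "sets \<mu> = sets borel" and \<rho>: "prob_space \<rho>" "sets \<rho> = sets borel"
    and p[measurable]: "p \<in> borel_measurable borel" and p01: "\<And>x. 0 \<le> p x" "\<And>x. p x \<le> 1"
  shows "\<exists>\<mu>'. prob_space \<mu>' \<and> sets \<mu>' = sets borel \<and>
    (\<forall>(f :: 'a \<Rightarrow> real) C. f \<in> borel_measurable borel \<longrightarrow> (\<forall>x. \<bar>f x\<bar> \<le> C) \<longrightarrow>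
       (\<integral>x. f x \<partial>\<mu>') = (\<integral>x. (1 - p x) * f x + p x * (\<integral>z. f (x + z) \<partial>\<rho>) \<partial>\<mu>))"
proof -
  define U :: "real measure" where "U = uniform_measure lborel {0..1}"
  interpret \<mu>: prob_space \<mu> by fact
  interpret \<rho>: prob_space \<rho> by fact
  interpret U: prob_space U unfolding U_def by (rule prob_space_uniform_measure) auto
  interpret \<rho>U: pair_prob_space \<rho> U ..
  interpret Q: pair_prob_space \<mu> "\<rho> \<Otimes>\<^sub>M U" ..
  have sU[measurable_cong]: "sets U = sets borel" by (simp add: U_def)
  note [measurable_cong] = \<mu>(2) \<rho>(2)
  \<comment> \<open>position, proposed jump, and the uniform number that decides on its acceptance\<close>
  define J where "J = (\<lambda>(x, z, s). x + (if s \<le> p x then z else (0::'a)))"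
  have J[measurable]: "J \<in> borel_measurable (\<mu> \<Otimes>\<^sub>M (\<rho> \<Otimes>\<^sub>M U))"
    unfolding J_def by measurable
  show ?thesis
  proof (intro exI[of _ "distr (\<mu> \<Otimes>\<^sub>M (\<rho> \<Otimes>\<^sub>M U)) borel J"] conjI allI impI)
    show "prob_space (distr (\<mu> \<Otimes>\<^sub>M (\<rho> \<Otimes>\<^sub>M U)) borel J)" by (rule Q.P.prob_space_distr[OF J])
    show "sets (distr (\<mu> \<Otimes>\<^sub>M (\<rho> \<Otimes>\<^sub>M U)) borel J) = sets borel" by simp
    fix f :: "'a \<Rightarrow> real" and C
    assume f[measurable]: "f \<in> borel_measurable borel" and "\<forall>x. \<bar>f x\<bar> \<le> C"
    then have fC: "\<And>x. \<bar>f x\<bar> \<le> C" by simp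
    have "(\<integral>x. f x \<partial>distr (\<mu> \<Otimes>\<^sub>M (\<rho> \<Otimes>\<^sub>M U)) borel J) = (\<integral>q. f (J q) \<partial>(\<mu> \<Otimes>\<^sub>M (\<rho> \<Otimes>\<^sub>M U)))"
      by (rule integral_distr) auto
    also have "\<dots> = (\<integral>x. (\<integral>zs. f (J (x, zs)) \<partial>(\<rho> \<Otimes>\<^sub>M U)) \<partial>\<mu>)"
      by (rule Q.integral_fst'[symmetric]) (rule Q.P.integrable_bounded_real[of _ C], use fC in auto)
    also have "\<dots> = (\<integral>x. (1 - p x) * f x + p x * (\<integral>z. f (x + z) \<partial>\<rho>) \<partial>\<mu>)"
    proof (rule Bochner_Integration.integral_cong[OF refl])
      fix x
      have "(\<integral>zs. f (J (x, zs)) \<partial>(\<rho> \<Otimes>\<^sub>M U)) = (\<integral>z. (\<integral>s. f (J (x, (z, s))) \<partial>U) \<partial>\<rho>)"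
        by (rule \<rho>U.integral_fst'[symmetric]) (rule \<rho>U.P.integrable_bounded_real[of _ C], use fC in \<open>auto simp:
            J_def\<close>)
      also have "\<dots> = (\<integral>z. (1 - p x) * f x + p x * f (x + z) \<partial>\<rho>)"
      proof (rule Bochner_Integration.integral_cong[OF refl])
        fix z
        have eq: "f (J (x, (z, s))) = f x + indicator {..p x} s * (f (x + z) - f x)" for s
          by (simp add: J_def indicator_def)
        have "{0..1} \<inter> {..p x} = {0..p x}" using p01[of x] by auto
        then have "measure U {..p x} = p x"
          unfolding U_def using p01[of x] by (subst measure_uniform_measure) auto
        moreover have "integrable U (\<lambda>s. indicator {..p x} s * (f (x + z) - f x))"
          by (intro integrable_mult_left integrable_real_indicator) (auto simp: sU U.emeasure_finite
              less_top[symmetric])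
        moreover have "space U = UNIV" using sets_eq_imp_space_eq[OF sU] by simp
        moreover from this have "measure U UNIV = 1" using U.prob_space by simp
        ultimately have "(\<integral>s. f (J (x, (z, s))) \<partial>U) = f x + p x * (f (x + z) - f x)"
          unfolding eq by (subst Bochner_Integration.integral_add) auto
        then show "(\<integral>s. f (J (x, (z, s))) \<partial>U) = (1 - p x) * f x + p x * f (x + z)" by (simp add: algebra_simps)
      qed
      also have "\<dots> = (1 - p x) * f x + p x * (\<integral>z. f (x + z) \<partial>\<rho>)"
      proof -
        have "integrable \<rho> (\<lambda>z. f (x + z))" by (rule \<rho>.integrable_bounded_real[of _ C]) (use fC in auto)
        then show ?thesis by (simp add: \<rho>.prob_space)
      qed
      finally show "(\<integral>zs. f (J (x, zs)) \<partial>(\<rho> \<Otimes>\<^sub>M U)) = (1 - p x) * f x + p x * (\<integral>z. f (x + z) \<partial>\<rho>)" .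
    qed
    finally show "(\<integral>x. f x \<partial>distr (\<mu> \<Otimes>\<^sub>M (\<rho> \<Otimes>\<^sub>M U)) borel J) = (\<integral>x. (1 - p x) * f x + p x * (\<integral>z. f (x + z) \<partial>\<rho>) \<partial>\<mu>)" .
  qed
qed

lemma set_integral_Ioo_split:
  fixes g :: "real \<Rightarrow> real"
  assumes g: "set_integrable lborel {0<..<s'} g" and s: "0 \<le> s" "s \<le> s'"
  shows "(LINT \<tau>:{0<..<s'}|lborel. g \<tau>) = (LINT \<tau>:{0<..<s}|lborel. g \<tau>) + (LINT \<tau>:{s<..<s'}|lborel. g \<tau>)"
proof -
  have i: "set_integrable lborel {0<..<s} g" "set_integrable lborel {s<..<s'} g"
    by (rule set_integrable_subset[OF g]; use s in auto)+
  have "(LINT \<tau>:{0<..<s'}|lborel. g \<tau>) = (\<integral>\<tau>. indicator {0<..<s} \<tau> *\<^sub>R g \<tau> + indicator {s<..<s'} \<tau> *\<^sub>R g \<tau> \<partial>lborel)"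
    unfolding set_lebesgue_integral_def
  proof (rule integral_cong_AE)
    show "AE \<tau> in lborel. indicator {0<..<s'} \<tau> *\<^sub>R g \<tau> = indicator {0<..<s} \<tau> *\<^sub>R g \<tau>
        + indicator {s<..<s'} \<tau> *\<^sub>R g \<tau>"
      using AE_lborel_singleton[of s] by eventually_elim (use s in \<open>auto simp: indicator_def\<close>)
  qed (use g i in \<open>auto simp: set_integrable_def dest: borel_measurable_integrable\<close>)
  also have "\<dots> = (LINT \<tau>:{0<..<s}|lborel. g \<tau>) + (LINT \<tau>:{s<..<s'}|lborel. g \<tau>)"
    using i unfolding set_lebesgue_integral_def set_integrable_def by (rule Bochner_Integration.integral_add)
  finally show ?thesis .
qed

lemma set_integral_Ioo_bound:
  fixes g :: "real \<Rightarrow> real"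
  assumes g: "set_integrable lborel {s<..<s'} g" and s: "s \<le> s'" and C: "\<And>\<tau>. \<tau> \<in> {s<..<s'} \<Longrightarrow> \<bar>g \<tau>\<bar> \<le> C"
  shows "\<bar>LINT \<tau>:{s<..<s'}|lborel. g \<tau>\<bar> \<le> C * (s' - s)"
proof -
  have "\<bar>LINT \<tau>:{s<..<s'}|lborel. g \<tau>\<bar> \<le> (LINT \<tau>:{s<..<s'}|lborel. norm (g \<tau>))"
    using set_integral_norm_bound[OF g] by simp
  also have "\<dots> \<le> (LINT \<tau>:{s<..<s'}|lborel. C)"
  proof (rule set_integral_mono)
    show "set_integrable lborel {s<..<s'} (\<lambda>\<tau>. C)"
      unfolding set_integrable_def
      by (intro integrable_scaleR_left integrable_real_indicator) (auto simp: emeasure_lborel_Ioo_finite)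
  qed (use set_integrable_norm[OF g] C in auto)
  also have "\<dots> = C * (s' - s)" using s by (simp add: set_lebesgue_integral_def)
  finally show ?thesis .
qed

context fokker_planck
begin

text \<open>
  The normalised measure of the jumps of length at least \<open>r\<close>; if there are none, the law is irrelevant as it is
  multiplied by \<open>mass r = 0\<close>.
\<close>

lemma exists_jump_law:
  assumes r: "r > 0"
  shows "\<exists>\<rho> :: 'a measure. prob_space \<rho> \<and> sets \<rho> = sets borel \<and>
    (\<forall>(f :: 'a \<Rightarrow> real) C. f \<in> borel_measurable borel \<longrightarrow> (\<forall>x. \<bar>f x\<bar> \<le> C) \<longrightarrow>
       mass r * (\<integral>z. f z \<partial>\<rho>) = (\<integral>z. indicator (- ball 0 r) z * f z \<partial>\<nu>))"
proof (cases "mass r = 0")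
  case True
  show ?thesis
  proof (intro exI[of _ "return borel (0::'a)"] conjI allI impI)
    show "prob_space (return borel (0::'a))" by (rule prob_space_return) simp
    show "sets (return borel (0::'a)) = sets borel" by simp
    fix f :: "'a \<Rightarrow> real" and C assume "\<forall>x. \<bar>f x\<bar> \<le> C"
    then have "\<And>x. \<bar>f x\<bar> \<le> C" by simp
    from outside_integral_bound[OF this r] True
    show "mass r * (\<integral>z. f z \<partial>return borel 0) = (\<integral>z. indicator (- ball 0 r) z * f z \<partial>\<nu>)" by simp
  qed
next
  case False
  then have pos: "mass r > 0" using mass_nonneg[of r] by simp
  have fin: "integrable \<nu> (\<lambda>z. indicator (- ball 0 r) z / mass r)"
    using emeasure_outside_ball[OF r] by (intro integrable_divide integrable_real_indicator) (auto simp: sets_\<nu>)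
  have [measurable]: "ball (0::'a) r \<in> sets borel" by simp
  have dm[measurable]: "(\<lambda>z::'a. indicator (- ball 0 r) z / mass r) \<in> borel_measurable borel" by measurable
  define \<rho> where "\<rho> = density \<nu> (\<lambda>z. ennreal (indicator (- ball 0 r) z / mass r))"
  show ?thesis
  proof (intro exI[of _ \<rho>] conjI allI impI)
    show "prob_space \<rho>"
    proof
      have "emeasure \<rho> (space \<rho>) = (\<integral>\<^sup>+z. ennreal (indicator (- ball 0 r) z / mass r) \<partial>\<nu>)"
        unfolding \<rho>_def by (subst emeasure_density) (auto intro!: nn_integral_cong simp: space_\<nu>)
      also have "\<dots> = ennreal (\<integral>z. indicator (- ball 0 r) z / mass r \<partial>\<nu>)"
        using pos by (intro nn_integral_eq_integral fin) (auto simp: indicator_def)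
      also have "(\<integral>z. indicator (- ball 0 r) z / mass r \<partial>\<nu>) = 1"
        using pos by (simp add: mass_def space_\<nu>)
      finally show "emeasure \<rho> (space \<rho>) = 1" by simp
    qed
    show "sets \<rho> = sets borel" by (simp add: \<rho>_def sets_\<nu>)
    fix f :: "'a \<Rightarrow> real" and C
    assume f[measurable]: "f \<in> borel_measurable borel"
    have "(\<integral>z. f z \<partial>\<rho>) = (\<integral>z. (indicator (- ball 0 r) z / mass r) * f z \<partial>\<nu>)"
      unfolding \<rho>_def using pos by (subst integral_real_density) (auto simp: indicator_def)
    also have "\<dots> = (\<integral>z. (1 / mass r) * (indicator (- ball 0 r) z * f z) \<partial>\<nu>)" by simp
    also have "\<dots> = (1 / mass r) * (\<integral>z. indicator (- ball 0 r) z * f z \<partial>\<nu>)" by (rule integral_mult_right_zero)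
    finally show "mass r * (\<integral>z. f z \<partial>\<rho>) = (\<integral>z. indicator (- ball 0 r) z * f z \<partial>\<nu>)" using pos by simp
  qed
qed

text \<open>
  One time step: the acceptance probability at \<open>x\<close> is the time integral of \<open>b\<close> at \<open>x\<close> over the step times the total
  jump rate. With this choice the step solves the frozen equation exactly, whatever the dependence of \<open>b\<close> on time.
\<close>

lemma euler_step:
  assumes \<mu>: "prob_space \<mu>" "sets \<mu> = sets borel" and r: "r > 0"
    and s: "0 \<le> s" "s \<le> s'" "s' \<le> T" and small_step: "B * (s' - s) * mass r \<le> 1"
  shows "\<exists>\<mu>'. prob_space \<mu>' \<and> sets \<mu>' = sets borel \<and> (\<forall>u a c. u \<in> holder_ball \<beta> a c \<longrightarrow>
       (\<integral>x. u x \<partial>\<mu>') = (\<integral>x. u x \<partial>\<mu>) + (LINT \<tau>:{s<..<s'}|lborel. (\<integral>x. b \<tau> x * trunc_op r u x \<partial>\<mu>)))"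
proof -
  interpret \<mu>: prob_space \<mu> by fact
  interpret P: pair_sigma_finite \<mu> "lborel :: real measure" ..
  note [measurable_cong] = \<mu>(2)
  define k where "k x \<tau> = indicator {s<..<s'} \<tau> * b \<tau> x" for x \<tau>
  have kmeas[measurable]: "(\<lambda>(x, \<tau>). k x \<tau>) \<in> borel_measurable (borel \<Otimes>\<^sub>M borel)"
  proof -
    have "continuous_on (UNIV \<times> {s<..<s'}) (\<lambda>(x, \<tau>). b \<tau> x)"
    proof -
      have "continuous_on (UNIV \<times> {s<..<s'}) (\<lambda>q. (case (snd q, fst q) of (t, x) \<Rightarrow> b t x))"
        by (rule continuous_on_compose2[OF b_cont]) (use s in \<open>auto intro!: continuous_intros\<close>)
      then show ?thesis by (simp add: split_beta)
    qed
    then have "(\<lambda>q. indicator (UNIV \<times> {s<..<s'}) q *\<^sub>R (case q of (x, \<tau>) \<Rightarrow> b \<tau> x)) \<in> borel_measurable borel"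
      by (intro borel_measurable_continuous_on_indicator) (auto intro!: borel_open open_Times)
    moreover have "(\<lambda>q. indicator (UNIV \<times> {s<..<s'}) q *\<^sub>R (case q of (x, \<tau>) \<Rightarrow> b \<tau> x)) = (\<lambda>(x, \<tau>). k x \<tau>)"
      by (auto simp: k_def fun_eq_iff indicator_def)
    ultimately show ?thesis by (simp add: borel_prod)
  qed
  have k: "0 \<le> k x \<tau>" "k x \<tau> \<le> indicator {s<..<s'} \<tau> * B" for x \<tau>
    using b_range[of \<tau> x] by (auto simp: k_def indicator_def)
  define A where "A x = (\<integral>\<tau>. k x \<tau> \<partial>lborel)" for x
  have A[measurable]: "A \<in> borel_measurable borel" unfolding A_def by measurable
  have A0: "0 \<le> A x" for x unfolding A_def by (intro Bochner_Integration.integral_nonneg k)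
  have AB: "A x \<le> B * (s' - s)" for x
  proof -
    have "A x \<le> (\<integral>\<tau>. indicator {s<..<s'} \<tau> * B \<partial>lborel)"
      unfolding A_def
      by (rule integral_mono') (use k B in \<open>auto intro!: integrable_mult_left integrable_real_indicator simp:
          emeasure_lborel_Ioo_finite\<close>)
    then show ?thesis using s by (simp add: mult.commute)
  qed
  obtain \<rho> :: "'a measure" where \<rho>: "prob_space \<rho>" "sets \<rho> = sets borel"
    "\<forall>(f :: 'a \<Rightarrow> real) C. f \<in> borel_measurable borel \<longrightarrow> (\<forall>x. \<bar>f x\<bar> \<le> C) \<longrightarrow>
       mass r * (\<integral>z. f z \<partial>\<rho>) = (\<integral>z. indicator (- ball 0 r) z * f z \<partial>\<nu>)"
    using exists_jump_law[OF r] by (elim exE conjE) (rule that)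
  have p1: "A x * mass r \<le> 1" for x
    using mult_right_mono[OF AB[of x] mass_nonneg[of r]] small_step by simp
  have Am: "(\<lambda>x. A x * mass r) \<in> borel_measurable borel" by measurable
  have p0: "0 \<le> A x * mass r" for x using A0 mass_nonneg by simp
  obtain \<mu>' where \<mu>': "prob_space \<mu>'" "sets \<mu>' = sets borel"
    "\<forall>(f :: 'a \<Rightarrow> real) C. f \<in> borel_measurable borel \<longrightarrow> (\<forall>x. \<bar>f x\<bar> \<le> C) \<longrightarrow>
       (\<integral>x. f x \<partial>\<mu>') = (\<integral>x. (1 - A x * mass r) * f x + A x * mass r * (\<integral>z. f (x + z) \<partial>\<rho>) \<partial>\<mu>)"
    using exists_thinned_jump[OF \<mu> \<rho>(1,2) Am p0 p1] by (elim exE conjE) (rule that)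
  show ?thesis
  proof (intro exI[of _ \<mu>'] conjI \<mu>'(1,2) allI impI)
    fix u :: "'a \<Rightarrow> real" and a c assume u: "u \<in> holder_ball \<beta> a c"
    note ub = holder_ballD(1)[OF u]
    have um[measurable]: "u \<in> borel_measurable borel" by (rule holder_measurable[OF u])
    let ?C = "(2 * a + c) * M"
    have tm[measurable]: "trunc_op r u \<in> borel_measurable borel"
      by (rule borel_measurable_continuous_onI[OF trunc_op_continuous[OF u]])
    have tb: "\<bar>trunc_op r u x\<bar> \<le> ?C" for x by (rule trunc_op_bound[OF u])
    have C0: "?C \<ge> 0" using tb[of 0] by linarith
    have "(\<integral>x. u x \<partial>\<mu>') = (\<integral>x. (1 - A x * mass r) * u x + A x * mass r * (\<integral>z. u (x + z) \<partial>\<rho>) \<partial>\<mu>)"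
      using \<mu>'(3)[rule_format, OF um ub] .
    also have "\<dots> = (\<integral>x. u x + A x * trunc_op r u x \<partial>\<mu>)"
    proof (rule Bochner_Integration.integral_cong[OF refl])
      fix x
      have "mass r * (\<integral>z. u (x + z) \<partial>\<rho>) = (\<integral>z. indicator (- ball 0 r) z * u (x + z) \<partial>\<nu>)"
        by (rule \<rho>(3)[rule_format, of _ a]) (use ub in auto)
      then have "trunc_op r u x = mass r * (\<integral>z. u (x + z) \<partial>\<rho>) - mass r * u x"
        using trunc_op_eq(1)[OF um ub r] by simp
      moreover have "(1 - A x * mass r) * u x + A x * mass r * (\<integral>z. u (x + z) \<partial>\<rho>)
          = u x + A x * (mass r * (\<integral>z. u (x + z) \<partial>\<rho>) - mass r * u x)"
        by (simp add: algebra_simps)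
      ultimately show "(1 - A x * mass r) * u x + A x * mass r * (\<integral>z. u (x + z) \<partial>\<rho>) = u x + A x * trunc_op r u x"
        by simp
    qed
    also have "\<dots> = (\<integral>x. u x \<partial>\<mu>) + (\<integral>x. A x * trunc_op r u x \<partial>\<mu>)"
    proof (rule Bochner_Integration.integral_add)
      show "integrable \<mu> u" by (rule \<mu>.integrable_bounded_real[OF _ ub]) measurable
      show "integrable \<mu> (\<lambda>x. A x * trunc_op r u x)"
      proof (rule \<mu>.integrable_bounded_real)
        show "\<bar>A x * trunc_op r u x\<bar> \<le> (B * (s' - s)) * ?C" for x
          unfolding abs_mult using AB[of x] A0[of x] tb[of x] C0 by (intro mult_mono) auto
      qed measurable
    qed
    also have "(\<integral>x. A x * trunc_op r u x \<partial>\<mu>) = (\<integral>x. (\<integral>\<tau>. k x \<tau> * trunc_op r u x \<partial>lborel) \<partial>\<mu>)"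
      by (simp add: A_def)
    also have "\<dots> = (\<integral>\<tau>. (\<integral>x. k x \<tau> * trunc_op r u x \<partial>\<mu>) \<partial>lborel)"
    proof (rule P.Fubini_integral[symmetric])
      show "integrable (\<mu> \<Otimes>\<^sub>M lborel) (\<lambda>(x, \<tau>). k x \<tau> * trunc_op r u x)"
      proof (rule Bochner_Integration.integrable_bound)
        have "emeasure (\<mu> \<Otimes>\<^sub>M lborel) (space \<mu> \<times> {s<..<s'}) < \<infinity>"
          by (subst lborel.emeasure_pair_measure_Times) (auto simp: \<mu>.emeasure_space_1 emeasure_lborel_Ioo_finite)
        then show "integrable (\<mu> \<Otimes>\<^sub>M lborel) (\<lambda>q. indicator (space \<mu> \<times> {s<..<s'}) q * (B * ?C))"
          by (intro integrable_mult_left integrable_real_indicator) auto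
        show "AE q in \<mu> \<Otimes>\<^sub>M lborel. norm (case q of (x, \<tau>) \<Rightarrow> k x \<tau> * trunc_op r u x)
            \<le> norm (indicator (space \<mu> \<times> {s<..<s'}) q * (B * ?C))"
        proof (rule AE_I2)
          fix q :: "'a \<times> real"
          obtain x \<tau> where q: "q = (x, \<tau>)" by (cases q)
          have "\<bar>k x \<tau>\<bar> * \<bar>trunc_op r u x\<bar> \<le> (indicator {s<..<s'} \<tau> * B) * ?C"
            using k[of x \<tau>] tb[of x] B by (intro mult_mono) auto
          then have "\<bar>k x \<tau> * trunc_op r u x\<bar> \<le> \<bar>indicator {s<..<s'} \<tau> * (B * ?C)\<bar>"
            unfolding abs_mult[of "k x \<tau>"] by (intro order_trans[OF _ abs_ge_self]) (simp only: mult.assoc)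
          moreover have "indicator (space \<mu> \<times> {s<..<s'}) (x, \<tau>) = (indicator {s<..<s'} \<tau> :: real)"
            using sets_eq_imp_space_eq[OF \<mu>(2)] by (simp add: indicator_def)
          ultimately show "norm (case q of (x, \<tau>) \<Rightarrow> k x \<tau> * trunc_op r u x)
              \<le> norm (indicator (space \<mu> \<times> {s<..<s'}) q * (B * ?C))"
            unfolding q by (simp only: real_norm_def prod.case)
        qed
      qed measurable
    qed
    also have "\<dots> = (LINT \<tau>:{s<..<s'}|lborel. (\<integral>x. b \<tau> x * trunc_op r u x \<partial>\<mu>))"
      unfolding set_lebesgue_integral_def by (intro Bochner_Integration.integral_cong refl) (simp add: k_def
          mult.assoc)
    finally show "(\<integral>x. u x \<partial>\<mu>') = (\<integral>x. u x \<partial>\<mu>) + (LINT \<tau>:{s<..<s'}|lborel. (\<integral>x. b \<tau> x * trunc_op r u x \<partial>\<mu>))" .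
  qed
qed

text \<open>
  The weak formulation for test functions that do not depend on time, with a defect relative to the Hoelder size of
  the test function.
\<close>

definition holder_solution_upto :: "real \<Rightarrow> 'a measure \<Rightarrow> (real \<Rightarrow> 'a measure) \<Rightarrow> bool" where
  "holder_solution_upto \<delta> m0 m \<longleftrightarrow> measurable_curve T m \<and>
     (\<forall>(u :: 'a \<Rightarrow> real) a c t. u \<in> holder_ball \<beta> a c \<longrightarrow> t \<in> {0..T} \<longrightarrow>
       \<bar>(\<integral>x. u x \<partial>m t) - (\<integral>x. u x \<partial>m0) - (LINT \<tau>:{0<..<t}|lborel. flux u m \<tau>)\<bar>
         \<le> \<delta> * (2 * a + c))"

lemma holder_solution_uptoD:
  assumes "holder_solution_upto \<delta> m0 m"
  shows "measurable_curve T m"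
    and "u \<in> holder_ball \<beta> a c \<Longrightarrow> t \<in> {0..T} \<Longrightarrow>
       \<bar>(\<integral>x. u x \<partial>m t) - (\<integral>x. u x \<partial>m0) - (LINT \<tau>:{0<..<t}|lborel. flux u m \<tau>)\<bar>
         \<le> \<delta> * (2 * a + c)"
  using assms unfolding holder_solution_upto_def by blast+

text \<open>
  The defect has two sources: the jumps shorter than \<open>r\<close>, which contribute \<open>B * T * small r\<close>, and the part of the
  last time step that is not completed, which contributes \<open>B * h * M\<close>. Each is made at most \<open>\<delta> / 2\<close>.
\<close>

lemma approximate_solution:
  assumes m0: "prob_space m0" "sets m0 = sets borel" and \<delta>: "\<delta> > 0"
  shows "\<exists>m. holder_solution_upto \<delta> m0 m"
proof -
  have "(\<lambda>n. B * T * small (1 / real (Suc n))) \<longlonglongrightarrow> B * T * 0" by (intro tendsto_intros small_tendsto_0)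
  then have "\<forall>\<^sub>F n in sequentially. B * T * small (1 / real (Suc n)) < \<delta> / 2"
    by (rule order_tendstoD) (use \<delta> in simp)
  then obtain n where n: "B * T * small (1 / real (Suc n)) < \<delta> / 2" by (auto simp: eventually_sequentially)
  define r where "r = 1 / real (Suc n)"
  have r: "r > 0" by (simp add: r_def)
  obtain N :: nat where N': "B * T * mass r + 2 * B * T * M / \<delta> + 1 < real N" using reals_Archimedean2 by blast
  have nn: "0 \<le> B * T * mass r" "0 \<le> 2 * B * T * M / \<delta>" using B T mass_nonneg M \<delta> by auto
  have N: "N > 0" using N' nn by (cases N) auto
  define h where "h = T / real N"
  have h: "h > 0" using T N by (simp add: h_def)
  have hm: "B * h * mass r \<le> 1" using N' nn N by (simp add: h_def field_simps)
  have hM: "B * h * M \<le> \<delta> / 2"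
  proof -
    have "2 * B * T * M / \<delta> \<le> real N" using N' nn by linarith
    then have "2 * B * T * M \<le> real N * \<delta>" using \<delta> by (simp add: field_simps)
    then show ?thesis using N by (simp add: h_def field_simps)
  qed
  \<comment> \<open>the Euler chain on the grid of width h, frozen after N steps\<close>
  have "\<exists>m. \<forall>i. (prob_space (m i) \<and> sets (m i) = sets borel \<and> (i = 0 \<longrightarrow> m i = m0)) \<and>
      (i < N \<longrightarrow> (\<forall>u a c. u \<in> holder_ball \<beta> a c \<longrightarrow>
        (\<integral>x. u x \<partial>m (Suc i)) = (\<integral>x. u x \<partial>m i) + (LINT \<tau>:{real i * h<..<real (Suc i) * h}|lborel. (\<integral>x. b \<tau> x * trunc_op
            r u x \<partial>m i))))"
  proof (rule dependent_nat_choice)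
    show "\<exists>\<mu>. prob_space \<mu> \<and> sets \<mu> = sets borel \<and> ((0::nat) = 0 \<longrightarrow> \<mu> = m0)" using m0 by blast
    fix \<mu> :: "'a measure" and i :: nat
    assume \<mu>: "prob_space \<mu> \<and> sets \<mu> = sets borel \<and> (i = 0 \<longrightarrow> \<mu> = m0)"
    show "\<exists>\<mu>'. (prob_space \<mu>' \<and> sets \<mu>' = sets borel \<and> (Suc i = 0 \<longrightarrow> \<mu>' = m0)) \<and>
      (i < N \<longrightarrow> (\<forall>u a c. u \<in> holder_ball \<beta> a c \<longrightarrow>
        (\<integral>x. u x \<partial>\<mu>') = (\<integral>x. u x \<partial>\<mu>) + (LINT \<tau>:{real i * h<..<real (Suc i) * h}|lborel. (\<integral>x. b \<tau> x * trunc_op r u x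
            \<partial>\<mu>))))"
    proof (cases "i < N")
      case True
      have "real (Suc i) * h \<le> real N * h" using True h by (intro mult_right_mono) auto
      also have "\<dots> = T" using N by (simp add: h_def)
      finally have le: "real (Suc i) * h \<le> T" .
      have d: "real (Suc i) * h - real i * h = h" by (simp add: algebra_simps)
      have "\<exists>\<mu>'. prob_space \<mu>' \<and> sets \<mu>' = sets borel \<and> (\<forall>u a c. u \<in> holder_ball \<beta> a c \<longrightarrow>
        (\<integral>x. u x \<partial>\<mu>') = (\<integral>x. u x \<partial>\<mu>) + (LINT \<tau>:{real i * h<..<real (Suc i) * h}|lborel. (\<integral>x. b \<tau> x * trunc_op r u x
            \<partial>\<mu>)))"
      proof (rule euler_step)
        show "prob_space \<mu>" "sets \<mu> = sets borel" using \<mu> by auto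
        show "0 \<le> real i * h" "real i * h \<le> real (Suc i) * h" using h by (auto intro: mult_right_mono)
        show "B * (real (Suc i) * h - real i * h) * mass r \<le> 1" unfolding d by (rule hm)
      qed (fact r le)+
      then show ?thesis
        by (elim exE, intro exI) (elim conjE, intro conjI impI; (assumption | simp))
    qed (use \<mu> in blast)
  qed
  then obtain c where c0: "\<forall>i. (prob_space (c i) \<and> sets (c i) = sets borel \<and> (i = 0 \<longrightarrow> c i = m0)) \<and>
      (i < N \<longrightarrow> (\<forall>u a c'. u \<in> holder_ball \<beta> a c' \<longrightarrow>
        (\<integral>x. u x \<partial>c (Suc i)) = (\<integral>x. u x \<partial>c i) + (LINT \<tau>:{real i * h<..<real (Suc i) * h}|lborel. (\<integral>x. b \<tau> x * trunc_op
            r u x \<partial>c i))))"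
    by (elim exE)
  have c: "\<And>i. prob_space (c i)" "\<And>i. sets (c i) = sets borel" "c 0 = m0" using c0 by auto
  have step: "(\<integral>x. u x \<partial>c (Suc i)) = (\<integral>x. u x \<partial>c i)
      + (LINT \<tau>:{real i * h<..<real (Suc i) * h}|lborel. (\<integral>x. b \<tau> x * trunc_op r u x \<partial>c i))"
    if "i < N" "u \<in> holder_ball \<beta> a c'" for i u a c'
    using conjunct2[OF spec[OF c0, of i]] that by blast
  define m where "m t = c (nat \<lfloor>t / h\<rfloor>)" for t
  have mcell: "m \<tau> = c i" if "\<tau> \<in> {real i * h<..<real (Suc i) * h}" for \<tau> i
  proof -
    have "\<lfloor>\<tau> / h\<rfloor> = int i" using that h by (intro floor_unique) (auto simp: field_simps)
    then show ?thesis by (simp add: m_def)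
  qed
  have meas: "(\<lambda>t. indicator {0<..<T} t * (\<integral>x. g t x \<partial>m t)) \<in> borel_measurable borel"
    if g: "continuous_on ({0<..<T} \<times> UNIV) (\<lambda>(t, x). g t x)" "\<And>t x. \<bar>g t x\<bar> \<le> C" for g :: "real \<Rightarrow> 'a \<Rightarrow> real" and C
  proof -
    have "(\<lambda>t. indicator {0<..<T} t *\<^sub>R (\<integral>x. g t x \<partial>c i)) \<in> borel_measurable borel" for i
    proof (intro borel_measurable_continuous_on_indicator)
      show "continuous_on {0<..<T} (\<lambda>t. \<integral>x. g t x \<partial>c i)"
        by (rule continuous_on_integral_narrow_curve[of _ "\<lambda>_. c i", OF _ _ g(1)]) (use c g in auto)
    qed auto
    then have "(\<lambda>t. (\<lambda>i t. indicator {0<..<T} t *\<^sub>R (\<integral>x. g t x \<partial>c i)) (nat \<lfloor>t / h\<rfloor>) t) \<in> borel_measurable borel"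
      by (rule measurable_compose_countable) measurable
    then show ?thesis by (simp add: m_def)
  qed
  have mc: "measurable_curve T m"
    unfolding measurable_curve_def
  proof (intro conjI ballI allI impI)
    show "prob_space (m t)" "sets (m t) = sets borel" for t by (auto simp: m_def c)
    fix g :: "real \<Rightarrow> 'a \<Rightarrow> real" and C
    assume g: "continuous_on ({0<..<T} \<times> UNIV) (\<lambda>(t, x). g t x)" and "\<forall>t x. \<bar>g t x\<bar> \<le> C"
    then have "\<bar>g t x\<bar> \<le> C" for t x by simp
    from meas[OF g this]
    show "(\<lambda>t. indicator {0<..<T} t * (\<integral>x. g t x \<partial>m t)) \<in> borel_measurable borel" .
  qed
  show ?thesis
    unfolding holder_solution_upto_def
  proof (intro exI[of _ m] conjI mc allI impI)
    fix u :: "'a \<Rightarrow> real" and a c' t assume u: "u \<in> holder_ball \<beta> a c'" and t: "t \<in> {0..T}"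
    define q where "q = 2 * a + c'"
    have q: "q \<ge> 0" using holder_const_nonneg[OF u] by (simp add: q_def)
    have tc: "continuous_on ({0<..<T} \<times> UNIV) (\<lambda>(\<tau>, x). b \<tau> x * trunc_op r u x)"
      by (rule continuous_b_times[OF trunc_op_continuous[OF u]])
    have tb: "\<bar>b \<tau> x * trunc_op r u x\<bar> \<le> B * (q * M)" for \<tau> x
      unfolding abs_mult q_def using trunc_op_bound[OF u, of r x] b_range[of \<tau> x] B by (intro mult_mono) auto
    define G where "G \<tau> = (\<integral>x. b \<tau> x * trunc_op r u x \<partial>m \<tau>)" for \<tau>
    have Gm: "(\<lambda>\<tau>. indicator {0<..<T} \<tau> * G \<tau>) \<in> borel_measurable borel"
      unfolding G_def by (rule meas[OF tc tb])
    have Gb: "\<bar>G \<tau>\<bar> \<le> B * (q * M)" if "\<tau> \<in> {0<..<T}" for \<tau>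
      unfolding G_def by (rule abs_integral_le(1)[OF _ _ continuous_section[OF tc that] tb]) (auto simp: m_def c)
    have Gi: "set_integrable lborel {s<..<s'} G" if "0 \<le> s" "s' \<le> T" for s s'
    proof -
      have "set_integrable lborel {0<..<T} G"
        unfolding set_integrable_def
      proof (rule Bochner_Integration.integrable_bound)
        show "integrable lborel (\<lambda>\<tau>. indicator {0<..<T} \<tau> * (B * (q * M)))"
          by (intro integrable_mult_left integrable_real_indicator) (auto simp: emeasure_lborel_Ioo_finite)
        show "AE \<tau> in lborel. norm (indicator {0<..<T} \<tau> *\<^sub>R G \<tau>) \<le> norm (indicator {0<..<T} \<tau> * (B * (q * M)))"
          using Gb by (intro AE_I2) (auto simp: indicator_def intro: order_trans[OF _ abs_ge_self])
      qed (use Gm in simp)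
      then show ?thesis by (rule set_integrable_subset) (use that in auto)
    qed
    have grid: "(\<integral>x. u x \<partial>c i) = (\<integral>x. u x \<partial>m0) + (LINT \<tau>:{0<..<real i * h}|lborel. G \<tau>)" if "i \<le> N" for i
      using that
    proof (induction i)
      case 0
      then show ?case by (simp add: c set_lebesgue_integral_def)
    next
      case (Suc i)
      have "real (Suc i) * h \<le> real N * h" using Suc.prems h by (intro mult_right_mono) auto
      also have "\<dots> = T" using N by (simp add: h_def)
      finally have le: "real (Suc i) * h \<le> T" .
      have "(LINT \<tau>:{real i * h<..<real (Suc i) * h}|lborel. (\<integral>x. b \<tau> x * trunc_op r u x \<partial>c i))
          = (LINT \<tau>:{real i * h<..<real (Suc i) * h}|lborel. G \<tau>)"
        by (rule set_lebesgue_integral_cong) (use mcell in \<open>auto simp: G_def\<close>)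
      moreover have "(LINT \<tau>:{0<..<real (Suc i) * h}|lborel. G \<tau>) = (LINT \<tau>:{0<..<real i * h}|lborel. G \<tau>)
          + (LINT \<tau>:{real i * h<..<real (Suc i) * h}|lborel. G \<tau>)"
        by (rule set_integral_Ioo_split[OF Gi]) (use le h in \<open>auto intro: mult_right_mono\<close>)
      ultimately show ?case using step[OF _ u, of i] Suc by simp
    qed
    define i where "i = nat \<lfloor>t / h\<rfloor>"
    have i: "real i * h \<le> t" "t < real i * h + h"
    proof -
      have "0 \<le> t / h" using t h by simp
      then have "real i = of_int \<lfloor>t / h\<rfloor>" by (simp add: i_def)
      then have "real i \<le> t / h" "t / h < real i + 1" by linarith+
      then show "real i * h \<le> t" "t < real i * h + h" using h by (auto simp: field_simps)
    qed
    have iN: "i \<le> N"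
    proof -
      have "real i * h \<le> real N * h" using i t N by (simp add: h_def)
      then show ?thesis using h by simp
    qed
    have "(\<integral>x. u x \<partial>m t) = (\<integral>x. u x \<partial>m0) + (LINT \<tau>:{0<..<real i * h}|lborel. G \<tau>)"
      using grid[OF iN] by (simp add: m_def i_def)
    moreover have "(LINT \<tau>:{0<..<t}|lborel. G \<tau>) = (LINT \<tau>:{0<..<real i * h}|lborel. G \<tau>)
        + (LINT \<tau>:{real i * h<..<t}|lborel. G \<tau>)"
      by (rule set_integral_Ioo_split[OF Gi]) (use i h t in auto)
    moreover have "\<bar>LINT \<tau>:{real i * h<..<t}|lborel. G \<tau>\<bar> \<le> (B * (q * M)) * h"
    proof -
      have "real i * h \<ge> 0" using h by simp
      then have "\<bar>LINT \<tau>:{real i * h<..<t}|lborel. G \<tau>\<bar> \<le> (B * (q * M)) * (t - real i * h)"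
        by (intro set_integral_Ioo_bound Gi Gb)
           (use i t le_less_trans[OF \<open>real i * h \<ge> 0\<close>] in auto)
      also have "\<dots> \<le> (B * (q * M)) * h" using i B q M by (intro mult_left_mono) auto
      finally show ?thesis .
    qed
    moreover have "\<bar>(LINT \<tau>:{0<..<t}|lborel. flux u m \<tau>) - (LINT \<tau>:{0<..<t}|lborel. G \<tau>)\<bar> \<le> (B * (q * small r)) * T"
    proof -
      note fi = flux_integrable[OF mc u t]
      have Gt: "set_integrable lborel {0<..<t} G" using Gi[of 0 t] t by simp
      have "(LINT \<tau>:{0<..<t}|lborel. flux u m \<tau>) - (LINT \<tau>:{0<..<t}|lborel. G \<tau>)
          = (LINT \<tau>:{0<..<t}|lborel. flux u m \<tau> - G \<tau>)"
        by (rule set_integral_diff(2)[OF fi Gt, symmetric])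
      also have "\<bar>\<dots>\<bar> \<le> (B * (q * small r)) * (t - 0)"
      proof (rule set_integral_Ioo_bound)
        show "set_integrable lborel {0<..<t} (\<lambda>\<tau>. flux u m \<tau> - G \<tau>)"
          by (rule set_integral_diff(1)[OF fi Gt])
        show "0 \<le> t" using t by simp
        fix \<tau> assume "\<tau> \<in> {0<..<t}"
        then have \<tau>: "\<tau> \<in> {0<..<T}" using t by auto
        have pm: "prob_space (m \<tau>)" "sets (m \<tau>) = sets borel" by (auto simp: m_def c)
        note c1 = continuous_section[OF flux_continuous[OF u] \<tau>] and c2 = continuous_section[OF tc \<tau>]
        have "flux u m \<tau> - G \<tau> = (\<integral>x. b \<tau> x * levy_op \<nu> u x - b \<tau> x * trunc_op r u x \<partial>m \<tau>)"
          unfolding G_def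
          by (rule Bochner_Integration.integral_diff[OF abs_integral_le(2)[OF pm c1 flux_bound[OF u]]
              abs_integral_le(2)[OF pm c2 tb], symmetric])
        also have "\<bar>\<dots>\<bar> \<le> B * (q * small r)"
        proof (rule abs_integral_le(1)[OF pm continuous_on_diff[OF c1 c2]])
          fix x
          have "\<bar>b \<tau> x * (levy_op \<nu> u x - trunc_op r u x)\<bar> \<le> B * (q * small r)"
            unfolding abs_mult q_def using b_range[of \<tau> x] levy_op_trunc_op[OF u, of x r] B by (intro mult_mono) auto
          then show "\<bar>b \<tau> x * levy_op \<nu> u x - b \<tau> x * trunc_op r u x\<bar> \<le> B * (q * small r)"
            by (simp add: right_diff_distrib)
        qed
        finally show "\<bar>flux u m \<tau> - G \<tau>\<bar> \<le> B * (q * small r)" .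
      qed
      also have "\<dots> \<le> (B * (q * small r)) * T" using t B q small_nonneg[of r] by (intro mult_left_mono) auto
      finally show ?thesis .
    qed
    ultimately have "\<bar>(\<integral>x. u x \<partial>m t) - (\<integral>x. u x \<partial>m0) - (LINT \<tau>:{0<..<t}|lborel. flux u m \<tau>)\<bar>
        \<le> (B * (q * M)) * h + (B * (q * small r)) * T" by linarith
    also have "\<dots> = (B * h * M) * q + (B * T * small r) * q" by (simp add: algebra_simps)
    also have "\<dots> \<le> \<delta> / 2 * q + \<delta> / 2 * q"
      using hM n q by (intro add_mono mult_right_mono) (auto simp: r_def)
    finally show "\<bar>(\<integral>x. u x \<partial>m t) - (\<integral>x. u x \<partial>m0) - (LINT \<tau>:{0<..<t}|lborel. flux u m \<tau>)\<bar> \<le> \<delta> * (2 * a + c')"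
      by (simp add: q_def)
  qed
qed

end

section \<open>The limit of the approximations\<close>

text \<open>
  A cutoff function that vanishes up to the radius \<open>R\<close>, equals one from \<open>2 * R\<close> on,
      and has the Lipschitz constant \<open>1 / R\<close>.
  The slow variation makes \<open>levy_op\<close> uniformly small on it for large \<open>R\<close>.
\<close>

definition far :: "real \<Rightarrow> 'a::real_normed_vector \<Rightarrow> real" where
  "far R x = max 0 (min 1 (norm x / R - 1))"

lemma far_range: "0 \<le> far R x" "far R x \<le> 1" by (auto simp: far_def)

lemma far_increment:
  assumes "R > 0" shows "\<bar>far R x - far R y\<bar> \<le> min 1 (norm (x - y) / R)"
proof -
  have "\<bar>norm x - norm y\<bar> \<le> norm (x - y)" by (rule norm_triangle_ineq3)
  then have "\<bar>norm x - norm y\<bar> / R \<le> norm (x - y) / R" using assms by (intro divide_right_mono) auto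
  moreover have "\<bar>norm x / R - norm y / R\<bar> = \<bar>norm x - norm y\<bar> / R"
    using assms unfolding diff_divide_distrib[symmetric] abs_divide by simp
  moreover have "0 \<le> norm (x - y) / R" using assms by simp
  ultimately have "\<bar>norm x / R - norm y / R\<bar> \<le> norm (x - y) / R" by linarith
  moreover have "\<bar>max 0 (min 1 (s - 1)) - max 0 (min 1 (t - 1))\<bar> \<le> 1"
    "\<bar>max 0 (min 1 (s - 1)) - max 0 (min 1 (t - 1))\<bar> \<le> \<bar>s - t\<bar>" for s t :: real
    by (auto simp: min_def max_def)
  ultimately show ?thesis unfolding far_def by (intro min.boundedI) (auto intro: order_trans)
qed

lemma far_tendsto_0: "(\<lambda>n. far (real (Suc n)) x) \<longlonglongrightarrow> 0"
proof (rule tendsto_eventually)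
  obtain n :: nat where "norm x \<le> real n" using real_arch_simple by blast
  then have "far (real (Suc k)) x = 0" if "k \<ge> n" for k using that by (simp add: far_def field_simps)
  then show "\<forall>\<^sub>F n in sequentially. far (real (Suc n)) x = 0" unfolding eventually_sequentially by blast
qed

lemma bounded_lipschitz_far: "R > 0 \<Longrightarrow> bounded_lipschitz (far R)"
proof (rule bounded_lipschitzI[of _ 1 "1 / R"])
  assume R: "R > 0"
  fix x y :: 'a
  show "\<bar>far R x\<bar> \<le> 1" using far_range[of R x] by simp
  show "\<bar>far R x - far R y\<bar> \<le> 1 / R * dist x y"
    using order_trans[OF far_increment[OF R, of x y] min.cobounded2] by (simp add: dist_norm)
qed

context fokker_planck
begin

definition far_levy :: "real \<Rightarrow> real" where "far_levy R = (\<integral>z. min 1 (norm z / R) \<partial>\<nu>)"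

lemma far_weight: "R \<ge> 1 \<Longrightarrow> min 1 (norm z / R) \<le> weight z"
proof (cases "norm z \<le> 1")
  case True
  assume R: "R \<ge> 1"
  have "norm z / R \<le> norm z / 1" using R by (intro divide_left_mono) auto
  also have "\<dots> = norm z powr 1" by simp
  also have "\<dots> \<le> norm z powr \<beta>" using True \<beta> by (intro powr_mono') auto
  finally show ?thesis by (simp add: weight_def min.coboundedI2)
next
  case False
  then have "1 \<le> norm z powr \<beta>" using \<beta> by (intro ge_one_powr_ge_zero) auto
  then show ?thesis by (simp add: weight_def)
qed

lemma far_holder: "R \<ge> 1 \<Longrightarrow> (far R :: 'a \<Rightarrow> real) \<in> holder_ball \<beta> 1 1"
proof (rule holder_ballI)
  assume R: "R \<ge> 1"
  fix x y :: 'a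
  show "\<bar>far R x\<bar> \<le> 1" using far_range[of R x] by simp
  have "\<bar>far R x - far R y\<bar> \<le> min 1 (norm (x - y) / R)" using R by (intro far_increment) simp
  also have "\<dots> \<le> weight (x - y)" by (rule far_weight[OF R])
  finally show "\<bar>far R x - far R y\<bar> \<le> 1 * norm (x - y) powr \<beta>" by (simp add: weight_def)
qed simp

lemma far_levy_integrable: "R \<ge> 1 \<Longrightarrow> integrable \<nu> (\<lambda>z. min 1 (norm z / R))"
  by (rule Bochner_Integration.integrable_bound[OF weight_integrable])
     (auto intro!: AE_I2 order_trans[OF far_weight])

lemma levy_op_far: "R \<ge> 1 \<Longrightarrow> \<bar>levy_op \<nu> (far R) x\<bar> \<le> far_levy R"
proof -
  assume R: "R \<ge> 1"
  have "\<bar>levy_op \<nu> (far R) x\<bar> \<le> (\<integral>z. \<bar>far R (x + z) - far R x\<bar> \<partial>\<nu>)"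
    unfolding levy_op_def by (rule integral_abs_bound)
  also have "\<dots> \<le> far_levy R"
    unfolding far_levy_def
  proof (rule integral_mono'[OF far_levy_integrable[OF R]])
    show "\<bar>far R (x + z) - far R x\<bar> \<le> min 1 (norm z / R)" for z
      using far_increment[of R "x + z" x] R by simp
    show "0 \<le> min 1 (norm z / R)" for z :: 'a using R by simp
  qed
  finally show ?thesis .
qed

lemma far_levy_tendsto_0: "(\<lambda>n. far_levy (real (Suc n))) \<longlonglongrightarrow> 0"
proof -
  have "(\<lambda>n. far_levy (real (Suc n))) \<longlonglongrightarrow> (\<integral>z. 0 \<partial>\<nu>)"
    unfolding far_levy_def
  proof (rule integral_dominated_convergence[where w = weight])
    show "AE z in \<nu>. (\<lambda>n. min 1 (norm z / real (Suc n))) \<longlonglongrightarrow> 0"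
    proof (rule AE_I2)
      fix z :: 'a
      have "(\<lambda>n. norm z * inverse (real (Suc n))) \<longlonglongrightarrow> norm z * 0"
        by (intro tendsto_intros LIMSEQ_inverse_real_of_nat)
      then have "(\<lambda>n. min 1 (norm z / real (Suc n))) \<longlonglongrightarrow> min 1 0"
        by (intro tendsto_min tendsto_const) (simp add: field_simps)
      then show "(\<lambda>n. min 1 (norm z / real (Suc n))) \<longlonglongrightarrow> 0" by simp
    qed
    show "AE z in \<nu>. norm (min 1 (norm z / real (Suc n))) \<le> weight z" for n
      using far_weight[of "real (Suc n)"] by (intro AE_I2) simp
  qed (auto intro: weight_integrable)
  then show ?thesis by simp
qed

text \<open>
  Stability for two approximations: the radius \<open>r\<close> is chosen first, then the indices so large that the defects times
  the jump rate for this \<open>r\<close> are small.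
\<close>

lemma approximations_Cauchy:
  assumes \<mu>': "\<And>n. holder_solution_upto (1 / real (Suc n)) m0 (\<mu> n)"
    and u: "u \<in> holder_ball \<beta> a c" and t: "t \<in> {0..T}"
  shows "Cauchy (\<lambda>n. \<integral>x. u x \<partial>\<mu> n t)"
proof (rule CauchyI)
  note \<mu> = holder_solution_uptoD(1)[OF \<mu>'] and eq = holder_solution_uptoD(2)[OF \<mu>']
  fix e :: real assume e: "e > 0"
  define q where "q = exp ((H * M + 1) * T) * (2 * a + c)"
  have q: "q \<ge> 0" using holder_const_nonneg[OF u] by (simp add: q_def)
  have "(\<lambda>n. q * (2 * B * small (1 / real (Suc n)))) \<longlonglongrightarrow> q * (2 * B * 0)" by (intro tendsto_intros small_tendsto_0)
  then have "\<forall>\<^sub>F n in sequentially. q * (2 * B * small (1 / real (Suc n))) < e / 2"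
    by (rule order_tendstoD) (use e in simp)
  then obtain j where j: "q * (2 * B * small (1 / real (Suc j))) < e / 2" by (auto simp: eventually_sequentially)
  define r where "r = 1 / real (Suc j)"
  have r: "r > 0" by (simp add: r_def)
  define K where "K = 2 * (B * mass r + 1) + H * M + 1"
  have K: "K \<ge> 0" using B mass_nonneg[of r] H M by (simp add: K_def)
  have "(\<lambda>n. q * (2 * inverse (real (Suc n)) * K)) \<longlonglongrightarrow> q * (2 * 0 * K)"
      by (intro tendsto_intros LIMSEQ_inverse_real_of_nat)
  then have "\<forall>\<^sub>F n in sequentially. q * (2 * inverse (real (Suc n)) * K) < e / 2"
    by (rule order_tendstoD) (use e in simp)
  then obtain N where N: "q * (2 * inverse (real (Suc N)) * K) < e / 2" by (auto simp: eventually_sequentially)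
  have "norm ((\<integral>x. u x \<partial>\<mu> n t) - (\<integral>x. u x \<partial>\<mu> k t)) < e" if nk: "n \<ge> N" "k \<ge> N" for n k
  proof -
    have "\<bar>(\<integral>x. u x \<partial>\<mu> n t) - (\<integral>x. u x \<partial>\<mu> k t)\<bar> \<le> exp ((H * M + 1) * T) *
        ((2 * B * small r + (2 * inverse (real (Suc N))) * (2 * (B * mass r + 1) + H * M + 1)) * (2 * a + c))"
    proof (rule stability[OF \<mu> \<mu> _ r _ u t])
      show "0 \<le> 2 * inverse (real (Suc N))" by simp
      fix w :: "'a \<Rightarrow> real" and a c s assume w: "w \<in> holder_ball \<beta> a c" and s: "s \<in> {0..T}"
      have inv: "1 / real (Suc n) \<le> inverse (real (Suc N))" "1 / real (Suc k) \<le> inverse (real (Suc N))"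
        using nk by (auto simp: inverse_eq_divide intro!: divide_left_mono)
      have "(LINT \<tau>:{0<..<s}|lborel. flux w (\<mu> n) \<tau> - flux w (\<mu> k) \<tau>)
        = (LINT \<tau>:{0<..<s}|lborel. flux w (\<mu> n) \<tau>) - (LINT \<tau>:{0<..<s}|lborel. flux w (\<mu> k) \<tau>)"
        by (rule set_integral_diff(2)[OF flux_integrable[OF \<mu> w s] flux_integrable[OF \<mu> w s]])
      moreover have "1 / real (Suc n) * (2 * a + c) \<le> inverse (real (Suc N)) * (2 * a + c)"
        "1 / real (Suc k) * (2 * a + c) \<le> inverse (real (Suc N)) * (2 * a + c)"
        by (rule mult_right_mono[OF inv(1) holder_const_nonneg[OF w]], rule mult_right_mono[OF inv(2)
            holder_const_nonneg[OF w]])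
      ultimately show "\<bar>(\<integral>x. w x \<partial>\<mu> n s) - (\<integral>x. w x \<partial>\<mu> k s) - (LINT \<tau>:{0<..<s}|lborel. flux w (\<mu> n) \<tau>
          - flux w (\<mu> k) \<tau>)\<bar>
          \<le> 2 * inverse (real (Suc N)) * (2 * a + c)"
        using eq[OF w s, of n] eq[OF w s, of k] by linarith
    qed
    also have "\<dots> = q * (2 * B * small r) + q * (2 * inverse (real (Suc N)) * K)"
      by (simp add: q_def K_def algebra_simps)
    also have "\<dots> < e" using j N by (simp add: r_def)
    finally show ?thesis by simp
  qed
  then show "\<exists>N. \<forall>n\<ge>N. \<forall>k\<ge>N. norm ((\<integral>x. u x \<partial>\<mu> n t) - (\<integral>x. u x \<partial>\<mu> k t)) < e" by blast
qed

text \<open>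
  The limits of the integrals form a tight functional. For the tightness the approximate equation is tested with
  \<open>far R\<close>: its integral at time \<open>t\<close> exceeds the one against \<open>m0\<close> by at most \<open>B * T * far_levy R\<close> and the defect.
\<close>

lemma approximations_converge:
  assumes m0: "prob_space m0" "sets m0 = sets borel"
    and \<mu>': "\<And>n. holder_solution_upto (1 / real (Suc n)) m0 (\<mu> n)"
    and t: "t \<in> {0..T}"
  shows "\<exists>\<mu>'. prob_space \<mu>' \<and> sets \<mu>' = sets borel \<and>
     (\<forall>u. bounded_lipschitz u \<longrightarrow> (\<lambda>n. \<integral>x. u x \<partial>\<mu> n t) \<longlonglongrightarrow> (\<integral>x. u x \<partial>\<mu>'))"
proof -
  note \<mu> = holder_solution_uptoD(1)[OF \<mu>'] and eq = holder_solution_uptoD(2)[OF \<mu>']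
  have p: "prob_space (\<mu> n t)" "sets (\<mu> n t) = sets borel" for n using \<mu>[of n] t by (auto simp: measurable_curve_def)
  define \<Lambda> where "\<Lambda> u = lim (\<lambda>n. \<integral>x. u x \<partial>\<mu> n t)" for u :: "'a \<Rightarrow> real"
  have lim: "(\<lambda>n. \<integral>x. u x \<partial>\<mu> n t) \<longlonglongrightarrow> \<Lambda> u" if bl: "bounded_lipschitz u" for u
  proof -
    obtain a c where u: "u \<in> holder_ball \<beta> a c" by (rule bounded_lipschitz_imp_holder[OF bl \<beta>])
    show ?thesis unfolding \<Lambda>_def
      using Cauchy_convergent[OF approximations_Cauchy[OF \<mu>' u t]] by (rule convergent_LIMSEQ_iff[THEN iffD1])
  qed
  have int: "integrable (\<mu> n t) u" if bl: "bounded_lipschitz u" for u n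
  proof -
    obtain a c where u: "u \<in> holder_ball \<beta> a c" by (rule bounded_lipschitz_imp_holder[OF bl \<beta>])
    show ?thesis by (rule abs_integral_le(2)[OF p bounded_lipschitz_continuous_on[OF bl] holder_ballD(1)[OF u]])
  qed
  have mono: "\<Lambda> u \<le> \<Lambda> w" if "bounded_lipschitz u" "bounded_lipschitz w" "\<And>x. u x \<le> w x" for u w
    by (rule LIMSEQ_le[OF lim[OF that(1)] lim[OF that(2)]]) (use that in \<open>auto intro!: integral_mono int\<close>)
  have fartight: "\<Lambda> (far (real (Suc j))) \<le> (\<integral>x. far (real (Suc j)) x \<partial>m0) + B * far_levy (real (Suc j)) * T" for j
  proof (rule LIMSEQ_le_const2)
    let ?R = "real (Suc j)"
    have R: "?R \<ge> 1" by simp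
    have "(\<lambda>n. (\<integral>x. far ?R x \<partial>\<mu> n t) - inverse (real (Suc n)) * 3) \<longlonglongrightarrow> \<Lambda> (far ?R) - 0 * 3"
      by (intro tendsto_diff tendsto_mult_right lim bounded_lipschitz_far LIMSEQ_inverse_real_of_nat) simp
    then show "(\<lambda>n. (\<integral>x. far ?R x \<partial>\<mu> n t) - inverse (real (Suc n)) * 3) \<longlonglongrightarrow> \<Lambda> (far ?R)" by simp
    have "(\<integral>x. far ?R x \<partial>\<mu> n t) - inverse (real (Suc n)) * 3 \<le> (\<integral>x. far ?R x \<partial>m0) + B * far_levy ?R * T" for n
    proof -
      have fb: "\<bar>b \<tau> x * levy_op \<nu> (far ?R) x\<bar> \<le> B * far_levy ?R" for \<tau> x
        unfolding abs_mult using b_range[of \<tau> x] levy_op_far[OF R, of x] B by (intro mult_mono) auto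
      have F0: "0 \<le> far_levy ?R" using levy_op_far[OF R, of 0] by linarith
      have "\<bar>LINT \<tau>:{0<..<t}|lborel. flux (far ?R) (\<mu> n) \<tau>\<bar> \<le> B * far_levy ?R * (t - 0)"
      proof (rule set_integral_Ioo_bound[OF flux_integrable[OF \<mu> far_holder[OF R] t]])
        fix \<tau> assume "\<tau> \<in> {0<..<t}"
        then have \<tau>: "\<tau> \<in> {0<..<T}" using t by auto
        show "\<bar>\<integral>x. b \<tau> x * levy_op \<nu> (far ?R) x \<partial>\<mu> n \<tau>\<bar> \<le> B * far_levy ?R"
          by (rule abs_integral_le(1)[OF _ _ continuous_section[OF flux_continuous[OF far_holder[OF R]] \<tau>] fb])
             (use \<mu>[of n] \<tau> in \<open>auto simp: measurable_curve_def\<close>)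
      qed (use t in simp)
      also have "\<dots> \<le> B * far_levy ?R * T" using t B F0 by (intro mult_left_mono) auto
      finally have "\<bar>LINT \<tau>:{0<..<t}|lborel. flux (far ?R) (\<mu> n) \<tau>\<bar> \<le> B * far_levy ?R * T" .
      moreover have "1 / real (Suc n) * (2 * 1 + 1) = inverse (real (Suc n)) * 3" by (simp add: inverse_eq_divide)
      ultimately show ?thesis using eq[OF far_holder[OF R] t, of n] by linarith
    qed
    then show "\<exists>N. \<forall>n\<ge>N. (\<integral>x. far ?R x \<partial>\<mu> n t) - inverse (real (Suc n)) * 3 \<le> (\<integral>x. far ?R x \<partial>m0)
        + B * far_levy ?R * T" by blast
  qed
  interpret \<Lambda>: tight_functional \<Lambda>
  proof
    fix f g :: "'a \<Rightarrow> real" assume fg: "bounded_lipschitz f" "bounded_lipschitz g"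
    have "(\<lambda>n. \<integral>x. f x + g x \<partial>\<mu> n t) \<longlonglongrightarrow> \<Lambda> f + \<Lambda> g"
      by (subst Bochner_Integration.integral_add[OF int[OF fg(1)] int[OF fg(2)]]) (intro tendsto_add lim fg)
    then show "\<Lambda> (\<lambda>x. f x + g x) = \<Lambda> f + \<Lambda> g"
      by (rule LIMSEQ_unique[OF lim[OF bounded_lipschitz_add[OF fg]]])
  next
    fix f :: "'a \<Rightarrow> real" and k assume f: "bounded_lipschitz f"
    have "(\<lambda>n. \<integral>x. k * f x \<partial>\<mu> n t) \<longlonglongrightarrow> k * \<Lambda> f"
      by (subst integral_mult_right_zero) (intro tendsto_mult_left lim f)
    then show "\<Lambda> (\<lambda>x. k * f x) = k * \<Lambda> f"
      by (rule LIMSEQ_unique[OF lim[OF bounded_lipschitz_cmult[OF f]]])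
  next
    fix f :: "'a \<Rightarrow> real" assume f: "bounded_lipschitz f" "\<And>x. 0 \<le> f x"
    show "0 \<le> \<Lambda> f"
      by (rule LIMSEQ_le_const[OF lim[OF f(1)]]) (use f in \<open>auto intro!: Bochner_Integration.integral_nonneg\<close>)
  next
    have "(\<lambda>n. \<integral>x. 1 \<partial>\<mu> n t) \<longlonglongrightarrow> (1::real)"
      using prob_space.prob_space[OF p(1)] by simp
    then show "\<Lambda> (\<lambda>x. 1) = 1" by (rule LIMSEQ_unique[OF lim[OF bounded_lipschitz_const]])
  next
    fix e :: real assume e: "e > 0"
    interpret m0: prob_space m0 by fact
    note [measurable_cong] = m0(2)
    have [measurable]: "far (real (Suc j)) \<in> borel_measurable (borel :: 'a measure)" for j
      by (intro bounded_lipschitz_measurable bounded_lipschitz_far) simp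
    have "(\<lambda>j. \<integral>x. far (real (Suc j)) x \<partial>m0) \<longlonglongrightarrow> (\<integral>x. 0 \<partial>m0)"
    proof (rule integral_dominated_convergence[where w = "\<lambda>_. 1"])
      show "far (real (Suc j)) \<in> borel_measurable m0" for j by measurable
      show "AE x in m0. (\<lambda>j. far (real (Suc j)) x) \<longlonglongrightarrow> 0" by (intro AE_I2 far_tendsto_0)
      show "AE x in m0. norm (far (real (Suc j)) x) \<le> 1" for j
        by (intro AE_I2) (simp only: real_norm_def abs_of_nonneg[OF far_range(1)] far_range(2))
    qed simp_all
    then have "(\<lambda>j. (\<integral>x. far (real (Suc j)) x \<partial>m0) + B * far_levy (real (Suc j)) * T) \<longlonglongrightarrow> (\<integral>x. 0 \<partial>m0) + B * 0 * T"
      by (intro tendsto_intros far_levy_tendsto_0)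
    then have "\<forall>\<^sub>F j in sequentially. (\<integral>x. far (real (Suc j)) x \<partial>m0) + B * far_levy (real (Suc j)) * T < e"
      by (rule order_tendstoD) (use e in simp)
    then obtain j where j: "(\<integral>x. far (real (Suc j)) x \<partial>m0) + B * far_levy (real (Suc j)) * T < e"
      by (auto simp: eventually_sequentially)
    show "\<exists>R. \<forall>f. bounded_lipschitz f \<longrightarrow> (\<forall>x. 0 \<le> f x \<and> f x \<le> 1) \<longrightarrow> (\<forall>x. norm x \<le> R \<longrightarrow> f x = 0) \<longrightarrow> \<Lambda> f \<le> e"
    proof (intro exI[of _ "2 * real (Suc j)"] allI impI)
      fix f :: "'a \<Rightarrow> real"
      assume f: "bounded_lipschitz f" "\<forall>x. 0 \<le> f x \<and> f x \<le> 1" "\<forall>x. norm x \<le> 2 * real (Suc j) \<longrightarrow> f x = 0"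
      have "f x \<le> far (real (Suc j)) x" for x
      proof (cases "norm x \<le> 2 * real (Suc j)")
        case True
        then show ?thesis using f far_range(1)[of _ x] by simp
      next
        case False
        then have "norm x / real (Suc j) \<ge> 2" by (simp add: field_simps)
        then have "far (real (Suc j)) x = 1" by (simp add: far_def)
        then show ?thesis using f by simp
      qed
      then have "\<Lambda> f \<le> \<Lambda> (far (real (Suc j)))" by (intro mono f bounded_lipschitz_far) simp_all
      then show "\<Lambda> f \<le> e" using fartight[of j] j by linarith
    qed
  qed
  show ?thesis
  proof (intro exI[of _ \<Lambda>.representing] conjI allI impI)
    show "prob_space \<Lambda>.representing" by (rule \<Lambda>.prob_space_representing)
    show "sets \<Lambda>.representing = sets borel" by (rule \<Lambda>.sets_representing)
    fix u :: "'a \<Rightarrow> real" assume u: "bounded_lipschitz u"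
    show "(\<lambda>n. \<integral>x. u x \<partial>\<mu> n t) \<longlonglongrightarrow> (\<integral>x. u x \<partial>\<Lambda>.representing)"
      unfolding \<Lambda>.integral_representing[OF u] by (rule lim[OF u])
  qed
qed

definition holder_solution :: "'a measure \<Rightarrow> (real \<Rightarrow> 'a measure) \<Rightarrow> bool" where
  "holder_solution m0 m \<longleftrightarrow> measurable_curve T m \<and>
     (\<forall>(u :: 'a \<Rightarrow> real) a c t. u \<in> holder_ball \<beta> a c \<longrightarrow> t \<in> {0..T} \<longrightarrow>
       (\<integral>x. u x \<partial>m t) = (\<integral>x. u x \<partial>m0) + (LINT \<tau>:{0<..<t}|lborel. flux u m \<tau>))"

text \<open>
  Convergence for bounded Lipschitz functions is narrow convergence at each time, so the flux terms, whose integrands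
  are merely continuous and bounded, converge as well.
\<close>

lemma exists_holder_solution:
  assumes m0: "prob_space m0" "sets m0 = sets borel"
  shows "\<exists>m. holder_solution m0 m \<and> m \<in> extensional {0..T}"
proof -
  have "\<forall>n. \<exists>m. holder_solution_upto (1 / real (Suc n)) m0 m"
    by (intro allI approximate_solution[OF m0]) simp
  from choice[OF this] obtain \<mu> where "\<forall>n. holder_solution_upto (1 / real (Suc n)) m0 (\<mu> n)" ..
  then have \<mu>': "\<And>n. holder_solution_upto (1 / real (Suc n)) m0 (\<mu> n)" by simp
  note \<mu> = holder_solution_uptoD(1)[OF \<mu>'] and eq = holder_solution_uptoD(2)[OF \<mu>']
  have p: "prob_space (\<mu> n t)" "sets (\<mu> n t) = sets borel" if "t \<in> {0..T}" for n t
    using \<mu>[of n] that by (auto simp: measurable_curve_def)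
  define m where "m = restrict (\<lambda>t. SOME \<mu>'. prob_space \<mu>' \<and> sets \<mu>' = sets borel \<and>
     (\<forall>u. bounded_lipschitz u \<longrightarrow> (\<lambda>n. \<integral>x. u x \<partial>\<mu> n t) \<longlonglongrightarrow> (\<integral>x. u x \<partial>\<mu>'))) {0..T}"
  have m: "prob_space (m t) \<and> sets (m t) = sets borel \<and>
     (\<forall>u. bounded_lipschitz u \<longrightarrow> (\<lambda>n. \<integral>x. u x \<partial>\<mu> n t) \<longlonglongrightarrow> (\<integral>x. u x \<partial>m t))" if t: "t \<in> {0..T}" for t
    using someI_ex[OF approximations_converge[OF m0 \<mu>' t]] t unfolding m_def by simp
  have narrow: "(\<lambda>n. \<integral>x. f x \<partial>\<mu> n t) \<longlonglongrightarrow> (\<integral>x. f x \<partial>m t)"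
    if "t \<in> {0..T}" "continuous_on UNIV f" "\<And>x. \<bar>f x\<bar> \<le> C" for f :: "'a \<Rightarrow> real" and C t
    by (rule narrow_convergence_bounded_lipschitz[OF _ _ _ _ that(2,3)]) (use p[OF that(1)] m[OF that(1)] in auto)
  have mc: "measurable_curve T m"
    unfolding measurable_curve_def
  proof (intro conjI ballI allI impI)
    show "prob_space (m t)" "sets (m t) = sets borel" if "t \<in> {0..T}" for t using m[OF that] by auto
    fix g :: "real \<Rightarrow> 'a \<Rightarrow> real" and C
    assume g: "continuous_on ({0<..<T} \<times> UNIV) (\<lambda>(t, x). g t x)" "\<forall>t x. \<bar>g t x\<bar> \<le> C"
    show "(\<lambda>t. indicator {0<..<T} t * (\<integral>x. g t x \<partial>m t)) \<in> borel_measurable borel"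
    proof (rule borel_measurable_LIMSEQ_real)
      show "(\<lambda>t. indicator {0<..<T} t * (\<integral>x. g t x \<partial>\<mu> n t)) \<in> borel_measurable borel" for n
        using \<mu>[of n] g unfolding measurable_curve_def by blast
      show "(\<lambda>n. indicator {0<..<T} t * (\<integral>x. g t x \<partial>\<mu> n t)) \<longlonglongrightarrow> indicator {0<..<T} t * (\<integral>x. g t x \<partial>m t)" for t
      proof (cases "t \<in> {0<..<T}")
        case True
        then have "t \<in> {0..T}" by simp
        from narrow[OF this continuous_section[OF g(1) True], of C] g(2)
        show ?thesis by (intro tendsto_mult_left) simp
      qed simp
    qed
  qed
  have "(\<integral>x. u x \<partial>m t) = (\<integral>x. u x \<partial>m0) + (LINT \<tau>:{0<..<t}|lborel. flux u m \<tau>)"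
    if u: "u \<in> holder_ball \<beta> a c" and t: "t \<in> {0..T}" for u :: "'a \<Rightarrow> real" and a c t
  proof -
    let ?F = "\<lambda>m. LINT \<tau>:{0<..<t}|lborel. flux u m \<tau>"
    have F: "(\<lambda>n. ?F (\<mu> n)) \<longlonglongrightarrow> ?F m"
      unfolding set_lebesgue_integral_def
    proof (rule integral_dominated_convergence[where w = "\<lambda>\<tau>. indicator {0<..<t} \<tau> * (B * ((2 * a + c) * M))"])
      show "integrable lborel (\<lambda>\<tau>. indicator {0<..<t} \<tau> * (B * ((2 * a + c) * M)))"
        by (intro integrable_mult_left integrable_real_indicator) (auto simp: emeasure_lborel_Ioo_finite)
      show "(\<lambda>\<tau>. indicator {0<..<t} \<tau> *\<^sub>R flux u m \<tau>) \<in> borel_measurable lborel"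
        using flux_curve_measurable[OF mc u t] by simp
      show "(\<lambda>\<tau>. indicator {0<..<t} \<tau> *\<^sub>R flux u (\<mu> n) \<tau>) \<in> borel_measurable lborel" for n
        using flux_curve_measurable[OF \<mu> u t] by simp
      show "AE \<tau> in lborel. norm (indicator {0<..<t} \<tau> *\<^sub>R flux u (\<mu> n) \<tau>) \<le> indicator {0<..<t} \<tau> * (B * ((2 * a
          + c) * M))" for n
        using t flux_integral_bound[OF \<mu> u] by (intro AE_I2) (auto simp: indicator_def)
      have "(\<lambda>n. \<integral>x. b \<tau> x * levy_op \<nu> u x \<partial>\<mu> n \<tau>) \<longlonglongrightarrow> flux u m \<tau>" if "\<tau> \<in> {0<..<T}" for \<tau>
        by (rule narrow[OF _ continuous_section[OF flux_continuous[OF u] that] flux_bound[OF u]]) (use that in simp)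
      then show "AE \<tau> in lborel. (\<lambda>n. indicator {0<..<t} \<tau> *\<^sub>R flux u (\<mu> n) \<tau>) \<longlonglongrightarrow> indicator {0<..<t} \<tau> *\<^sub>R flux u m \<tau>"
        using t by (intro AE_I2) (auto simp: indicator_def)
    qed
    have 1: "(\<lambda>n. (\<integral>x. u x \<partial>\<mu> n t) - (\<integral>x. u x \<partial>m0) - ?F (\<mu> n)) \<longlonglongrightarrow> (\<integral>x. u x \<partial>m t) - (\<integral>x. u x \<partial>m0) - ?F m"
      by (intro tendsto_diff tendsto_const F narrow[OF t holder_continuous[OF u \<beta>(1)] holder_ballD(1)[OF u]])
    have "(\<lambda>n. (\<integral>x. u x \<partial>\<mu> n t) - (\<integral>x. u x \<partial>m0) - ?F (\<mu> n)) \<longlonglongrightarrow> 0"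
    proof (rule Lim_null_comparison)
      show "\<forall>\<^sub>F n in sequentially. norm ((\<integral>x. u x \<partial>\<mu> n t) - (\<integral>x. u x \<partial>m0) - ?F (\<mu> n))
          \<le> inverse (real (Suc n)) * (2 * a + c)"
        using eq[OF u t] by (intro always_eventually allI) (simp only: real_norm_def inverse_eq_divide)
      show "(\<lambda>n. inverse (real (Suc n)) * (2 * a + c)) \<longlonglongrightarrow> 0"
        using tendsto_mult_right[OF LIMSEQ_inverse_real_of_nat, of "2 * a + c"] by simp
    qed
    from LIMSEQ_unique[OF 1 this] show ?thesis by simp
  qed
  moreover have "m \<in> extensional {0..T}" by (simp add: m_def)
  ultimately show ?thesis using mc unfolding holder_solution_def by blast
qed

end

section \<open>Test functions that depend on time, and existence\<close>

lemma Cc_infty_bounded: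
  fixes \<phi> :: "'b::euclidean_space \<Rightarrow> real"
  assumes "\<phi> \<in> Cc_infty"
  obtains C where "C \<ge> 0" "\<And>x. \<bar>\<phi> x\<bar> \<le> C"
proof -
  let ?K = "closure {x. \<phi> x \<noteq> 0}"
  have "Ck 0 \<phi>" using assms unfolding Cc_infty_def by blast
  then have c: "continuous_on UNIV \<phi>" by simp
  have K: "compact ?K" using assms unfolding Cc_infty_def by blast
  have "bounded (\<phi> ` ?K)"
    by (intro compact_imp_bounded compact_continuous_image continuous_on_subset[OF c] K) auto
  then obtain C where C: "\<forall>y\<in>\<phi> ` ?K. norm y \<le> C" unfolding bounded_iff by (elim exE)
  show thesis
  proof (rule that[of "max 0 C"])
    fix x
    show "\<bar>\<phi> x\<bar> \<le> max 0 C"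
    proof (cases "\<phi> x = 0")
      case False
      then have "x \<in> ?K" using closure_subset[of "{x. \<phi> x \<noteq> 0}"] by (intro subsetD[OF closure_subset]) simp
      then have "norm (\<phi> x) \<le> C" using C by (intro bspec[OF C] imageI)
      then show ?thesis by simp
    qed simp
  qed simp
qed

lemma Cc_infty_derivative:
  fixes \<phi> :: "'b::euclidean_space \<Rightarrow> real"
  assumes "\<phi> \<in> Cc_infty"
  shows "(\<lambda>x. frechet_derivative \<phi> (at x) v) \<in> Cc_infty"
proof -
  let ?K = "closure {x. \<phi> x \<noteq> 0}"
  have Ck: "Ck k \<phi>" for k using assms unfolding Cc_infty_def by blast
  have K: "compact ?K" using assms unfolding Cc_infty_def by blast
  have "frechet_derivative \<phi> (at x) v = 0" if "x \<notin> ?K" for x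
  proof -
    have "((\<lambda>x. 0) has_derivative (\<lambda>v. 0)) (at x)" by simp
    then have "(\<phi> has_derivative (\<lambda>v. 0)) (at x)"
    proof (rule has_derivative_transform_within_open)
      show "open (- ?K)" "x \<in> - ?K" using that by auto
      show "0 = \<phi> y" if "y \<in> - ?K" for y
      proof -
        have "y \<notin> {x. \<phi> x \<noteq> 0}" using that closure_subset[of "{x. \<phi> x \<noteq> 0}"] by (meson ComplD subsetD)
        then show ?thesis by simp
      qed
    qed
    then have "(\<lambda>v. 0) = frechet_derivative \<phi> (at x)" by (rule frechet_derivative_at)
    from fun_cong[OF this, of v] show ?thesis by simp
  qed
  then have "{x. frechet_derivative \<phi> (at x) v \<noteq> 0} \<subseteq> ?K" by blast
  then have "bounded {x. frechet_derivative \<phi> (at x) v \<noteq> 0}"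
    using K compact_imp_bounded bounded_subset by blast
  moreover have "Ck k (\<lambda>x. frechet_derivative \<phi> (at x) v)" for k using Ck[of "Suc k"] by simp
  ultimately show ?thesis by (simp add: Cc_infty_def compact_closure)
qed

text \<open>The directional derivatives are bounded as continuous functions of compact support.\<close>

lemma Cc_infty_bounded_lipschitz:
  fixes \<phi> :: "'b::euclidean_space \<Rightarrow> real"
  assumes \<phi>: "\<phi> \<in> Cc_infty"
  shows "bounded_lipschitz \<phi>"
proof -
  obtain C where C: "C \<ge> 0" "\<And>x. \<bar>\<phi> x\<bar> \<le> C" by (rule Cc_infty_bounded[OF \<phi>]) (rule that)
  have "\<exists>D. D \<ge> 0 \<and> (\<forall>x. \<bar>frechet_derivative \<phi> (at x) v\<bar> \<le> D)" for v
    by (rule Cc_infty_bounded[OF Cc_infty_derivative[OF \<phi>, of v]]) blast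
  then obtain D where D: "\<And>v. D v \<ge> 0" "\<And>v x. \<bar>frechet_derivative \<phi> (at x) v\<bar> \<le> D v" by metis
  define L where "L = (\<Sum>i\<in>Basis. D i)"
  have "Ck (Suc 0) \<phi>" using \<phi> unfolding Cc_infty_def by blast
  note d = Ck_SucD[OF this]
  have on: "onorm (frechet_derivative \<phi> (at x)) \<le> L" for x
  proof (rule onorm_bound)
    show "0 \<le> L" unfolding L_def by (intro sum_nonneg D)
    fix v
    have lin: "linear (frechet_derivative \<phi> (at x))" using has_derivative_linear[OF d] .
    have "frechet_derivative \<phi> (at x) v = frechet_derivative \<phi> (at x) (\<Sum>i\<in>Basis. (v \<bullet> i) *\<^sub>R i)"
      by (simp add: euclidean_representation)
    also have "\<dots> = (\<Sum>i\<in>Basis. (v \<bullet> i) * frechet_derivative \<phi> (at x) i)"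
      by (simp add: linear_sum[OF lin] linear_scale[OF lin])
    also have "norm \<dots> \<le> (\<Sum>i\<in>Basis. norm v * D i)"
    proof (rule sum_norm_le)
      fix i :: 'b assume "i \<in> Basis"
      then show "norm ((v \<bullet> i) * frechet_derivative \<phi> (at x) i) \<le> norm v * D i"
        using D(2)[of x i] by (simp add: abs_mult) (intro mult_mono Basis_le_norm, auto)
    qed
    also have "\<dots> = L * norm v" by (simp add: L_def sum_distrib_left mult.commute)
    finally show "norm (frechet_derivative \<phi> (at x) v) \<le> L * norm v" .
  qed
  show ?thesis
  proof (rule bounded_lipschitzI[OF C(2)])
    fix x y
    have "norm (\<phi> x - \<phi> y) \<le> L * norm (x - y)"
      by (rule differentiable_bound[of UNIV \<phi> "\<lambda>x. frechet_derivative \<phi> (at x)"]) (use d on in auto)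
    then show "\<bar>\<phi> x - \<phi> y\<bar> \<le> L * dist x y" by (simp add: dist_norm)
  qed
qed

lemma constant_of_quadratic_increment:
  fixes f :: "real \<Rightarrow> real"
  assumes f: "\<And>s t. 0 \<le> s \<Longrightarrow> s \<le> t \<Longrightarrow> t \<le> T \<Longrightarrow> \<bar>f t - f s\<bar> \<le> C * (t - s)\<^sup>2" and t: "t \<in> {0..T}"
  shows "f t = f 0"
proof -
  have sym: "\<bar>f t - f s\<bar> \<le> C * (t - s)\<^sup>2" if "s \<in> {0..T}" "t \<in> {0..T}" for s t
    using f[of s t] f[of t s] that by (cases "s \<le> t") (auto simp: abs_minus_commute power2_commute)
  have "(f has_field_derivative 0) (at s within {0..T})" if s: "s \<in> {0..T}" for s
    unfolding has_field_derivative_iff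
  proof (rule Lim_null_comparison)
    show "\<forall>\<^sub>F y in at s within {0..T}. norm ((f y - f s) / (y - s)) \<le> C * \<bar>y - s\<bar>"
      unfolding eventually_at_filter
    proof (intro always_eventually allI impI)
      fix y assume y: "y \<noteq> s" "y \<in> {0..T}"
      define d where "d = \<bar>y - s\<bar>"
      have d: "d > 0" "(y - s)\<^sup>2 = d * d" using y by (simp_all add: d_def power2_eq_square)
      have "\<bar>f y - f s\<bar> / d \<le> C * (d * d) / d"
        using sym[OF s y(2)] d by (intro divide_right_mono) auto
      also have "\<dots> = C * d" using d by simp
      finally show "norm ((f y - f s) / (y - s)) \<le> C * \<bar>y - s\<bar>" by (simp add: abs_divide d_def)
    qed
    have "((\<lambda>y. C * \<bar>y - s\<bar>) \<longlongrightarrow> C * \<bar>s - s\<bar>) (at s within {0..T})" by (intro tendsto_intros)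
    then show "((\<lambda>y. C * \<bar>y - s\<bar>) \<longlongrightarrow> 0) (at s within {0..T})" by simp
  qed
  then have "\<exists>c. \<forall>x\<in>{0..T}. f x = c"
    by (intro has_field_derivative_zero_constant) auto
  then show ?thesis using t by force
qed

context fokker_planck
begin

lemma holder_solution_increment:
  assumes m: "holder_solution m0 m" and u: "u \<in> holder_ball \<beta> a c" and st: "0 \<le> s" "s \<le> t" "t \<le> T"
  shows "(\<integral>x. u x \<partial>m t) - (\<integral>x. u x \<partial>m s) = (LINT \<tau>:{s<..<t}|lborel. flux u m \<tau>)"
    and "\<bar>(\<integral>x. u x \<partial>m t) - (\<integral>x. u x \<partial>m s)\<bar> \<le> B * ((2 * a + c) * M) * (t - s)"
proof -
  have mc: "measurable_curve T m" using m by (simp add: holder_solution_def)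
  have eq: "(\<integral>x. u x \<partial>m t) = (\<integral>x. u x \<partial>m0) + (LINT \<tau>:{0<..<t}|lborel. flux u m \<tau>)"
    if "t \<in> {0..T}" for t using m u that unfolding holder_solution_def by blast
  have tT: "t \<in> {0..T}" "s \<in> {0..T}" using st by auto
  have i: "set_integrable lborel {s<..<t} (\<lambda>\<tau>. \<integral>x. b \<tau> x * levy_op \<nu> u x \<partial>m \<tau>)"
    by (rule set_integrable_subset[OF flux_integrable[OF mc u tT(1)]]) (use st in auto)
  show inc: "(\<integral>x. u x \<partial>m t) - (\<integral>x. u x \<partial>m s) = (LINT \<tau>:{s<..<t}|lborel. flux u m \<tau>)"
    using eq[OF tT(1)] eq[OF tT(2)] set_integral_Ioo_split[OF flux_integrable[OF mc u tT(1)] st(1,2)] by simp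
  show "\<bar>(\<integral>x. u x \<partial>m t) - (\<integral>x. u x \<partial>m s)\<bar> \<le> B * ((2 * a + c) * M) * (t - s)"
    unfolding inc by (rule set_integral_Ioo_bound[OF i st(2)]) (rule flux_integral_bound[OF mc u], use st in auto)
qed

lemma holder_solution_prob:
  assumes "holder_solution m0 m" "t \<in> {0..T}"
  shows "prob_space (m t)" "sets (m t) = sets borel"
  using assms by (auto simp: holder_solution_def measurable_curve_def)

text \<open>
  Integrals of Hoelder functions are Lipschitz in time by the equation itself; this upgrades to all bounded
  continuous functions.
\<close>

lemma holder_solution_narrow:
  assumes m: "holder_solution m0 m" and ext: "m \<in> extensional {0..T}"
  shows "m \<in> narrow_curves T"
  unfolding narrow_curves_iff
proof (intro conjI ballI allI impI ext)
  fix t assume "t \<in> {0..T}"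
  then show "m t \<in> borel_probs" using holder_solution_prob[OF m] by (auto simp: borel_probs_def)
next
  fix f :: "'a \<Rightarrow> real" assume f: "continuous_on UNIV f" "bounded (range f)"
  from f(2) obtain C where C: "\<And>x. \<bar>f x\<bar> \<le> C" by (auto simp: bounded_iff)
  show "continuous_on {0..T} (\<lambda>t. \<integral>x. f x \<partial>m t)"
    unfolding continuous_on_def
  proof
    fix s assume s: "s \<in> {0..T}"
    show "((\<lambda>t. \<integral>x. f x \<partial>m t) \<longlongrightarrow> (\<integral>x. f x \<partial>m s)) (at s within {0..T})"
    proof (rule narrow_convergence_bounded_lipschitz[OF _ _ _ _ f(1) C])
      show "\<forall>\<^sub>F t in at s within {0..T}. prob_space (m t) \<and> sets (m t) = sets borel"
        unfolding eventually_at_filter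
        by (intro always_eventually allI impI conjI holder_solution_prob[OF m])
      show "prob_space (m s)" "sets (m s) = sets borel" using holder_solution_prob[OF m s] by auto
      fix u :: "'a \<Rightarrow> real" assume bl: "bounded_lipschitz u"
      obtain a c where u: "u \<in> holder_ball \<beta> a c" by (rule bounded_lipschitz_imp_holder[OF bl \<beta>])
      let ?K = "B * ((2 * a + c) * M)"
      show "((\<lambda>t. \<integral>x. u x \<partial>m t) \<longlongrightarrow> (\<integral>x. u x \<partial>m s)) (at s within {0..T})"
      proof (rule LIM_zero_cancel, rule Lim_null_comparison)
        show "\<forall>\<^sub>F t in at s within {0..T}. norm ((\<integral>x. u x \<partial>m t) - (\<integral>x. u x \<partial>m s)) \<le> ?K * \<bar>t - s\<bar>"
          unfolding eventually_at_filter
        proof (intro always_eventually allI impI)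
          fix t assume t: "t \<in> {0..T}"
          show "norm ((\<integral>x. u x \<partial>m t) - (\<integral>x. u x \<partial>m s)) \<le> ?K * \<bar>t - s\<bar>"
          proof (cases "s \<le> t")
            case True
            then show ?thesis using holder_solution_increment(2)[OF m u _ True] s t by simp
          next
            case False
            then have "t \<le> s" by simp
            then show ?thesis using holder_solution_increment(2)[OF m u _ \<open>t \<le> s\<close>] s t
                by (simp add: abs_minus_commute)
          qed
        qed
        have "((\<lambda>t. ?K * \<bar>t - s\<bar>) \<longlongrightarrow> ?K * \<bar>s - s\<bar>) (at s within {0..T})" by (intro tendsto_intros)
        then show "((\<lambda>t. ?K * \<bar>t - s\<bar>) \<longlongrightarrow> 0) (at s within {0..T})" by simp
      qed
    qed
  qed
qed

lemma levy_op_diff: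
  fixes u w :: "'a \<Rightarrow> real"
  assumes u: "u \<in> holder_ball \<beta> a c" and w: "w \<in> holder_ball \<beta> a' c'"
  shows "levy_op \<nu> (\<lambda>x. u x - w x) x = levy_op \<nu> u x - levy_op \<nu> w x"
proof -
  have i: "integrable \<nu> (\<lambda>z. u (x + z) - u x)" "integrable \<nu> (\<lambda>z. w (x + z) - w x)"
    using increment_integrable[OF u, of "\<lambda>_. 1" x] increment_integrable[OF w, of "\<lambda>_. 1" x] by auto
  have "levy_op \<nu> (\<lambda>x. u x - w x) x = (\<integral>z. (u (x + z) - u x) - (w (x + z) - w x) \<partial>\<nu>)"
    unfolding levy_op_def by (intro Bochner_Integration.integral_cong refl) simp
  also have "\<dots> = levy_op \<nu> u x - levy_op \<nu> w x"
    unfolding levy_op_def by (rule Bochner_Integration.integral_diff[OF i])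
  finally show ?thesis .
qed

text \<open>
  Let \<open>\<Phi> t\<close> be the difference of the two sides of the equation at time \<open>t\<close>, up to a constant. On \<open>{s..t}\<close> freeze the
  test function at time \<open>s\<close> and use the equation for it. What remains are the Taylor remainder of \<open>\<phi>\<close> in time, the
  change of \<open>\<partial>\<^sub>t\<phi>\<close> and of the measure over a time \<open>t - s\<close>, and \<open>\<L>\<close> of \<open>\<phi>(\<tau>) - \<phi>(s)\<close>, whose Hoelder
  size is \<open>O(t - s)\<close> because \<open>\<partial>\<^sub>t\<phi>\<close> is Hoelder in space. Integrated, all of them are \<open>O((t
      - s)\<^sup>2)\<close>, so \<open>\<Phi>\<close> is constant.
\<close>

lemma holder_solution_weak:
  assumes m: "holder_solution m0 m" and \<phi>: "\<phi> \<in> Cc_infty" and t: "t \<in> {0..T}"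
  shows "(\<integral>x. \<phi> (t, x) \<partial>m t) = (\<integral>x. \<phi> (0, x) \<partial>m0) + (LINT \<tau>:{0<..<t}|lborel.
           (\<integral>x. deriv (\<lambda>s. \<phi> (s, x)) \<tau> + b \<tau> x * levy_op \<nu> (\<lambda>y. \<phi> (\<tau>, y)) x \<partial>m \<tau>))"
proof -
  have mc: "measurable_curve T m" using m by (simp add: holder_solution_def)
  define \<psi> where "\<psi> p = frechet_derivative \<phi> (at p) (1, 0)" for p
  have \<psi>C: "\<psi> \<in> Cc_infty" unfolding \<psi>_def by (rule Cc_infty_derivative[OF \<phi>])
  obtain a c where \<phi>H: "\<phi> \<in> holder_ball \<beta> a c"
    by (rule bounded_lipschitz_imp_holder[OF Cc_infty_bounded_lipschitz[OF \<phi>] \<beta>])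
  obtain a1 c1 where \<psi>H: "\<psi> \<in> holder_ball \<beta> a1 c1"
    by (rule bounded_lipschitz_imp_holder[OF Cc_infty_bounded_lipschitz[OF \<psi>C] \<beta>])
  obtain A L where \<psi>L: "A \<ge> 0" "L \<ge> 0" "\<And>p. \<bar>\<psi> p\<bar> \<le> A" "\<And>p q. \<bar>\<psi> p - \<psi> q\<bar> \<le> L * dist p q"
    by (rule bounded_lipschitzE[OF Cc_infty_bounded_lipschitz[OF \<psi>C]]) (rule that)
  have slice: "(\<lambda>x. f (s, x)) \<in> holder_ball \<beta> a c"
    if f: "f \<in> holder_ball \<beta> a c" for f :: "real \<times> 'a \<Rightarrow> real" and s a c
    by (rule holder_ballI) (use holder_ballD(1,3)[OF f] holder_ballD(2)[OF f, of "(s, _)" "(s, _)"] in \<open>auto simp: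
        norm_Pair\<close>)
  have dt: "((\<lambda>s. \<phi> (s, x)) has_real_derivative \<psi> (s, x)) (at s)" for s x
  proof -
    have "Ck (Suc 0) \<phi>" using \<phi> unfolding Cc_infty_def by blast
    note d = Ck_SucD[OF this]
    have "((\<lambda>s. (s, x)) has_derivative (\<lambda>h. (h, 0))) (at s)" by (auto intro!: derivative_eq_intros)
    from has_derivative_compose[OF this d]
    have "((\<lambda>s. \<phi> (s, x)) has_derivative (\<lambda>h. frechet_derivative \<phi> (at (s, x)) (h, 0))) (at s)" .
    moreover have "frechet_derivative \<phi> (at (s, x)) (h, 0) = h * \<psi> (s, x)" for h
    proof -
      have "frechet_derivative \<phi> (at (s, x)) (h *\<^sub>R (1, 0)) = h *\<^sub>R frechet_derivative \<phi> (at (s, x)) (1, 0)"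
        by (rule linear_scale[OF has_derivative_linear[OF d]])
      then show ?thesis by (simp add: \<psi>_def)
    qed
    moreover have "(\<lambda>h. h * \<psi> (s, x)) = (*) (\<psi> (s, x))" by (simp add: fun_eq_iff)
    ultimately show ?thesis by (simp add: has_field_derivative_def)
  qed
  have mvt: "\<exists>z. s \<le> z \<and> z \<le> t \<and> f t - f s = (t - s) * f' z"
    if "s \<le> t" "\<And>s. (f has_real_derivative f' s) (at s)" for s t :: real and f f' :: "real \<Rightarrow> real"
  proof (cases "s = t")
    case False
    then have "s < t" using that by simp
    from MVT2[OF this that(2)] obtain z where "s < z" "z < t" "f t - f s = (t - s) * f' z" by blast
    then show ?thesis by (intro exI[of _ z]) auto
  qed (use that in auto)
  have taylor: "\<bar>\<phi> (t, x) - \<phi> (s, x) - (t - s) * \<psi> (s, x)\<bar> \<le> L * (t - s)\<^sup>2" if st: "s \<le> t" for s t x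
  proof -
    obtain z where z: "s \<le> z" "z \<le> t" "\<phi> (t, x) - \<phi> (s, x) = (t - s) * \<psi> (z, x)"
      using mvt[OF st dt] by blast
    have "\<bar>\<phi> (t, x) - \<phi> (s, x) - (t - s) * \<psi> (s, x)\<bar> = (t - s) * \<bar>\<psi> (z, x) - \<psi> (s, x)\<bar>"
      unfolding z(3) right_diff_distrib[symmetric] abs_mult using st by simp
    also have "\<dots> \<le> (t - s) * (L * (t - s))"
    proof (rule mult_left_mono)
      have "\<bar>\<psi> (z, x) - \<psi> (s, x)\<bar> \<le> L * dist (z, x) (s, x)" by (rule \<psi>L)
      also have "dist (z, x) (s, x) = z - s" using z by (simp add: dist_Pair_Pair dist_real_def)
      also have "L * (z - s) \<le> L * (t - s)" using z \<psi>L by (intro mult_left_mono) auto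
      finally show "\<bar>\<psi> (z, x) - \<psi> (s, x)\<bar> \<le> L * (t - s)" .
    qed (use st in simp)
    finally show ?thesis by (simp add: power2_eq_square algebra_simps)
  qed
  have dH: "(\<lambda>x. \<phi> (t, x) - \<phi> (s, x)) \<in> holder_ball \<beta> ((t - s) * a1) ((t - s) * c1)" if st: "s \<le> t" for s t
  proof (rule holder_ballI)
    show "0 \<le> (t - s) * c1" using st holder_ballD(3)[OF \<psi>H] by simp
    fix x
    obtain z where "\<phi> (t, x) - \<phi> (s, x) = (t - s) * \<psi> (z, x)" using mvt[OF st dt] by blast
    then show "\<bar>\<phi> (t, x) - \<phi> (s, x)\<bar> \<le> (t - s) * a1"
      using st holder_ballD(1)[OF \<psi>H, of "(z, x)"] by (simp add: abs_mult mult_left_mono)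
    fix y
    have "((\<lambda>s. \<phi> (s, x) - \<phi> (s, y)) has_real_derivative \<psi> (s, x) - \<psi> (s, y)) (at s)" for s
      by (intro DERIV_diff dt)
    from mvt[OF st this] obtain z where
      z: "\<phi> (t, x) - \<phi> (t, y) - (\<phi> (s, x) - \<phi> (s, y)) = (t - s) * (\<psi> (z, x) - \<psi> (z, y))" by blast
    have "\<phi> (t, x) - \<phi> (s, x) - (\<phi> (t, y) - \<phi> (s, y)) = (t - s) * (\<psi> (z, x) - \<psi> (z, y))"
      using z by (simp add: algebra_simps)
    then have "\<bar>\<phi> (t, x) - \<phi> (s, x) - (\<phi> (t, y) - \<phi> (s, y))\<bar> = (t - s) * \<bar>\<psi> (z, x) - \<psi> (z, y)\<bar>"
      using st by (simp add: abs_mult)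
    also have "\<dots> \<le> (t - s) * (c1 * norm (x - y) powr \<beta>)"
      using st holder_ballD(2)[OF slice[OF \<psi>H], of z x y] by (intro mult_left_mono) auto
    finally show "\<bar>\<phi> (t, x) - \<phi> (s, x) - (\<phi> (t, y) - \<phi> (s, y))\<bar> \<le> (t - s) * c1 * norm (x - y) powr \<beta>"
      by (simp add: mult.assoc)
  qed
  define K where "K = B * ((2 * a1 + c1) * M)"
  have K0: "K \<ge> 0" using B M holder_const_nonneg[OF slice[OF \<psi>H, of 0]] by (simp add: K_def)
  have levy_time: "\<bar>levy_op \<nu> (\<lambda>y. \<phi> (t, y)) x - levy_op \<nu> (\<lambda>y. \<phi> (s, y)) x\<bar> \<le> (2 * a1 + c1) * M * (t - s)"
    if st: "s \<le> t" for s t x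
    using levy_op_bound[OF dH[OF st], of x]
    by (simp add: levy_op_diff[OF slice[OF \<phi>H] slice[OF \<phi>H]] algebra_simps)
  have levy_time': "\<bar>levy_op \<nu> (\<lambda>y. \<phi> (t, y)) x - levy_op \<nu> (\<lambda>y. \<phi> (s, y)) x\<bar> \<le> (2 * a1 + c1) * M * \<bar>t - s\<bar>" for s t x
    using levy_time[of s t x] levy_time[of t s x] by (cases "s \<le> t") (auto simp: abs_minus_commute)
  define g where "g \<tau> x = \<psi> (\<tau>, x) + b \<tau> x * levy_op \<nu> (\<lambda>y. \<phi> (\<tau>, y)) x" for \<tau> x
  have \<psi>c: "continuous_on S \<psi>" for S by (rule holder_continuous[OF \<psi>H \<beta>(1)])
  have levy_joint: "continuous_on UNIV (\<lambda>(\<tau>, x). levy_op \<nu> (\<lambda>y. \<phi> (\<tau>, y)) x)"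
    unfolding continuous_on_sequentially
  proof (intro allI ballI impI, elim conjE)
    fix p :: "real \<times> 'a" and q assume q: "q \<longlonglongrightarrow> p"
    obtain \<tau> x where p: "p = (\<tau>, x)" by (cases p)
    have q1: "(\<lambda>n. fst (q n)) \<longlonglongrightarrow> \<tau>" and q2: "(\<lambda>n. snd (q n)) \<longlonglongrightarrow> x"
      using tendsto_fst[OF q] tendsto_snd[OF q] by (simp_all add: p)
    have "(\<lambda>n. levy_op \<nu> (\<lambda>y. \<phi> (fst (q n), y)) (snd (q n)) - levy_op \<nu> (\<lambda>y. \<phi> (\<tau>, y)) (snd (q n))) \<longlonglongrightarrow> 0"
    proof (rule Lim_null_comparison)
      show "\<forall>\<^sub>F n in sequentially. norm (levy_op \<nu> (\<lambda>y. \<phi> (fst (q n), y)) (snd (q n))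
          - levy_op \<nu> (\<lambda>y. \<phi> (\<tau>, y)) (snd (q n)))
          \<le> (2 * a1 + c1) * M * \<bar>fst (q n) - \<tau>\<bar>"
        using levy_time' by (intro always_eventually allI) (simp only: real_norm_def)
      have "(\<lambda>n. (2 * a1 + c1) * M * \<bar>fst (q n) - \<tau>\<bar>) \<longlonglongrightarrow> (2 * a1 + c1) * M * \<bar>\<tau> - \<tau>\<bar>"
        by (intro tendsto_intros q1)
      then show "(\<lambda>n. (2 * a1 + c1) * M * \<bar>fst (q n) - \<tau>\<bar>) \<longlonglongrightarrow> 0" by simp
    qed
    moreover have "(\<lambda>n. levy_op \<nu> (\<lambda>y. \<phi> (\<tau>, y)) (snd (q n))) \<longlonglongrightarrow> levy_op \<nu> (\<lambda>y. \<phi> (\<tau>, y)) x"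
      using levy_op_continuous[OF slice[OF \<phi>H, of \<tau>]] q2
      by (intro isCont_tendsto_compose[of x "levy_op \<nu> (\<lambda>y. \<phi> (\<tau>, y))"]) (simp_all add:
          continuous_on_eq_continuous_at)
    ultimately have "(\<lambda>n. (levy_op \<nu> (\<lambda>y. \<phi> (fst (q n), y)) (snd (q n)) - levy_op \<nu> (\<lambda>y. \<phi> (\<tau>, y)) (snd (q n)))
         + levy_op \<nu> (\<lambda>y. \<phi> (\<tau>, y)) (snd (q n))) \<longlonglongrightarrow> 0 + levy_op \<nu> (\<lambda>y. \<phi> (\<tau>, y)) x"
      by (rule tendsto_add)
    then show "((\<lambda>(\<tau>, x). levy_op \<nu> (\<lambda>y. \<phi> (\<tau>, y)) x) \<circ> q) \<longlonglongrightarrow> (case p of (\<tau>, x) \<Rightarrow> levy_op \<nu> (\<lambda>y. \<phi> (\<tau>, y)) x)"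
      by (simp add: o_def p split_beta)
  qed
  have gc: "continuous_on ({0<..<T} \<times> UNIV) (\<lambda>(\<tau>, x). g \<tau> x)"
  proof -
    have "continuous_on ({0<..<T} \<times> UNIV) (\<lambda>q. \<psi> q
        + (case q of (\<tau>, x) \<Rightarrow> b \<tau> x) * (case q of (\<tau>, x) \<Rightarrow> levy_op \<nu> (\<lambda>y. \<phi> (\<tau>, y)) x))"
      by (intro continuous_on_add continuous_on_mult \<psi>c b_cont continuous_on_subset[OF levy_joint]) auto
    then show ?thesis by (simp add: g_def split_beta)
  qed
  define Cg where "Cg = a1 + B * ((2 * a + c) * M)"
  have gb: "\<bar>g \<tau> x\<bar> \<le> Cg" for \<tau> x
    unfolding g_def Cg_def
    by (rule order_trans[OF abs_triangle_ineq add_mono[OF holder_ballD(1)[OF \<psi>H] flux_bound[OF slice[OF \<phi>H]]]])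
  define I where "I \<tau> = (\<integral>x. g \<tau> x \<partial>m \<tau>)" for \<tau>
  have pm: "prob_space (m \<tau>)" "sets (m \<tau>) = sets borel" if "\<tau> \<in> {0..T}" for \<tau>
    using holder_solution_prob[OF m that] by auto
  have Ib: "\<bar>I \<tau>\<bar> \<le> Cg" if "\<tau> \<in> {0<..<T}" for \<tau>
    unfolding I_def by (rule abs_integral_le(1)[OF pm continuous_section[OF gc that] gb]) (use that in auto)
  have Ii: "set_integrable lborel {s<..<t} I" if "0 \<le> s" "t \<le> T" for s t
  proof -
    have "set_integrable lborel {0<..<T} I"
      unfolding set_integrable_def
    proof (rule Bochner_Integration.integrable_bound)
      show "integrable lborel (\<lambda>\<tau>. indicator {0<..<T} \<tau> * Cg)"
        by (intro integrable_mult_left integrable_real_indicator) (auto simp: emeasure_lborel_Ioo_finite)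
      have "(\<lambda>t. indicator {0<..<T} t * (\<integral>x. g t x \<partial>m t)) \<in> borel_measurable borel"
        using mc gc gb unfolding measurable_curve_def by blast
      then show "(\<lambda>\<tau>. indicator {0<..<T} \<tau> *\<^sub>R I \<tau>) \<in> borel_measurable lborel" by (simp add: I_def)
      show "AE \<tau> in lborel. norm (indicator {0<..<T} \<tau> *\<^sub>R I \<tau>) \<le> norm (indicator {0<..<T} \<tau> * Cg)"
        using Ib by (intro AE_I2) (auto simp: indicator_def intro: order_trans[OF _ abs_ge_self])
    qed
    then show ?thesis by (rule set_integrable_subset) (use that in auto)
  qed
  define \<Phi> where "\<Phi> t = (\<integral>x. \<phi> (t, x) \<partial>m t) - (LINT \<tau>:{0<..<t}|lborel. I \<tau>)" for t
  have quad: "\<bar>\<Phi> t - \<Phi> s\<bar> \<le> (2 * L + 2 * K) * (t - s)\<^sup>2" if st: "0 \<le> s" "s \<le> t" "t \<le> T" for s t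
  proof -
    have tT: "t \<in> {0..T}" using st by auto
    note Hs = slice[OF \<phi>H, of s] and Ht = slice[OF \<phi>H, of t] and \<psi>s = slice[OF \<psi>H, of s]
    have int: "integrable (m \<tau>) w" if "\<tau> \<in> {0..T}" "w \<in> holder_ball \<beta> a c" for w :: "'a \<Rightarrow> real" and \<tau> a c
      by (rule abs_integral_le(2)[OF pm[OF that(1)] holder_continuous[OF that(2) \<beta>(1)] holder_ballD(1)[OF that(2)]])
    define J where "J \<tau> = flux (\<lambda>y. \<phi> (s, y)) m \<tau>" for \<tau>
    define P where "P = (\<integral>x. \<psi> (s, x) \<partial>m t)"
    have Ji: "set_integrable lborel {s<..<t} J"
      unfolding J_def by (rule set_integrable_subset[OF flux_integrable[OF mc Hs tT]]) (use st in auto)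
    have Pi: "set_integrable lborel {s<..<t} (\<lambda>_. P)"
      unfolding set_integrable_def
      by (intro integrable_scaleR_left integrable_real_indicator) (auto simp: emeasure_lborel_Ioo_finite)
    have e1: "\<bar>(\<integral>x. \<phi> (t, x) \<partial>m t) - (\<integral>x. \<phi> (s, x) \<partial>m t) - (t - s) * P\<bar> \<le> L * (t - s)\<^sup>2"
    proof -
      have "(\<integral>x. \<phi> (t, x) \<partial>m t) - (\<integral>x. \<phi> (s, x) \<partial>m t) - (t - s) * P
          = (\<integral>x. \<phi> (t, x) - \<phi> (s, x) - (t - s) * \<psi> (s, x) \<partial>m t)"
        unfolding P_def using int[OF tT Hs] int[OF tT Ht] int[OF tT \<psi>s] by simp
      also have "\<bar>\<dots>\<bar> \<le> L * (t - s)\<^sup>2"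
        by (rule abs_integral_le(1)[OF pm[OF tT] _ taylor[OF st(2)]])
           (intro continuous_on_diff continuous_on_mult_left holder_continuous[OF Hs \<beta>(1)] holder_continuous[OF Ht
               \<beta>(1)] holder_continuous[OF \<psi>s \<beta>(1)])
      finally show ?thesis .
    qed
    have e2: "(\<integral>x. \<phi> (s, x) \<partial>m t) - (\<integral>x. \<phi> (s, x) \<partial>m s) = (LINT \<tau>:{s<..<t}|lborel. J \<tau>)"
      unfolding J_def by (rule holder_solution_increment(1)[OF m Hs st])
    have e3: "(LINT \<tau>:{0<..<t}|lborel. I \<tau>) = (LINT \<tau>:{0<..<s}|lborel. I \<tau>) + (LINT \<tau>:{s<..<t}|lborel. I \<tau>)"
      by (rule set_integral_Ioo_split[OF Ii]) (use st in auto)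
    have e4: "(LINT \<tau>:{s<..<t}|lborel. P + J \<tau> - I \<tau>) = (t - s) * P + (LINT \<tau>:{s<..<t}|lborel. J \<tau>)
        - (LINT \<tau>:{s<..<t}|lborel. I \<tau>)"
    proof -
      have "(LINT \<tau>:{s<..<t}|lborel. P) = (t - s) * P" using st by (simp add: set_lebesgue_integral_def)
      then show ?thesis
        using set_integral_diff(2)[OF set_integral_add(1)[OF Pi Ji] Ii[OF st(1,3)]] set_integral_add(2)[OF Pi Ji]
            by simp
    qed
    have e5: "\<bar>LINT \<tau>:{s<..<t}|lborel. P + J \<tau> - I \<tau>\<bar> \<le> ((L + 2 * K) * (t - s)) * (t - s)"
    proof (rule set_integral_Ioo_bound[OF set_integral_diff(1)[OF set_integral_add(1)[OF Pi Ji] Ii[OF st(1,3)]]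
        st(2)])
      fix \<tau> assume \<tau>: "\<tau> \<in> {s<..<t}"
      then have \<tau>T: "\<tau> \<in> {0..T}" "\<tau> \<in> {0<..<T}" using st by auto
      note H\<tau> = slice[OF \<phi>H, of \<tau>] and \<psi>\<tau> = slice[OF \<psi>H, of \<tau>]
      have "\<bar>P - (\<integral>x. \<psi> (s, x) \<partial>m \<tau>)\<bar> \<le> K * (t - \<tau>)"
        unfolding P_def K_def by (rule holder_solution_increment(2)[OF m \<psi>s]) (use st \<tau> in auto)
      also have "\<dots> \<le> K * (t - s)" using K0 \<tau> by (intro mult_left_mono) auto
      finally have 1: "\<bar>P - (\<integral>x. \<psi> (s, x) \<partial>m \<tau>)\<bar> \<le> K * (t - s)" .
      have 2: "\<bar>(\<integral>x. \<psi> (s, x) \<partial>m \<tau>) - (\<integral>x. \<psi> (\<tau>, x) \<partial>m \<tau>)\<bar> \<le> L * (t - s)"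
      proof -
        have "(\<integral>x. \<psi> (s, x) \<partial>m \<tau>) - (\<integral>x. \<psi> (\<tau>, x) \<partial>m \<tau>) = (\<integral>x. \<psi> (s, x) - \<psi> (\<tau>, x) \<partial>m \<tau>)"
          using int[OF \<tau>T(1) \<psi>s] int[OF \<tau>T(1) \<psi>\<tau>] by simp
        also have "\<bar>\<dots>\<bar> \<le> L * (t - s)"
        proof (rule abs_integral_le(1)[OF pm[OF \<tau>T(1)]])
          show "continuous_on UNIV (\<lambda>x. \<psi> (s, x) - \<psi> (\<tau>, x))"
            by (intro continuous_on_diff holder_continuous[OF \<psi>s \<beta>(1)] holder_continuous[OF \<psi>\<tau> \<beta>(1)])
          fix x
          have "\<bar>\<psi> (s, x) - \<psi> (\<tau>, x)\<bar> \<le> L * dist (s, x) (\<tau>, x)" by (rule \<psi>L)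
          also have "dist (s, x) (\<tau>, x) = \<tau> - s" using \<tau> by (simp add: dist_Pair_Pair dist_real_def)
          also have "L * (\<tau> - s) \<le> L * (t - s)" using \<tau> \<psi>L by (intro mult_left_mono) auto
          finally show "\<bar>\<psi> (s, x) - \<psi> (\<tau>, x)\<bar> \<le> L * (t - s)" .
        qed
        finally show ?thesis .
      qed
      let ?f = "\<lambda>s x. b \<tau> x * levy_op \<nu> (\<lambda>y. \<phi> (s, y)) x"
      have fc: "continuous_on UNIV (?f s)" for s
        by (rule continuous_section[OF flux_continuous[OF slice[OF \<phi>H]] \<tau>T(2)])
      have fi: "integrable (m \<tau>) (?f s)" for s
        by (rule abs_integral_le(2)[OF pm[OF \<tau>T(1)] fc flux_bound[OF slice[OF \<phi>H]]])
      have 3: "\<bar>J \<tau> - (\<integral>x. ?f \<tau> x \<partial>m \<tau>)\<bar> \<le> K * (t - s)"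
      proof -
        have "J \<tau> - (\<integral>x. ?f \<tau> x \<partial>m \<tau>) = (\<integral>x. ?f s x - ?f \<tau> x \<partial>m \<tau>)"
          unfolding J_def by (rule Bochner_Integration.integral_diff[OF fi fi, symmetric])
        also have "\<bar>\<dots>\<bar> \<le> K * (t - s)"
        proof (rule abs_integral_le(1)[OF pm[OF \<tau>T(1)] continuous_on_diff[OF fc fc]])
          fix x
          have "\<bar>?f s x - ?f \<tau> x\<bar> = \<bar>b \<tau> x\<bar> * \<bar>levy_op \<nu> (\<lambda>y. \<phi> (\<tau>, y)) x - levy_op \<nu> (\<lambda>y. \<phi> (s, y)) x\<bar>"
            by (simp add: abs_mult[symmetric] right_diff_distrib abs_minus_commute)
          also have "\<dots> \<le> B * ((2 * a1 + c1) * M * (\<tau> - s))"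
            using b_range[of \<tau> x] levy_time[of s \<tau> x] \<tau> B by (intro mult_mono) auto
          also have "\<dots> = K * (\<tau> - s)" by (simp add: K_def)
          also have "\<dots> \<le> K * (t - s)" using K0 \<tau> by (intro mult_left_mono) auto
          finally show "\<bar>?f s x - ?f \<tau> x\<bar> \<le> K * (t - s)" .
        qed
        finally show ?thesis .
      qed
      have "I \<tau> = (\<integral>x. \<psi> (\<tau>, x) \<partial>m \<tau>) + (\<integral>x. ?f \<tau> x \<partial>m \<tau>)"
        unfolding I_def g_def by (rule Bochner_Integration.integral_add[OF int[OF \<tau>T(1) \<psi>\<tau>] fi])
      then show "\<bar>P + J \<tau> - I \<tau>\<bar> \<le> (L + 2 * K) * (t - s)" using 1 2 3 by (simp add: algebra_simps)
    qed
    have "\<Phi> t - \<Phi> s = ((\<integral>x. \<phi> (t, x) \<partial>m t) - (\<integral>x. \<phi> (s, x) \<partial>m t) - (t - s) * P)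
        + (LINT \<tau>:{s<..<t}|lborel. P + J \<tau> - I \<tau>)"
      unfolding \<Phi>_def e4 e3 using e2 by simp
    then have "\<bar>\<Phi> t - \<Phi> s\<bar> \<le> L * (t - s)\<^sup>2 + ((L + 2 * K) * (t - s)) * (t - s)" using e1 e5 by linarith
    then show ?thesis by (simp add: power2_eq_square algebra_simps)
  qed
  have "\<Phi> t = \<Phi> 0" by (rule constant_of_quadratic_increment[OF quad t])
  moreover have "\<Phi> 0 = (\<integral>x. \<phi> (0, x) \<partial>m0)"
  proof -
    have "(\<integral>x. \<phi> (0, x) \<partial>m 0) = (\<integral>x. \<phi> (0, x) \<partial>m0)
        + (LINT \<tau>:{0<..<0}|lborel. (\<integral>x. b \<tau> x * levy_op \<nu> (\<lambda>x. \<phi> (0, x)) x \<partial>m \<tau>))"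
      using m slice[OF \<phi>H, of 0] T unfolding holder_solution_def by fastforce
    then show ?thesis by (simp add: \<Phi>_def set_lebesgue_integral_def)
  qed
  moreover have "(\<integral>x. deriv (\<lambda>s. \<phi> (s, x)) \<tau> + b \<tau> x * levy_op \<nu> (\<lambda>y. \<phi> (\<tau>, y)) x \<partial>m \<tau>) = I \<tau>" for \<tau>
    unfolding I_def g_def DERIV_imp_deriv[OF dt] ..
  ultimately show ?thesis by (simp add: \<Phi>_def)
qed

theorem weak_solution_exists:
  assumes m0: "m0 \<in> borel_probs"
  shows "\<exists>m. very_weak_solution T \<nu> b m0 m"
proof -
  have "prob_space m0" "sets m0 = sets borel" using m0 by (auto simp: borel_probs_def)
  from exists_holder_solution[OF this] obtain m where m: "holder_solution m0 m" "m \<in> extensional {0..T}"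
    by blast
  then show ?thesis
    using holder_solution_narrow[OF m] holder_solution_weak[OF m(1)] by (auto simp: very_weak_solution_def)
qed

end

lemma very_weak_solution_cong:
  assumes "\<And>t x. t \<in> {0<..<T} \<Longrightarrow> b t x = b' t x"
  shows "very_weak_solution T \<nu> b m0 m \<longleftrightarrow> very_weak_solution T \<nu> b' m0 m"
proof -
  have "(LINT \<tau>:{0<..<t}|lborel. (\<integral>x. deriv (\<lambda>s. \<phi> (s, x)) \<tau> + b \<tau> x * levy_op \<nu> (\<lambda>y. \<phi> (\<tau>, y)) x \<partial>m \<tau>))
     = (LINT \<tau>:{0<..<t}|lborel. (\<integral>x. deriv (\<lambda>s. \<phi> (s, x)) \<tau> + b' \<tau> x * levy_op \<nu> (\<lambda>y. \<phi> (\<tau>, y)) x \<partial>m \<tau>))"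
    if "t \<in> {0..T}" for t and \<phi> :: "real \<times> 'a \<Rightarrow> real"
    by (rule set_lebesgue_integral_cong) (use assms that in auto)
  then show ?thesis by (simp add: very_weak_solution_def)
qed

text \<open>The seminorm sees only points at distance less than one; at larger distance the bound on the values suffices.\<close>

lemma holder_seminorm_finite_imp_holder:
  fixes f :: "'a::euclidean_space \<Rightarrow> real"
  assumes "holder_seminorm \<beta> f \<le> ennreal C" "C \<ge> 0" "\<beta> > 0" and f: "\<And>x. 0 \<le> f x \<and> f x \<le> B"
  shows "\<bar>f x - f y\<bar> \<le> (C + B) * norm (x - y) powr \<beta>"
proof -
  have B: "B \<ge> 0" using f[of x] by linarith
  consider "x = y" | "x \<noteq> y" "norm (x - y) < 1" | "norm (x - y) \<ge> 1" by linarith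
  then show ?thesis
  proof cases
    case 2
    then have y: "y \<in> ball x 1 - {x}" by (simp add: dist_norm)
    have "ennreal (\<bar>f x - f y\<bar> / norm (x - y) powr \<beta>) \<le> (SUP y \<in> ball x 1 - {x}. ennreal (\<bar>f x - f y\<bar> / norm (x
        - y) powr \<beta>))"
      by (rule SUP_upper[OF y])
    also have "\<dots> \<le> holder_seminorm \<beta> f" unfolding holder_seminorm_def by (rule SUP_upper) simp
    finally have "\<bar>f x - f y\<bar> / norm (x - y) powr \<beta> \<le> C" using assms(1,2)
        by (simp add: ennreal_le_iff[symmetric] del: ennreal_le_iff)
    then have "\<bar>f x - f y\<bar> \<le> C * norm (x - y) powr \<beta>" using 2 by (simp add: field_simps)
    also have "\<dots> \<le> (C + B) * norm (x - y) powr \<beta>" using B by (intro mult_right_mono) auto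
    finally show ?thesis .
  next
    case 3
    then have "1 \<le> norm (x - y) powr \<beta>" using assms by (intro ge_one_powr_ge_zero) auto
    then have "(C + B) * 1 \<le> (C + B) * norm (x - y) powr \<beta>" using B assms by (intro mult_left_mono) auto
    moreover have "\<bar>f x - f y\<bar> \<le> B" using f[of x] f[of y] by linarith
    ultimately show ?thesis using assms by simp
  qed (use assms B in simp)
qed

theorem theorem2p8:
  fixes T \<sigma> K B \<beta> :: real
    and \<nu> m0 :: "'a::euclidean_space measure"
    and b :: "real \<Rightarrow> 'a \<Rightarrow> real"
  assumes T: "T > 0"
    and sigma: "0 < 2 * \<sigma>" "2 * \<sigma> < 1"
    and levy: "levy_measure \<nu>"
    and K: "K \<ge> 0"
    and levy_bound: "\<And>p r. 2 * \<sigma> < p \<Longrightarrow> p \<le> 1 \<Longrightarrow> 0 < r \<Longrightarrow> r < 1 \<Longrightarrow>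
          (\<integral>\<^sup>+z\<in>ball 0 1. ennreal (min 1 (norm z powr p / r powr p)) \<partial>\<nu>)
            \<le> ennreal (K / (p - 2 * \<sigma>) * r powr (- (2 * \<sigma>)))"
    and m0: "m0 \<in> borel_probs"
    and B: "B \<ge> 0"
    and b_range: "\<And>t x. t \<in> {0<..<T} \<Longrightarrow> b t x \<in> {0..B}"
    and b_cont: "continuous_on ({0<..<T} \<times> UNIV) (\<lambda>(t, x). b t x)"
    and beta: "\<beta> > 0"
    and b_holder: "b \<in> bounded_curves {0<..<T} (holder_norm \<beta>)"
    and alternatives: "(2 * \<sigma> \<in> {0<..<(3 - sqrt 5) / 2} \<and>
                 \<beta> \<in> {2 * \<sigma> + 2 * \<sigma> / (1 - 2 * \<sigma>)<..1}) \<or>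
                (symmetric_at_origin \<nu> \<and>
                 2 * \<sigma> \<in> {0<..<(5 - sqrt 17) / 2} \<and>
                 \<beta> \<in> {2 * \<sigma> + 2 * \<sigma> / (1 - \<sigma>)<..1})"
  shows "\<exists>!m. very_weak_solution T \<nu> b m0 m"
proof -
  have "2 * \<sigma> / (1 - 2 * \<sigma>) > 0" "2 * \<sigma> / (1 - \<sigma>) > 0" using sigma by auto
  then have \<beta>: "2 * \<sigma> < \<beta>" "\<beta> \<le> 1" using alternatives by auto
  have s\<nu>[measurable_cong]: "sets \<nu> = sets borel" using levy by (simp add: levy_measure_def)
  have moment: "(\<integral>\<^sup>+z. ennreal (min 1 (norm z powr \<beta>)) \<partial>\<nu>) < \<infinity>"
  proof -
    have [measurable]: "ball (0::'a) 1 \<in> sets borel" by simp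
    have "ennreal (min 1 (norm z powr \<beta>)) \<le> ennreal (min 1 (norm z powr \<beta> / (1/2) powr \<beta>)) * indicator (ball 0 1) z
        + ennreal (min 1 (norm z))" for z :: 'a
    proof (cases "norm z < 1")
      case True
      have "(1/2::real) powr \<beta> \<le> 1" using beta by (intro powr_le1) auto
      then have "norm z powr \<beta> / 1 \<le> norm z powr \<beta> / (1/2) powr \<beta>" by (intro divide_left_mono) auto
      then have "ennreal (min 1 (norm z powr \<beta>)) \<le> ennreal (min 1 (norm z powr \<beta> / (1/2) powr \<beta>))"
        by (intro ennreal_leI min.mono) auto
      then show ?thesis using True by (simp add: add_increasing2)
    next
      case False
      then show ?thesis by (auto intro!: ennreal_leI)
    qed
    then have "(\<integral>\<^sup>+z. ennreal (min 1 (norm z powr \<beta>)) \<partial>\<nu>)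
        \<le> (\<integral>\<^sup>+z. ennreal (min 1 (norm z powr \<beta> / (1/2) powr \<beta>)) * indicator (ball 0 1) z
        + ennreal (min 1 (norm z)) \<partial>\<nu>)" by (intro nn_integral_mono)
    also have "\<dots> = (\<integral>\<^sup>+z\<in>ball 0 1. ennreal (min 1 (norm z powr \<beta> / (1/2) powr \<beta>)) \<partial>\<nu>)
        + (\<integral>\<^sup>+z. ennreal (min 1 (norm z)) \<partial>\<nu>)"
      by (rule nn_integral_add) measurable
    also have "\<dots> < \<infinity>"
    proof -
      have "(\<integral>\<^sup>+z\<in>ball 0 1. ennreal (min 1 (norm z powr \<beta> / (1/2) powr \<beta>)) \<partial>\<nu>) < \<infinity>"
        by (rule le_less_trans[OF levy_bound[OF \<beta>]]) auto
      moreover have "(\<integral>\<^sup>+z. ennreal (min 1 (norm z)) \<partial>\<nu>) < \<infinity>" using levy by (simp add: levy_measure_def)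
      ultimately show ?thesis by simp
    qed
    finally show ?thesis .
  qed
  define S where "S = (SUP t\<in>{0<..<T}. holder_norm \<beta> (b t))"
  have S: "S < \<infinity>" using b_holder by (simp add: bounded_curves_def S_def)
  define C where "C = enn2real S"
  have C: "S = ennreal C" "C \<ge> 0" using S by (auto simp: C_def)
  \<comment> \<open>the coefficient is prescribed on the open time interval only; the extension by zero keeps the bounds\<close>
  define b' where "b' t x = (if t \<in> {0<..<T} then b t x else 0)" for t x
  have b'_range: "0 \<le> b' t x \<and> b' t x \<le> B" for t x using b_range[of t x] B by (auto simp: b'_def)
  interpret fokker_planck \<nu> b' \<beta> B "C + B" T
  proof
    show "sets \<nu> = sets borel" by (rule s\<nu>)
    show "emeasure \<nu> {0} = 0" using levy by (simp add: levy_measure_def)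
    show "0 < \<beta>" "\<beta> \<le> 1" "0 < T" by fact+
    show "(\<integral>\<^sup>+z. ennreal (min 1 (norm z powr \<beta>)) \<partial>\<nu>) < \<infinity>" by (rule moment)
    show "0 \<le> b' t x" "b' t x \<le> B" for t x using b'_range[of t x] by auto
    show "0 \<le> C + B" using C B by simp
    show "continuous_on ({0<..<T} \<times> UNIV) (\<lambda>(t, x). b' t x)"
      by (rule continuous_on_eq[OF b_cont]) (auto simp: b'_def)
    show "\<bar>b' t x - b' t y\<bar> \<le> (C + B) * norm (x - y) powr \<beta>" for t x y
    proof (cases "t \<in> {0<..<T}")
      case True
      have "holder_seminorm \<beta> (b t) \<le> holder_norm \<beta> (b t)" by (simp add: holder_norm_def)
      also have "\<dots> \<le> S" unfolding S_def by (rule SUP_upper[OF True])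
      finally have "holder_seminorm \<beta> (b t) \<le> ennreal C" by (simp add: C)
      from holder_seminorm_finite_imp_holder[OF this C(2) beta] b_range[OF True] True
      show ?thesis by (simp add: b'_def)
    next
      case False
      then have "b' t x = 0" "b' t y = 0" unfolding b'_def by (simp_all only: if_False)
      then show ?thesis using C B by simp
    qed
  qed
  have eq: "very_weak_solution T \<nu> b m0 m \<longleftrightarrow> very_weak_solution T \<nu> b' m0 m" for m
    by (rule very_weak_solution_cong) (simp add: b'_def)
  show ?thesis
    unfolding eq using weak_solution_exists[OF m0] weak_solution_unique[OF _ _ m0] by blast
qed

end
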